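(* Let $0<p<q<\infty$, $\lambda\ge p$ and $\omega\in\widehat{\mathcal D}$. Then there exists a constant $C=C(\omega,p,q,\lambda)>0$ such that for every $f\in A^p_\omega$, $$\int_0^1\omega(S(r))^{\lambda\left(\frac1p-\frac1q\right)}\|f_r\|_{A^q_\omega}^\lambda\,\frac{dr}{1-r}\le C\|f\|_{A^p_\omega}^\lambda.$$
   Context: A weight is an integrable function $\omega:\mathbb D\to[0,\infty)$ on the unit disc $\mathbb D$; it is radial if $\omega(z)=\omega(|z|)$. For a radial weight, $\widehat\omega(r)=\int_r^1\omega(s)\,ds$. $\omega\in\widehat{\mathcal D}$ means: $\omega$ is a radial weight, not a.e. zero, and there is $C>1$ with $\widehat\omega(r)\le C\,\widehat\omega\left(\frac{1+r}2\right)$ for all $0\le r<1$. $A^p_\omega$ is the space of analytic $f$ in $\mathbb D$ with $\|f\|_{A^p_\omega}^p=\int_{\mathbb D}|f|^p\omega\,dA<\infty$, $dA$ being normalized area measure. $f_r(z)=f(rz)$. Carleson square: for $a\in\mathbb D\setminus\{0\}$, $S(a)=\{z\in\mathbb D:|z|\ge|a|,\ |\arg z-\arg a|\le\frac12(1-|a|)\}$, and $\omega(S(a))=\int_{S(a)}\omega\,dA$. *)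

theory Defs
  imports "HOL-Complex_Analysis.Complex_Analysis"
begin

definition disc :: "complex set" where
  "disc = ball 0 1"

definition disc_area :: "complex measure" where
  "disc_area = scale_measure (ennreal (1 / pi)) (lebesgue_on disc)"

text \<open>Weights are total functions on the complex plane; only their values on the disc matter.\<close>

definition weight :: "(complex \<Rightarrow> real) \<Rightarrow> bool" where
  "weight \<omega> \<longleftrightarrow> (\<forall>z\<in>disc. 0 \<le> \<omega> z) \<and> integrable disc_area \<omega>"

definition radial_weight :: "(complex \<Rightarrow> real) \<Rightarrow> bool" where
  "radial_weight \<omega> \<longleftrightarrow> weight \<omega> \<and> (\<forall>z\<in>disc. \<omega> z = \<omega> (of_real (norm z)))"

text \<open>The tail integral is extended-valued: a radial weight is integrable with respect to
  \<open>s ds\<close>, so its integral over \<open>[0, 1)\<close> with respect to \<open>ds\<close> may be infinite.  A real-valued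
  Bochner integral would then be 0 and make the doubling condition at 0 vacuous.\<close>

definition weight_tail :: "(complex \<Rightarrow> real) \<Rightarrow> real \<Rightarrow> ennreal" where
  "weight_tail \<omega> r = (\<integral>\<^sup>+ s\<in>{r..<1}. ennreal (\<omega> (of_real s)) \<partial>lebesgue)"

definition D_hat :: "(complex \<Rightarrow> real) set" where
  "D_hat = {\<omega>. radial_weight \<omega> \<and> \<not> (AE z in disc_area. \<omega> z = 0) \<and>
     (\<exists>C>1. \<forall>r. 0 \<le> r \<and> r < 1 \<longrightarrow>
        weight_tail \<omega> r \<le> ennreal C * weight_tail \<omega> ((1 + r) / 2))}"

definition bergman_space :: "real \<Rightarrow> (complex \<Rightarrow> real) \<Rightarrow> (complex \<Rightarrow> complex) set" where
  "bergman_space p \<omega> = {f. f holomorphic_on disc \<and>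
     integrable disc_area (\<lambda>z. norm (f z) powr p * \<omega> z)}"

text \<open>Meaningful only for functions in \<open>bergman_space p \<omega>\<close>: the Bochner integral is 0
  otherwise.  Dilations of functions analytic in the disc always belong to the space, see
  \<open>dilation_in_bergman_space\<close> below.\<close>

definition bergman_norm :: "real \<Rightarrow> (complex \<Rightarrow> real) \<Rightarrow> (complex \<Rightarrow> complex) \<Rightarrow> real" where
  "bergman_norm p \<omega> f = (\<integral>z. norm (f z) powr p * \<omega> z \<partial>disc_area) powr (1 / p)"

definition dilation :: "real \<Rightarrow> (complex \<Rightarrow> complex) \<Rightarrow> complex \<Rightarrow> complex" where
  "dilation r f = (\<lambda>z. f (of_real r * z))"

text \<open>Arguments are determined modulo \<open>2 * pi\<close>, hence the quantification over all of them
  rather than a fixed branch, which would cut the squares meeting the negative real axis.\<close>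

definition carleson_square :: "complex \<Rightarrow> complex set" where
  "carleson_square a = {z \<in> disc. norm a \<le> norm z \<and>
     (\<exists>s t. is_Arg z s \<and> is_Arg a t \<and> \<bar>s - t\<bar> \<le> (1 - norm a) / 2)}"

definition weight_mass :: "(complex \<Rightarrow> real) \<Rightarrow> complex set \<Rightarrow> real" where
  "weight_mass \<omega> E = (LINT z:E|disc_area. \<omega> z)"

lemma dilation_in_bergman_space:
  assumes "weight \<omega>" "f holomorphic_on disc" "0 \<le> r" "r < 1" "0 < q"
  shows "dilation r f \<in> bergman_space q \<omega>"
proof -
  have r_disc: "of_real r * z \<in> cball 0 r" if "z \<in> disc" for z :: complex
    using that assms(3) by (auto simp: disc_def norm_mult mult_left_le)
  have sub: "cball 0 r \<subseteq> disc"
    using assms(4) by (auto simp: disc_def)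
  have hol: "dilation r f holomorphic_on disc"
  proof -
    have "(f \<circ> (\<lambda>z. of_real r * z)) holomorphic_on disc"
      using r_disc sub
      by (intro holomorphic_on_compose_gen[OF _ assms(2)] holomorphic_intros) auto
    then show ?thesis by (simp add: dilation_def o_def)
  qed
  have "compact (f ` cball 0 r)"
    using sub assms(2)
    by (intro compact_continuous_image) (auto intro: holomorphic_on_imp_continuous_on holomorphic_on_subset)
  then obtain B where B: "\<And>w. w \<in> cball 0 r \<Longrightarrow> norm (f w) \<le> B"
    by (meson bounded_iff compact_imp_bounded imageI)
  have bound: "norm (dilation r f z) \<le> B" if "z \<in> disc" for z
    using B[OF r_disc[OF that]] by (simp add: dilation_def)
  have space: "space disc_area = disc"
    by (simp add: disc_area_def space_scale_measure)
  have "continuous_on disc (\<lambda>z. norm (dilation r f z) powr q)"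
    using hol assms(5)
    by (intro continuous_on_powr' continuous_intros holomorphic_on_imp_continuous_on) auto
  then have meas: "(\<lambda>z. norm (dilation r f z) powr q) \<in> borel_measurable disc_area"
    unfolding disc_area_def
    by (subst measurable_cong_sets[OF sets_scale_measure refl])
       (auto simp: disc_def intro: continuous_imp_measurable_on_sets_lebesgue)
  have int: "integrable disc_area \<omega>"
    using assms(1) by (simp add: weight_def)
  have "integrable disc_area (\<lambda>z. norm (dilation r f z) powr q * \<omega> z)"
  proof (rule Bochner_Integration.integrable_bound)
    show "integrable disc_area (\<lambda>z. B powr q * \<omega> z)" using int by simp
    show "(\<lambda>z. norm (dilation r f z) powr q * \<omega> z) \<in> borel_measurable disc_area"
      using meas int by auto
    show "AE z in disc_area. norm (norm (dilation r f z) powr q * \<omega> z) \<le> norm (B powr q * \<omega> z)"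
      using bound assms(5)
      by (intro AE_I2) (auto simp: space abs_mult intro!: mult_right_mono powr_mono2)
  qed
  then show ?thesis using hol by (simp add: bergman_space_def)
qed

end

theory Submission
  imports Defs
begin

text \<open>
  Let \<open>h\<close> be the nontangential maximal function of \<open>\<bar>f\<bar>\<^sup>p\<close> and
  \<open>\<mu>(t)\<close> the \<open>\<omega>\<close>-mass of \<open>{h > t}\<close>.  Inside each circle \<open>\<bar>f\<bar>\<^bsup>p/2\<^esup>\<close> is
  dominated by the Poisson integral of its boundary values (divide out the zeros by Blaschke factors), so an \<open>L\<^sup>2\<close>
  maximal inequality, obtained from a \<open>T T\<^sup>*\<close> argument, gives
  \<open>\<integral> h \<omega> dA \<le> C \<parallel>f\<parallel>\<^sup>p\<close>.
  If \<open>\<bar>f(w)\<bar>\<^sup>p > t\<close> with \<open>\<bar>w\<bar> \<le> r\<close>, then \<open>{h > t}\<close> contains the outer part of a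
  Carleson square at \<open>w\<close>, so by doubling \<open>\<omega>(S(r)) \<le> c \<mu>(t)\<close>.
  With \<open>s = q/p\<close>, Minkowski's inequality for the level sets yields
  \<open>\<parallel>f\<^sub>r\<parallel>\<^sub>q\<^sup>p \<le> \<integral> \<mu>(t)\<^bsup>1/s\<^esup> dt\<close>, the integral taken over those \<open>t\<close> with
  \<open>\<omega>(S(r)) \<le> c \<mu>(t)\<close>.  Multiplied by \<open>\<omega>(S(r))\<^bsup>1-1/s\<^esup>\<close>, the right-hand side is at most
  \<open>C \<integral> \<mu>(t) dt = C \<integral> h \<omega> dA\<close> for every \<open>r\<close>, and also after integration
  against \<open>dr/(1-r)\<close>, because \<open>\<omega>(S(r))/(1-r)\<close> is essentially decreasing.  The first bound
  reduces the exponent \<open>\<lambda>\<close> to \<open>p\<close>, the second settles this case.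
\<close>

subsection \<open>Polar coordinates\<close>

text \<open>Working with the power \<open>p / 2\<close> admits every p > 0: the square of an
  L^2-bounded maximal function is integrable, whereas the maximal function of an L^1 function need
  not be. The approach region of a vertex at radius s contains only points of modulus below s, so h
  on that circle is controlled by f on the same circle, with a constant independent of s; a radial
  weight can then be integrated against this bound whatever its shape. Doubling enters at one place
  only. A point of modulus below r is seen from a full arc of length comparable to 1 - r only by
  vertices that lie further out, beyond (1 + r) / 2, so the tail of the weight there has to control
  the tail at r. The restriction to heights with \<open>m r \<le> c * H t\<close> restores
  homogeneity. At a fixed height it confines r to a region near the boundary where the integral in r
  is of the order of the level mass to the power 1 - 1/s. Together with the power 1/s from Minkowski
  this gives the level mass itself. Without the restriction a fixed constant would remain, and the
  integral of the level mass to the power 1/s is not controlled by the norm of f.\<close>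

lemma lborel_complex_distr:
  "lborel = distr (lborel \<Otimes>\<^sub>M lborel) borel (\<lambda>(x, y). Complex x y)"
proof (rule lborel_eqI)
  fix l u :: complex
  assume lu: "\<And>b. b \<in> Basis \<Longrightarrow> l \<bullet> b \<le> u \<bullet> b"
  have m[measurable]: "(\<lambda>(x, y). Complex x y) \<in> borel \<rightarrow>\<^sub>M borel"
    by (auto intro!: borel_measurable_continuous_onI continuous_intros simp: case_prod_beta)
  then have m2: "(\<lambda>(x, y). Complex x y) \<in> lborel \<Otimes>\<^sub>M lborel \<rightarrow>\<^sub>M borel"
    by (simp add: lborel_prod)
  have vim: "(\<lambda>(x, y). Complex x y) -` box l u = box (Re l) (Re u) \<times> box (Im l) (Im u)"
    by (auto simp: box_def Basis_complex_def)
  have "Re l \<le> Re u" "Im l \<le> Im u"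
    using lu[of 1] lu[of \<i>] by (auto simp: Basis_complex_def)
  then show "emeasure (distr (lborel \<Otimes>\<^sub>M lborel) borel (\<lambda>(x, y). Complex x y)) (box l u) =
      (\<Prod>b\<in>Basis. (u - l) \<bullet> b)"
    using m2 vim
    by (subst emeasure_distr)
       (auto simp: space_pair_measure lborel.emeasure_pair_measure_Times
         Basis_complex_def ennreal_mult)
qed simp

lemma nn_integral_lborel_complex:
  fixes F :: "complex \<Rightarrow> ennreal"
  assumes [measurable]: "F \<in> borel_measurable borel"
  shows "(\<integral>\<^sup>+z. F z \<partial>lborel) = (\<integral>\<^sup>+y. \<integral>\<^sup>+x. F (Complex x y) \<partial>lborel \<partial>lborel)"
proof -
  have m[measurable]: "(\<lambda>(x, y). Complex x y) \<in> borel \<Otimes>\<^sub>M borel \<rightarrow>\<^sub>M borel"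
    by (auto intro!: borel_measurable_continuous_onI continuous_intros simp: case_prod_beta borel_prod)
  have "(\<integral>\<^sup>+z. F z \<partial>lborel) = (\<integral>\<^sup>+p. F (case p of (x, y) \<Rightarrow> Complex x y) \<partial>(lborel \<Otimes>\<^sub>M lborel))"
    by (subst lborel_complex_distr, subst nn_integral_distr) auto
  also have "\<dots> = (\<integral>\<^sup>+y. \<integral>\<^sup>+x. F (Complex x y) \<partial>lborel \<partial>lborel)"
    by (subst lborel_pair.nn_integral_snd[symmetric]) (auto simp: case_prod_beta)
  finally show ?thesis .
qed

text \<open>The substitution \<open>u = cot \<theta>\<close>, obtained by comparing measures: the
  density \<open>1 / (1 + u\<^sup>2)\<close> and the image of Lebesgue measure on (0, pi) under the
  cotangent have the same finite mass on every half-line, which determines them.\<close>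

lemma nn_integral_arctan_density:
  fixes G :: "real \<Rightarrow> ennreal"
  assumes [measurable]: "G \<in> borel_measurable borel"
  shows "(\<integral>\<^sup>+u. ennreal (1 / (1 + u\<^sup>2)) * G (pi / 2 - arctan u) \<partial>lborel) = (\<integral>\<^sup>+\<theta>\<in>{0<..<pi}. G \<theta> \<partial>lborel)"
proof -
  have at[measurable]: "arctan \<in> borel_measurable borel"
    by (intro borel_measurable_continuous_onI continuous_intros)
  define M where "M = density lborel (\<lambda>u::real. ennreal (1 / (1 + u\<^sup>2)))"
  define N where "N = distr (density lborel (indicator {0<..<pi} :: real \<Rightarrow> ennreal)) borel (\<lambda>t. tan (pi / 2 - t))"
  have tm[measurable]: "tan \<in> borel_measurable (borel :: real measure)"
    by (simp add: tan_def[abs_def])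
  have "M = N"
  proof (rule measure_eqI_lessThan)
    have M: "emeasure M {x<..} = ennreal (pi / 2 - arctan x)" for x
    proof -
      have "emeasure M {x<..} = (\<integral>\<^sup>+u. ennreal (1 / (1 + u\<^sup>2)) * indicator {x..} u \<partial>lborel)"
        unfolding M_def
        by (subst emeasure_density, simp, simp, rule nn_integral_cong_AE,
            rule AE_mp[OF AE_lborel_singleton[of x]]) (auto simp: indicator_def)
      also have "\<dots> = ennreal (pi / 2 - arctan x)"
        by (rule nn_integral_FTC_atLeast)
           (auto intro!: derivative_eq_intros tendsto_arctan_at_top simp: field_simps)
      finally show ?thesis .
    qed
    show "emeasure M {x<..} < \<infinity>" for x by (simp add: M)
    show "emeasure M {x<..} = emeasure N {x<..}" for x
    proof -
      have eq: "{t. x < tan (pi / 2 - t)} \<inter> {0<..<pi} = {0<..<pi / 2 - arctan x}"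
      proof (intro equalityI subsetI)
        fix t assume t: "t \<in> {t. x < tan (pi / 2 - t)} \<inter> {0<..<pi}"
        then have "arctan x < arctan (tan (pi / 2 - t))" by (simp add: arctan_less_iff)
        also have "\<dots> = pi / 2 - t" using t by (intro arctan_tan) auto
        finally show "t \<in> {0<..<pi / 2 - arctan x}" using t by auto
      next
        fix t assume t: "t \<in> {0<..<pi / 2 - arctan x}"
        have "tan (arctan x) < tan (pi / 2 - t)"
          using t arctan_lbound[of x] by (intro tan_monotone) auto
        then show "t \<in> {t. x < tan (pi / 2 - t)} \<inter> {0<..<pi}"
          using t arctan_lbound[of x] by (auto simp: tan_arctan)
      qed
      have "emeasure N {x<..} = emeasure lborel ({t. x < tan (pi / 2 - t)} \<inter> {0<..<pi})"
        unfolding N_def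
        by (subst emeasure_distr, simp, simp, subst emeasure_density)
           (auto simp: vimage_def indicator_inter_arith[symmetric] Int_commute mult.commute
             simp flip: nn_integral_indicator intro!: nn_integral_cong)
      also have "\<dots> = ennreal (pi / 2 - arctan x)"
        using arctan_ubound[of x] by (simp add: eq)
      finally show ?thesis by (simp add: M)
    qed
  qed (simp_all add: M_def N_def)
  have "(\<integral>\<^sup>+u. ennreal (1 / (1 + u\<^sup>2)) * G (pi / 2 - arctan u) \<partial>lborel) = (\<integral>\<^sup>+u. G (pi / 2 - arctan u) \<partial>M)"
    unfolding M_def by (subst nn_integral_density) auto
  also have "\<dots> = (\<integral>\<^sup>+\<theta>\<in>{0<..<pi}. G (pi / 2 - arctan (tan (pi / 2 - \<theta>))) \<partial>lborel)"
    unfolding \<open>M = N\<close> N_def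
    by (subst nn_integral_distr) (auto simp: nn_integral_density mult.commute)
  also have "\<dots> = (\<integral>\<^sup>+\<theta>\<in>{0<..<pi}. G \<theta> \<partial>lborel)"
    by (intro nn_integral_cong) (auto simp: indicator_def arctan_tan)
  finally show ?thesis .
qed

lemma cis_pi_half_minus_arctan:
  "cis (pi / 2 - arctan u) = Complex (u / sqrt (1 + u\<^sup>2)) (1 / sqrt (1 + u\<^sup>2))"
  by (simp add: cis.ctr sin_diff cos_diff sin_arctan cos_arctan)

text \<open>The plane is cut into lines through the origin: \<open>x = y * u\<close> makes
  \<open>u\<close> the cotangent of the angle, and scaling \<open>y\<close> by
  \<open>1 / sqrt (1 + u\<^sup>2)\<close> makes the parameter on the line the signed distance to the
  origin. The Jacobian \<open>\<bar>y\<bar>\<close> and the scaling together produce the factor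
  \<open>\<bar>s\<bar>\<close> and the density \<open>1 / (1 + u\<^sup>2)\<close>.\<close>

lemma nn_integral_polar:
  fixes F :: "complex \<Rightarrow> ennreal"
  assumes [measurable]: "F \<in> borel_measurable borel"
  shows "(\<integral>\<^sup>+z. F z \<partial>lborel) =
    (\<integral>\<^sup>+s\<in>{0<..}. (\<integral>\<^sup>+\<theta>\<in>{0..2*pi}. ennreal s * F (of_real s * cis \<theta>) \<partial>lborel) \<partial>lborel)"
proof -
  have Cm[measurable]: "(\<lambda>p. Complex (f p) (g p)) \<in> borel_measurable M"
    if [measurable]: "f \<in> borel_measurable M" "g \<in> borel_measurable M" for f g and M :: "'z measure"
    unfolding Complex_eq by measurable
  have cm[measurable]: "cis \<in> borel_measurable borel"
    by (intro borel_measurable_continuous_onI continuous_intros)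
  have at[measurable]: "arctan \<in> borel_measurable borel"
    by (intro borel_measurable_continuous_onI continuous_intros)
  define G where "G = (\<lambda>e. \<integral>\<^sup>+s. ennreal \<bar>s\<bar> * F (of_real s * e) \<partial>lborel)"
  have Gm[measurable]: "G \<in> borel_measurable borel"
    unfolding G_def by measurable
  define g where "g = (\<lambda>\<theta>. \<integral>\<^sup>+s\<in>{0<..}. ennreal s * F (of_real s * cis \<theta>) \<partial>lborel)"
  have gm[measurable]: "g \<in> borel_measurable borel"
    unfolding g_def by measurable
  \<comment> \<open>The parameter in \<open>G\<close> runs over a whole line, hence over two
    opposite rays; the negative half is the ray at \<open>\<theta> + pi\<close>. This recovers the
    full circle from the angles in (0, pi).\<close>
  have Gg: "G (cis \<theta>) = g \<theta> + g (\<theta> + pi)" for \<theta>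
  proof -
    have "G (cis \<theta>) = (\<integral>\<^sup>+s. ennreal s * F (of_real s * cis \<theta>) * indicator {0<..} s +
        ennreal (- s) * F (of_real s * cis \<theta>) * indicator {0<..} (- s) \<partial>lborel)"
      unfolding G_def by (intro nn_integral_cong) (auto simp: indicator_def)
    also have "\<dots> = g \<theta> + (\<integral>\<^sup>+s. ennreal (- s) * F (of_real s * cis \<theta>) * indicator {0<..} (- s) \<partial>lborel)"
      unfolding g_def by (subst nn_integral_add) auto
    also have "(\<integral>\<^sup>+s. ennreal (- s) * F (of_real s * cis \<theta>) * indicator {0<..} (- s) \<partial>lborel) = g (\<theta> + pi)"
      unfolding g_def
      by (subst nn_integral_real_affine[where c="-1" and t=0]) (auto simp: cis_mult[symmetric])
    finally show ?thesis .
  qed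
  have "(\<integral>\<^sup>+z. F z \<partial>lborel) = (\<integral>\<^sup>+y. \<integral>\<^sup>+x. F (Complex x y) \<partial>lborel \<partial>lborel)"
    by (rule nn_integral_lborel_complex) simp
  also have "\<dots> = (\<integral>\<^sup>+y. \<integral>\<^sup>+u. ennreal \<bar>y\<bar> * F (Complex (y * u) y) \<partial>lborel \<partial>lborel)"
  proof (rule nn_integral_cong_AE, rule AE_mp[OF AE_lborel_singleton[of 0]], intro AE_I2 impI)
    fix y :: real assume "y \<noteq> 0"
    then have "(\<integral>\<^sup>+x. F (Complex x y) \<partial>lborel) = ennreal \<bar>y\<bar> * (\<integral>\<^sup>+u. F (Complex (0 + y * u) y) \<partial>lborel)"
      by (intro nn_integral_real_affine) auto
    then show "(\<integral>\<^sup>+x. F (Complex x y) \<partial>lborel) = (\<integral>\<^sup>+u. ennreal \<bar>y\<bar> * F (Complex (y * u) y) \<partial>lborel)"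
      by (simp add: nn_integral_cmult)
  qed
  also have "\<dots> = (\<integral>\<^sup>+u. \<integral>\<^sup>+y. ennreal \<bar>y\<bar> * F (Complex (y * u) y) \<partial>lborel \<partial>lborel)"
    by (rule lborel_pair.Fubini') simp
  also have "\<dots> = (\<integral>\<^sup>+u. ennreal (1 / (1 + u\<^sup>2)) * G (cis (pi / 2 - arctan u)) \<partial>lborel)"
  proof (rule nn_integral_cong)
    fix u :: real
    define c where "c = 1 / sqrt (1 + u\<^sup>2)"
    have pos: "1 + u\<^sup>2 > 0" by (simp add: add_pos_nonneg)
    then have c: "c > 0" "c * c = 1 / (1 + u\<^sup>2)"
      by (auto simp: c_def)
    have e: "Complex (c * s * u) (c * s) = of_real s * cis (pi / 2 - arctan u)" for s
      by (simp add: cis_pi_half_minus_arctan c_def complex_eq_iff)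
    have "(\<integral>\<^sup>+y. ennreal \<bar>y\<bar> * F (Complex (y * u) y) \<partial>lborel) =
        ennreal c * (\<integral>\<^sup>+s. ennreal \<bar>c * s\<bar> * F (Complex (c * s * u) (c * s)) \<partial>lborel)"
      using c by (subst nn_integral_real_affine[where c=c and t=0]) auto
    also have "\<dots> = ennreal c * (\<integral>\<^sup>+s. ennreal c * (ennreal \<bar>s\<bar> * F (of_real s * cis (pi / 2 - arctan u))) \<partial>lborel)"
      using c by (simp only: e) (simp add: abs_mult ennreal_mult mult.assoc)
    also have "\<dots> = ennreal c * ennreal c * G (cis (pi / 2 - arctan u))"
      unfolding G_def by (subst nn_integral_cmult) (auto simp: mult.assoc)
    finally show "(\<integral>\<^sup>+y. ennreal \<bar>y\<bar> * F (Complex (y * u) y) \<partial>lborel) =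
        ennreal (1 / (1 + u\<^sup>2)) * G (cis (pi / 2 - arctan u))"
      using c by (simp flip: ennreal_mult)
  qed
  also have "\<dots> = (\<integral>\<^sup>+\<theta>\<in>{0<..<pi}. G (cis \<theta>) \<partial>lborel)"
    by (rule nn_integral_arctan_density) measurable
  also have "\<dots> = (\<integral>\<^sup>+\<theta>\<in>{0<..<pi}. g \<theta> \<partial>lborel) + (\<integral>\<^sup>+\<theta>\<in>{0<..<pi}. g (\<theta> + pi) \<partial>lborel)"
    by (subst nn_integral_add[symmetric]) (auto simp: Gg algebra_simps intro!: nn_integral_cong)
  also have "(\<integral>\<^sup>+\<theta>\<in>{0<..<pi}. g (\<theta> + pi) \<partial>lborel) = (\<integral>\<^sup>+\<theta>\<in>{pi<..<2*pi}. g \<theta> \<partial>lborel)"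
    by (subst (2) nn_integral_real_affine[where c=1 and t=pi])
       (auto simp: add.commute indicator_def intro!: nn_integral_cong)
  also have "(\<integral>\<^sup>+\<theta>\<in>{0<..<pi}. g \<theta> \<partial>lborel) + \<dots> = (\<integral>\<^sup>+\<theta>\<in>{0..2*pi}. g \<theta> \<partial>lborel)"
  proof (subst nn_integral_add[symmetric], simp, simp, rule nn_integral_cong_AE)
    show "AE \<theta> in lborel. g \<theta> * indicator {0<..<pi} \<theta> + g \<theta> * indicator {pi<..<2*pi} \<theta> =
        g \<theta> * indicator {0..2*pi} \<theta>"
      using AE_lborel_singleton[of 0] AE_lborel_singleton[of pi] AE_lborel_singleton[of "2*pi"]
      by eventually_elim (auto simp: indicator_def)
  qed
  also have "\<dots> = (\<integral>\<^sup>+\<theta>. (\<integral>\<^sup>+s. ennreal s * F (of_real s * cis \<theta>) * indicator {0<..} s * indicator {0..2*pi} \<theta> \<partial>lborel) \<partial>lborel)"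
    unfolding g_def by (subst nn_integral_multc) auto
  also have "\<dots> = (\<integral>\<^sup>+s. (\<integral>\<^sup>+\<theta>. ennreal s * F (of_real s * cis \<theta>) * indicator {0<..} s * indicator {0..2*pi} \<theta> \<partial>lborel) \<partial>lborel)"
    by (rule lborel_pair.Fubini') simp
  also have "\<dots> = (\<integral>\<^sup>+s\<in>{0<..}. (\<integral>\<^sup>+\<theta>\<in>{0..2*pi}. ennreal s * F (of_real s * cis \<theta>) \<partial>lborel) \<partial>lborel)"
    by (subst nn_integral_multc[symmetric]) (auto simp: mult_ac)
  finally show ?thesis .
qed

subsection \<open>The Poisson integral and powers of holomorphic functions\<close>

text \<open>The Poisson kernel without its factor 1/(2 pi), which therefore appears as
  \<open>2 * pi\<close> on the other side of the estimates.\<close>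

definition poisson :: "complex \<Rightarrow> real \<Rightarrow> real" where
  "poisson w t = (1 - (norm w)\<^sup>2) / (norm (cis t - w))\<^sup>2"

lemma poisson_nonneg: "norm w \<le> 1 \<Longrightarrow> 0 \<le> poisson w t"
  by (simp add: poisson_def power_le_one)

lemma cis_neq_of_norm_less: "norm w < 1 \<Longrightarrow> cis t \<noteq> w"
  by auto

lemma continuous_on_poisson:
  assumes "norm w < 1"
  shows "continuous_on A (poisson w)"
  unfolding poisson_def using cis_neq_of_norm_less[OF assms]
  by (intro continuous_intros) auto

lemma poisson_integral_formula:
  assumes H: "H holomorphic_on cball 0 1" and w: "norm w < 1"
  shows "((\<lambda>t. H (cis t) * of_real (poisson w t)) has_integral of_real (2 * pi) * H w) {0..2*pi}"
proof -
  have nz: "1 - cnj w * u \<noteq> 0" if "norm u \<le> 1" for u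
  proof -
    have "norm (cnj w * u) < 1"
      using that w mult_left_le[of "norm u" "norm w"] by (simp add: norm_mult)
    then show ?thesis by auto
  qed
  \<comment> \<open>The extra factor equals 1 at \<open>w\<close>, and on the unit circle it turns
    the Cauchy kernel into the Poisson kernel, because \<open>cnj (cis t)\<close> is the inverse of
    \<open>cis t\<close>. Cauchy's formula for \<open>f\<close> is thus Poisson's formula for
    \<open>H\<close>.\<close>
  define f where "f = (\<lambda>u. H u * of_real (1 - (norm w)\<^sup>2) / (1 - cnj w * u))"
  have f: "f holomorphic_on cball 0 1"
    unfolding f_def using nz by (intro holomorphic_intros H) auto
  have "of_real (1 - (norm w)\<^sup>2) = 1 - cnj w * w"
    by (simp add: complex_norm_square[symmetric] mult.commute)
  then have fw: "f w = H w"
    using nz[of w] w by (simp add: f_def)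
  have "((\<lambda>u. f u / (u - w)) has_contour_integral (2 * of_real pi * \<i> * f w)) (part_circlepath 0 1 0 (2*pi))"
    using Cauchy_integral_circlepath_simple[OF f, of w] w by (simp add: circlepath_def)
  then have "((\<lambda>t. f (cis t) / (cis t - w) * \<i> * cis t) has_integral (2 * of_real pi * \<i> * f w)) {0..2*pi}"
    by (subst (asm) has_contour_integral_part_circlepath_iff) simp_all
  then have "((\<lambda>t. (1 / \<i>) * (f (cis t) / (cis t - w) * \<i> * cis t)) has_integral (1 / \<i>) * (2 * of_real pi * \<i> * f w)) {0..2*pi}"
    by (rule has_integral_mult_right)
  moreover have "(1 / \<i>) * (f (cis t) / (cis t - w) * \<i> * cis t) = H (cis t) * of_real (poisson w t)" for t
  proof -
    have a: "1 - cnj w * cis t = cis t * cnj (cis t - w)"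
      by (simp add: algebra_simps cis_cnj cis_mult)
    have *: "(1 / \<i>) * (A / (c * X) / d * \<i> * c) = A / (d * X)" if "c \<noteq> 0" for A c X d :: complex
      using that by (simp add: field_simps)
    have "(1 / \<i>) * (f (cis t) / (cis t - w) * \<i> * cis t) =
        H (cis t) * of_real (1 - (norm w)\<^sup>2) / ((cis t - w) * cnj (cis t - w))"
      unfolding f_def a by (rule *) simp
    also have "(cis t - w) * cnj (cis t - w) = of_real ((norm (cis t - w))\<^sup>2)"
      using complex_norm_square[of "cis t - w"] by simp
    finally show ?thesis by (simp add: poisson_def)
  qed
  moreover have "(1 / \<i>) * (2 * of_real pi * \<i> * f w) = of_real (2 * pi) * H w"
    by (simp add: fw)
  ultimately show ?thesis by (simp only:)
qed

lemma poisson_integral_one: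
  assumes "norm w < 1"
  shows "(poisson w has_integral 2 * pi) {0..2*pi}"
proof -
  have "((\<lambda>t. of_real (poisson w t) :: complex) has_integral of_real (2 * pi)) {0..2*pi}"
    using poisson_integral_formula[of "\<lambda>_. 1" w] assms by simp
  from has_integral_Re[OF this] show ?thesis by simp
qed

text \<open>A function without zeros has a holomorphic logarithm on the disc, hence a holomorphic
  power with exponent \<open>\<alpha>\<close>; the Poisson formula applies to that power, and taking
  norms gives the inequality.\<close>

lemma poisson_submean_nonzero:
  assumes F: "F holomorphic_on cball 0 1" and w: "norm w < 1" and "0 < \<alpha>"
    and nz: "\<And>z. norm z \<le> 1 \<Longrightarrow> F z \<noteq> 0"
  shows "2 * pi * norm (F w) powr \<alpha> \<le> integral {0..2*pi} (\<lambda>t. norm (F (cis t)) powr \<alpha> * poisson w t)"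
proof -
  obtain g where g: "g holomorphic_on cball 0 1" "\<And>z. z \<in> cball 0 1 \<Longrightarrow> F z = exp (g z)"
    using contractible_imp_holomorphic_log[OF F] nz by (auto simp: convex_imp_contractible)
  define H where "H = (\<lambda>z. exp (of_real \<alpha> * g z))"
  have H: "H holomorphic_on cball 0 1"
    unfolding H_def by (intro holomorphic_intros g)
  have nH: "norm (H z) = norm (F z) powr \<alpha>" if "norm z \<le> 1" for z
    using g(2)[of z] that by (simp add: H_def powr_def)
  have I: "((\<lambda>t. H (cis t) * of_real (poisson w t)) has_integral of_real (2 * pi) * H w) {0..2*pi}"
    by (rule poisson_integral_formula[OF H w])
  have "norm (integral {0..2*pi} (\<lambda>t. H (cis t) * of_real (poisson w t))) \<le>
      integral {0..2*pi} (\<lambda>t. norm (F (cis t)) powr \<alpha> * poisson w t)"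
  proof (rule integral_norm_bound_integral)
    show "(\<lambda>t. norm (F (cis t)) powr \<alpha> * poisson w t) integrable_on {0..2*pi}"
      using nz \<open>0 < \<alpha>\<close>
      by (intro integrable_continuous_interval continuous_intros continuous_on_poisson[OF w]
           continuous_on_powr continuous_on_compose2[OF holomorphic_on_imp_continuous_on[OF F]]) auto
  qed (use I w in \<open>auto simp: norm_mult nH poisson_nonneg has_integral_iff\<close>)
  moreover have "integral {0..2*pi} (\<lambda>t. H (cis t) * of_real (poisson w t)) = of_real (2 * pi) * H w"
    using I by (simp add: has_integral_iff)
  ultimately show ?thesis
    using w by (simp add: norm_mult nH)
qed

text \<open>Both comparisons of norms come from the identity \<open>eq\<close>, whose right-hand
  side is nonnegative on the closed disc and vanishes on the circle.\<close>

lemma blaschke_norm: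
  assumes "norm a < 1" "norm z \<le> 1"
  shows "norm (z - a) \<le> norm (1 - cnj a * z)"
    and "norm z = 1 \<Longrightarrow> norm (z - a) = norm (1 - cnj a * z)"
    and "1 - cnj a * z \<noteq> 0"
proof -
  have eq: "(norm (1 - cnj a * z))\<^sup>2 - (norm (z - a))\<^sup>2 = (1 - (norm a)\<^sup>2) * (1 - (norm z)\<^sup>2)"
    unfolding cmod_power2 by (simp add: power2_eq_square algebra_simps)
  moreover have "0 \<le> (1 - (norm a)\<^sup>2) * (1 - (norm z)\<^sup>2)"
    using assms by (intro mult_nonneg_nonneg) (auto simp: power_le_one)
  ultimately have "(norm (z - a))\<^sup>2 \<le> (norm (1 - cnj a * z))\<^sup>2" by linarith
  then show "norm (z - a) \<le> norm (1 - cnj a * z)" by (rule power2_le_imp_le) simp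
  show "norm (z - a) = norm (1 - cnj a * z)" if "norm z = 1"
    using eq that power2_eq_imp_eq[of "norm (1 - cnj a * z)" "norm (z - a)"] by auto
  have "norm (cnj a * z) < 1"
    using assms mult_left_le[of "norm z" "norm a"] by (simp add: norm_mult)
  then show "1 - cnj a * z \<noteq> 0" by auto
qed

text \<open>The zero at \<open>a\<close> is removed with its full multiplicity \<open>n\<close> at
  once, so that the zero set loses exactly one point; this permits an induction on the number of
  distinct zeros.\<close>

lemma blaschke_division:
  assumes F: "F holomorphic_on cball 0 1" and a: "norm a < 1" "F a = 0"
    and fin: "finite {z. norm z \<le> 1 \<and> F z = 0}"
  obtains G where "G holomorphic_on cball 0 1"
    "\<And>z. norm z \<le> 1 \<Longrightarrow> norm (F z) \<le> norm (G z)"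
    "\<And>z. norm z = 1 \<Longrightarrow> norm (G z) = norm (F z)"
    "{z. norm z \<le> 1 \<and> G z = 0} = {z. norm z \<le> 1 \<and> F z = 0} - {a}"
proof -
  have Fb: "F holomorphic_on ball 0 1"
    using F by (rule holomorphic_on_subset) auto
  have "\<not> F constant_on ball 0 1"
  proof
    assume "F constant_on ball 0 1"
    then have "ball 0 1 \<subseteq> {z. norm z \<le> 1 \<and> F z = 0}"
      using a unfolding constant_on_def by (force simp: dist_norm)
    then have "finite (ball (0::complex) 1)" using fin finite_subset by blast
    then show False using finite_imp_not_open[of "ball (0::complex) 1"] by simp
  qed
  then obtain g r n where g: "0 < n" "0 < r" "ball a r \<subseteq> ball 0 1" "g holomorphic_on ball a r"
      "\<And>z. z \<in> ball a r \<Longrightarrow> F z = (z - a)^n * g z" "\<And>z. z \<in> ball a r \<Longrightarrow> g z \<noteq> 0"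
    using holomorphic_factor_zero_nonconstant[OF Fb open_ball connected_ball _ a(2)] a(1)
    by (metis mem_ball_0)
  \<comment> \<open>The value at \<open>a\<close> is the one for which
    \<open>G z = g z * (1 - cnj a * z)^n\<close> holds throughout the ball around \<open>a\<close>,
    so that the singularity is removed.\<close>
  define G where "G = (\<lambda>z. if z = a then g a * (1 - cnj a * a)^n else F z * ((1 - cnj a * z) / (z - a))^n)"
  have Gr: "G z = g z * (1 - cnj a * z)^n" if "z \<in> ball a r" for z
    using g(5)[OF that] by (auto simp: G_def field_simps)
  have "G holomorphic_on ball a r \<longleftrightarrow> (\<lambda>z. g z * (1 - cnj a * z)^n) holomorphic_on ball a r"
    by (rule holomorphic_cong) (auto simp: Gr)
  then have "G holomorphic_on ball a r" using g(4) by (auto intro!: holomorphic_intros)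
  then have Ga: "G field_differentiable at a within cball 0 1"
    using g(2) by (meson centre_in_ball field_differentiable_at_within holomorphic_on_imp_differentiable_at open_ball)
  have "G field_differentiable at x within cball 0 1" if x: "x \<in> cball 0 1" for x
  proof (cases "x = a")
    case False
    have "F field_differentiable at x within cball 0 1"
      using F x by (simp add: holomorphic_on_def)
    then have "(\<lambda>z. F z * ((1 - cnj a * z) / (z - a))^n) field_differentiable at x within cball 0 1"
      using False by (auto intro!: derivative_intros)
    then show ?thesis
      by (rule field_differentiable_transform_within[rotated 3, of _ _ _ "dist x a"])
         (use False x in \<open>auto simp: G_def dist_commute\<close>)
  qed (use Ga in simp)
  then have "G holomorphic_on cball 0 1" by (simp add: holomorphic_on_def)
  moreover have "norm (F z) \<le> norm (G z)" if z: "norm z \<le> 1" for z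
  proof (cases "z = a")
    case False
    then have "1 \<le> norm (1 - cnj a * z) / norm (z - a)"
      using blaschke_norm(1)[OF a(1) z] by simp
    then have "norm (F z) * 1 \<le> norm (F z) * (norm (1 - cnj a * z) / norm (z - a)) ^ n"
      by (intro mult_left_mono one_le_power) auto
    then show ?thesis using False by (simp add: G_def norm_mult norm_power norm_divide)
  qed (use a in simp)
  moreover have "norm (G z) = norm (F z)" if z: "norm z = 1" for z
  proof -
    have "z \<noteq> a" using z a by auto
    then show ?thesis
      using blaschke_norm(2,3)[OF a(1), of z] z by (simp add: G_def norm_mult norm_power norm_divide)
  qed
  moreover have "{z. norm z \<le> 1 \<and> G z = 0} = {z. norm z \<le> 1 \<and> F z = 0} - {a}"
    using blaschke_norm(3)[OF a(1)] a g(2) g(6)[of a] g(1) by (auto simp: G_def)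
  ultimately show ?thesis by (rule that)
qed

text \<open>Induction on the number of zeros: dividing one of them out can only increase the
  left-hand side, and it leaves the integral unchanged, since that sees only the norms on the
  circle.\<close>

lemma poisson_submean_finite_zeros:
  assumes "F holomorphic_on cball 0 1" and w: "norm w < 1" and \<alpha>: "0 < \<alpha>"
    and "finite {z. norm z \<le> 1 \<and> F z = 0}"
    and "\<And>z. norm z = 1 \<Longrightarrow> F z \<noteq> 0"
  shows "2 * pi * norm (F w) powr \<alpha> \<le> integral {0..2*pi} (\<lambda>t. norm (F (cis t)) powr \<alpha> * poisson w t)"
  using assms(1,4,5)
proof (induction "card {z. norm z \<le> 1 \<and> F z = 0}" arbitrary: F)
  case 0
  then show ?case using w \<alpha> by (intro poisson_submean_nonzero) auto
next
  case (Suc n)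
  then have "{z. norm z \<le> 1 \<and> F z = 0} \<noteq> {}" by (metis card.empty nat.distinct(1))
  then obtain a where a: "norm a \<le> 1" "F a = 0" by auto
  then have a1: "norm a < 1" using Suc.prems(3)[of a] by fastforce
  obtain G where G: "G holomorphic_on cball 0 1"
    "\<And>z. norm z \<le> 1 \<Longrightarrow> norm (F z) \<le> norm (G z)"
    "\<And>z. norm z = 1 \<Longrightarrow> norm (G z) = norm (F z)"
    "{z. norm z \<le> 1 \<and> G z = 0} = {z. norm z \<le> 1 \<and> F z = 0} - {a}"
    using blaschke_division[OF Suc.prems(1) a1 a(2) Suc.prems(2)] by blast
  have "2 * pi * norm (F w) powr \<alpha> \<le> 2 * pi * norm (G w) powr \<alpha>"
    using G(2)[of w] w \<alpha> by (intro mult_left_mono powr_mono2) auto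
  also have "\<dots> \<le> integral {0..2*pi} (\<lambda>t. norm (G (cis t)) powr \<alpha> * poisson w t)"
  proof (rule Suc.hyps(1))
    show "n = card {z. norm z \<le> 1 \<and> G z = 0}"
      using Suc.hyps(2) Suc.prems(2) a unfolding G(4) by (subst card_Diff_singleton) auto
    show "finite {z. norm z \<le> 1 \<and> G z = 0}" using Suc.prems(2) unfolding G(4) by simp
    show "G z \<noteq> 0" if "norm z = 1" for z using G(3)[OF that] Suc.prems(3)[OF that] by auto
  qed (rule G(1))
  finally show ?case by (simp add: G(3))
qed

text \<open>Zeros on the unit circle cannot be divided out by Blaschke factors. Holomorphy on a
  larger disc leaves finitely many zeros in the closed unit disc once \<open>F w\<close> is nonzero,
  so the dilations by \<open>s < 1\<close> close to 1 have none on the circle; the inequality for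
  them passes to the limit by continuity.\<close>

lemma poisson_submean:
  assumes F: "F holomorphic_on ball 0 R" "1 < R" and w: "norm w < 1" and \<alpha>: "0 < \<alpha>"
  shows "2 * pi * norm (F w) powr \<alpha> \<le> integral {0..2*pi} (\<lambda>t. norm (F (cis t)) powr \<alpha> * poisson w t)"
proof (cases "F w = 0")
  case True
  have "0 \<le> integral {0..2*pi} (\<lambda>t. norm (F (cis t)) powr \<alpha> * poisson w t)"
    using w by (cases "(\<lambda>t. norm (F (cis t)) powr \<alpha> * poisson w t) integrable_on {0..2*pi}")
      (auto intro!: integral_nonneg simp: poisson_nonneg not_integrable_integral)
  then show ?thesis using True \<alpha> by simp
next
  case False
  define Z where "Z = {z \<in> cball 0 1. F z = 0}"
  have Z: "finite Z"
  proof (cases "F constant_on ball 0 R")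
    case True
    have "w \<in> ball 0 R" using w F(2) by simp
    with True False have "F z \<noteq> 0" if "z \<in> ball 0 R" for z
      using that unfolding constant_on_def by metis
    then have "Z = {}" using F(2) by (auto simp: Z_def)
    then show ?thesis by simp
  next
    case False
    show ?thesis
      unfolding Z_def by (rule holomorphic_compact_finite_zeros[OF F(1) _ _ _ _ False]) (use F in auto)
  qed
  define \<Phi> where "\<Phi> = (\<lambda>s. integral {0..2*pi} (\<lambda>t. norm (F (of_real s * cis t)) powr \<alpha> * poisson w t)
      - 2 * pi * norm (F (of_real s * w)) powr \<alpha>)"
  have cF: "continuous_on (ball 0 R) F" using F(1) by (rule holomorphic_on_imp_continuous_on)
  have in_ball: "norm (of_real s * z) < R" if "0 \<le> s" "s \<le> 1" "norm z \<le> 1" for s and z :: complex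
    using that F(2) mult_mono[of s 1 "norm z" 1] by (simp add: norm_mult)
  have "continuous_on {0..1} \<Phi>"
  proof -
    have "continuous_on ({0..1} \<times> cbox 0 (2*pi)) (\<lambda>(s, t). norm (F (of_real s * cis t)) powr \<alpha> * poisson w t)"
      unfolding case_prod_beta using \<alpha> in_ball
      by (intro continuous_intros continuous_on_powr' continuous_on_compose2[OF cF]
           continuous_on_compose2[OF continuous_on_poisson[OF w, of UNIV]]) auto
    then have "continuous_on {0..1} (\<lambda>s. integral {0..2*pi} (\<lambda>t. norm (F (of_real s * cis t)) powr \<alpha> * poisson w t))"
      using integral_continuous_on_param[of "{0..1}" 0 "2*pi"] by simp
    moreover have "continuous_on {0..1} (\<lambda>s. norm (F (of_real s * w)) powr \<alpha>)"
      using \<alpha> in_ball[of _ w] w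
      by (intro continuous_intros continuous_on_powr' continuous_on_compose2[OF cF]) auto
    ultimately show ?thesis
      unfolding \<Phi>_def by (intro continuous_on_diff continuous_on_mult_left)
  qed
  then have "(\<Phi> \<longlongrightarrow> \<Phi> 1) (at 1 within {0..1})"
    by (auto simp: continuous_on_def)
  then have lim: "(\<Phi> \<longlongrightarrow> \<Phi> 1) (at_left 1)"
    by (simp add: at_within_Icc_at_left)
  have "\<not> (1::real) islimpt norm ` Z"
    using Z by (simp add: islimpt_finite)
  then have "eventually (\<lambda>s. s \<notin> norm ` Z) (at_left 1)"
    by (auto simp: islimpt_iff_eventually intro: filter_leD[OF at_le])
  moreover have "eventually (\<lambda>s::real. s \<in> {0<..<1}) (at_left 1)"
    by (rule eventually_at_leftI[of 0]) auto
  ultimately have "eventually (\<lambda>s. 0 \<le> \<Phi> s) (at_left 1)"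
  proof eventually_elim
    case (elim s)
    have "2 * pi * norm ((\<lambda>z. F (of_real s * z)) w) powr \<alpha> \<le>
        integral {0..2*pi} (\<lambda>t. norm ((\<lambda>z. F (of_real s * z)) (cis t)) powr \<alpha> * poisson w t)"
    proof (rule poisson_submean_finite_zeros[OF _ w \<alpha>])
      have "F \<circ> (\<lambda>z. of_real s * z) holomorphic_on cball 0 1"
        using elim in_ball[of s] by (intro holomorphic_on_compose_gen[OF _ F(1)] holomorphic_intros) auto
      then show "(\<lambda>z. F (of_real s * z)) holomorphic_on cball 0 1" by (simp add: o_def)
      have "{z. norm z \<le> 1 \<and> F (of_real s * z) = 0} \<subseteq> (\<lambda>z. z / of_real s) ` Z"
      proof
        fix z assume z: "z \<in> {z. norm z \<le> 1 \<and> F (of_real s * z) = 0}"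
        then have "of_real s * z \<in> Z"
          using elim mult_mono[of s 1 "norm z" 1] by (auto simp: Z_def norm_mult)
        then show "z \<in> (\<lambda>z. z / of_real s) ` Z" using elim by (intro image_eqI[of _ _ "of_real s * z"]) auto
      qed
      then show "finite {z. norm z \<le> 1 \<and> F (of_real s * z) = 0}" using Z finite_surj by blast
      show "F (of_real s * z) \<noteq> 0" if "norm z = 1" for z
      proof
        assume "F (of_real s * z) = 0"
        then have "of_real s * z \<in> Z" using elim that by (auto simp: Z_def norm_mult)
        then have "norm (of_real s * z) \<in> norm ` Z" by blast
        then show False using elim that by (simp add: norm_mult)
      qed
    qed
    then show ?case by (simp add: \<Phi>_def)
  qed
  then have "0 \<le> \<Phi> 1" using lim by (intro tendsto_lowerbound[OF lim]) auto
  then show ?thesis by (simp add: \<Phi>_def)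
qed

subsection \<open>Maximal functions on the circle\<close>

lemma ennreal_le_of_square_le:
  fixes x c :: ennreal
  assumes "x * x \<le> c * x" "x < top"
  shows "x \<le> c"
proof (cases "x = 0")
  case False
  then show ?thesis
    using assms mult_right_mono[of c x x]
    by (metis ennreal_mult_le_mult_iff less_irrefl mult.commute)
qed simp

text \<open>Let T be the operator with kernel \<open>K\<close>, so \<open>v = T u\<close> and
  \<open>z = T* v\<close>. The last hypothesis bounds the kernel of T T* by \<open>A\<close> times
  the sum of \<open>K\<close> and its transpose. Hence the squared norm \<open>Z\<close>, which is
  the pairing of v with T T* v, is at most \<open>2 * A\<close> times the pairing of v with z, and
  Cauchy-Schwarz gives \<open>Z \<le> (2 * A)\<^sup>2 * V\<close>. Duality turns this bound for T*
  into one for T. The bounds \<open>B\<close> and \<open>B'\<close> make \<open>V\<close> and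
  \<open>Z\<close> finite, so that they may be cancelled; they do not enter the constant.\<close>

lemma quasi_symmetric_kernel_L2:
  fixes K :: "'a \<Rightarrow> 'a \<Rightarrow> ennreal" and u :: "'a \<Rightarrow> ennreal"
  assumes "finite_measure M"
    and [measurable]: "case_prod K \<in> borel_measurable (M \<Otimes>\<^sub>M M)" "u \<in> borel_measurable M"
    and bnd: "\<And>x t. x \<in> space M \<Longrightarrow> t \<in> space M \<Longrightarrow> K x t \<le> ennreal B"
      "\<And>t. t \<in> space M \<Longrightarrow> u t \<le> ennreal B'"
    and A: "\<And>x y. x \<in> space M \<Longrightarrow> y \<in> space M \<Longrightarrow>
      (\<integral>\<^sup>+t. K x t * K y t \<partial>M) \<le> A * (K x y + K y x)"
  shows "(\<integral>\<^sup>+x. (\<integral>\<^sup>+t. K x t * u t \<partial>M)\<^sup>2 \<partial>M) \<le> (2 * A)\<^sup>2 * (\<integral>\<^sup>+t. (u t)\<^sup>2 \<partial>M)"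
proof -
  interpret finite_measure M by fact
  interpret pair_sigma_finite M M ..
  define m where "m = emeasure M (space M)"
  have m: "m < top" by (simp add: m_def less_top[symmetric])
  define v where "v = (\<lambda>x. \<integral>\<^sup>+t. K x t * u t \<partial>M)"
  define z where "z = (\<lambda>t. \<integral>\<^sup>+x. K x t * v x \<partial>M)"
  have [measurable]: "v \<in> borel_measurable M" unfolding v_def by measurable
  have [measurable]: "z \<in> borel_measurable M" unfolding z_def by measurable
  define U where "U = (\<integral>\<^sup>+t. (u t)\<^sup>2 \<partial>M)"
  define V where "V = (\<integral>\<^sup>+t. (v t)\<^sup>2 \<partial>M)"
  define Z where "Z = (\<integral>\<^sup>+t. (z t)\<^sup>2 \<partial>M)"
  have int_bound: "(\<integral>\<^sup>+t. g t \<partial>M) \<le> c * m" if "\<And>t. t \<in> space M \<Longrightarrow> g t \<le> c" for g c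
    using nn_integral_mono[of M g "\<lambda>_. c"] that by (simp add: m_def)
  have vb: "v x \<le> ennreal B * ennreal B' * m" if "x \<in> space M" for x
    unfolding v_def by (rule int_bound) (use bnd that in \<open>auto intro!: mult_mono\<close>)
  have zb: "z x \<le> ennreal B * (ennreal B * ennreal B' * m) * m" if "x \<in> space M" for x
    unfolding z_def by (rule int_bound) (use bnd vb that in \<open>auto intro!: mult_mono\<close>)
  have "V \<le> (ennreal B * ennreal B' * m)\<^sup>2 * m"
    unfolding V_def by (rule int_bound) (use vb in \<open>auto intro!: power_mono\<close>)
  also have "\<dots> < top"
    using m by (simp add: power2_eq_square ennreal_mult_less_top)
  finally have Vfin: "V < top" .
  have "Z \<le> (ennreal B * (ennreal B * ennreal B' * m) * m)\<^sup>2 * m"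
    unfolding Z_def by (rule int_bound) (use zb in \<open>auto intro!: power_mono\<close>)
  also have "\<dots> < top"
    using m by (simp add: power2_eq_square ennreal_mult_less_top)
  finally have Zfin: "Z < top" .
  have swap: "(\<integral>\<^sup>+x. a x * (\<integral>\<^sup>+t. K x t * b t \<partial>M) \<partial>M) = (\<integral>\<^sup>+t. (\<integral>\<^sup>+x. K x t * a x \<partial>M) * b t \<partial>M)"
    if [measurable]: "a \<in> borel_measurable M" "b \<in> borel_measurable M" for a b
  proof -
    have "(\<integral>\<^sup>+x. a x * (\<integral>\<^sup>+t. K x t * b t \<partial>M) \<partial>M) = (\<integral>\<^sup>+x. (\<integral>\<^sup>+t. a x * K x t * b t \<partial>M) \<partial>M)"
      by (intro nn_integral_cong) (simp add: nn_integral_cmult[symmetric] mult.assoc)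
    also have "\<dots> = (\<integral>\<^sup>+t. (\<integral>\<^sup>+x. a x * K x t * b t \<partial>M) \<partial>M)"
      by (rule Fubini'[symmetric]) measurable
    also have "\<dots> = (\<integral>\<^sup>+t. (\<integral>\<^sup>+x. K x t * a x \<partial>M) * b t \<partial>M)"
      by (intro nn_integral_cong) (simp add: nn_integral_multc mult.commute[of "a _"])
    finally show ?thesis .
  qed
  have "V = (\<integral>\<^sup>+x. v x * (\<integral>\<^sup>+t. K x t * u t \<partial>M) \<partial>M)"
    by (simp add: V_def v_def power2_eq_square)
  also have "\<dots> = (\<integral>\<^sup>+t. z t * u t \<partial>M)"
    unfolding z_def by (rule swap) measurable
  finally have VV: "V\<^sup>2 \<le> Z * U"
    unfolding Z_def U_def by (simp add: Cauchy_Schwarz_nn_integral)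
  have inner: "(\<integral>\<^sup>+t. K x t * z t \<partial>M) \<le> A * ((\<integral>\<^sup>+y. K x y * v y \<partial>M) + z x)" if x: "x \<in> space M" for x
  proof -
    have "(\<integral>\<^sup>+t. K x t * z t \<partial>M) = (\<integral>\<^sup>+t. z t * K x t \<partial>M)" by (simp add: mult.commute)
    also have "\<dots> = (\<integral>\<^sup>+y. v y * (\<integral>\<^sup>+t. K y t * K x t \<partial>M) \<partial>M)"
      unfolding z_def by (rule swap[symmetric]) (use x in measurable)
    also have "\<dots> \<le> (\<integral>\<^sup>+y. v y * (A * (K y x + K x y)) \<partial>M)"
      using A x by (intro nn_integral_mono mult_left_mono) auto
    also have "\<dots> = (\<integral>\<^sup>+y. A * (K x y * v y + K y x * v y) \<partial>M)"
      by (intro nn_integral_cong) (simp add: algebra_simps)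
    also have "\<dots> = A * ((\<integral>\<^sup>+y. K x y * v y \<partial>M) + z x)"
      unfolding z_def using x by (subst nn_integral_cmult, measurable, subst nn_integral_add) auto
    finally show ?thesis .
  qed
  have "Z = (\<integral>\<^sup>+t. z t * z t \<partial>M)" by (simp add: Z_def power2_eq_square)
  also have "\<dots> = (\<integral>\<^sup>+x. v x * (\<integral>\<^sup>+t. K x t * z t \<partial>M) \<partial>M)"
    by (subst swap) (auto simp: z_def)
  also have "\<dots> \<le> (\<integral>\<^sup>+x. v x * (A * ((\<integral>\<^sup>+y. K x y * v y \<partial>M) + z x)) \<partial>M)"
    using inner by (intro nn_integral_mono mult_left_mono) auto
  also have "\<dots> = (\<integral>\<^sup>+x. A * (v x * (\<integral>\<^sup>+y. K x y * v y \<partial>M) + v x * z x) \<partial>M)"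
    by (intro nn_integral_cong) (simp add: algebra_simps)
  also have "\<dots> = A * ((\<integral>\<^sup>+x. v x * (\<integral>\<^sup>+y. K x y * v y \<partial>M) \<partial>M) + (\<integral>\<^sup>+x. v x * z x \<partial>M))"
    by (subst nn_integral_cmult, measurable, subst nn_integral_add) auto
  also have "(\<integral>\<^sup>+x. v x * (\<integral>\<^sup>+y. K x y * v y \<partial>M) \<partial>M) = (\<integral>\<^sup>+x. v x * z x \<partial>M)"
    by (subst swap) (auto simp: z_def mult.commute)
  also have "A * ((\<integral>\<^sup>+x. v x * z x \<partial>M) + (\<integral>\<^sup>+x. v x * z x \<partial>M)) = 2 * A * (\<integral>\<^sup>+x. v x * z x \<partial>M)"
    by (simp add: mult_2 algebra_simps)
  finally have "Z\<^sup>2 \<le> (2 * A * (\<integral>\<^sup>+x. v x * z x \<partial>M))\<^sup>2"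
    by (rule power_mono) simp
  also have "\<dots> \<le> (2 * A)\<^sup>2 * (V * Z)"
    unfolding power_mult_distrib[of "2 * A"] V_def Z_def
    by (intro mult_left_mono Cauchy_Schwarz_nn_integral) auto
  finally have "Z * Z \<le> ((2 * A)\<^sup>2 * V) * Z"
    by (simp only: power2_eq_square[of Z] mult.assoc)
  then have Z: "Z \<le> (2 * A)\<^sup>2 * V"
    using Zfin by (rule ennreal_le_of_square_le)
  have "V * V \<le> Z * U" using VV by (simp only: power2_eq_square)
  also have "\<dots> \<le> ((2 * A)\<^sup>2 * V) * U" using Z by (rule mult_right_mono) simp
  also have "\<dots> = ((2 * A)\<^sup>2 * U) * V" by (simp only: mult.assoc mult.commute[of V U])
  finally have "V \<le> (2 * A)\<^sup>2 * U"
    using Vfin by (rule ennreal_le_of_square_le)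
  then show ?thesis by (simp add: V_def U_def v_def)
qed

text \<open>Comparable to the Poisson kernel at radius \<open>1 - \<delta>\<close>.\<close>

definition kern :: "real \<Rightarrow> real \<Rightarrow> real" where
  "kern \<delta> x = \<delta> / (\<delta>\<^sup>2 + (sin (x / 2))\<^sup>2)"

section \<open>Comparison estimates for the kernel\<close>

lemma kern_nonneg: "0 \<le> \<delta> \<Longrightarrow> 0 \<le> kern \<delta> x"
  by (simp add: kern_def)

lemma kern_even: "kern \<delta> (x - y) = kern \<delta> (y - x)"
proof -
  have "sin ((x - y) / 2) = - sin ((y - x) / 2)"
    unfolding sin_minus[symmetric] by (rule arg_cong[of _ _ sin]) (simp add: field_simps)
  then show ?thesis by (simp add: kern_def)
qed

lemma kern_le: "0 < \<delta> \<Longrightarrow> kern \<delta> x \<le> 1 / \<delta>"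
  by (simp add: kern_def power2_eq_square field_simps add_pos_nonneg)

lemma kern_le_kern:
  assumes "0 < \<delta>" "0 < \<delta>'" "\<delta> * (\<delta>'\<^sup>2 + (sin (y / 2))\<^sup>2) \<le> c * \<delta>' * (\<delta>\<^sup>2 + (sin (x / 2))\<^sup>2)"
  shows "kern \<delta> x \<le> c * kern \<delta>' y"
proof -
  have "0 < \<delta>\<^sup>2 + (sin (x / 2))\<^sup>2" "0 < \<delta>'\<^sup>2 + (sin (y / 2))\<^sup>2"
    using assms by (auto intro!: add_pos_nonneg)
  then show ?thesis using assms(3) by (simp add: kern_def field_simps)
qed

lemma kern_scale:
  assumes "0 < \<delta>" "\<delta> \<le> \<delta>'" "\<delta>' \<le> 2 * \<delta>"
  shows "kern \<delta> x \<le> 2 * kern \<delta>' x"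
proof (rule kern_le_kern)
  have "\<delta> * \<delta>'\<^sup>2 \<le> 2 * \<delta>' * \<delta>\<^sup>2"
    using assms mult_left_mono[of \<delta>' "2 * \<delta>" "\<delta> * \<delta>'"] by (simp add: power2_eq_square mult_ac)
  moreover have "\<delta> * (sin (x / 2))\<^sup>2 \<le> 2 * \<delta>' * (sin (x / 2))\<^sup>2"
    using assms by (intro mult_right_mono) auto
  ultimately show "\<delta> * (\<delta>'\<^sup>2 + (sin (x / 2))\<^sup>2) \<le> 2 * \<delta>' * (\<delta>\<^sup>2 + (sin (x / 2))\<^sup>2)"
    by (simp add: algebra_simps)
qed (use assms in auto)

lemma abs_sin_half_add_le: "\<bar>sin ((a + b) / 2)\<bar> \<le> \<bar>sin (a / 2)\<bar> + \<bar>sin (b / 2)\<bar>" for a b :: real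
proof -
  have "\<bar>sin ((a + b) / 2)\<bar> \<le> \<bar>sin (a / 2)\<bar> * \<bar>cos (b / 2)\<bar> + \<bar>cos (a / 2)\<bar> * \<bar>sin (b / 2)\<bar>"
    unfolding add_divide_distrib sin_add by (simp flip: abs_mult)
  also have "\<dots> \<le> \<bar>sin (a / 2)\<bar> * 1 + 1 * \<bar>sin (b / 2)\<bar>"
    by (intro add_mono mult_mono) auto
  finally show ?thesis by simp
qed

lemma square_add_le: "(x + y)\<^sup>2 \<le> 2 * x\<^sup>2 + 2 * y\<^sup>2" for x y :: real
  using zero_le_power2[of "x - y"] by (simp add: power2_eq_square algebra_simps)

text \<open>A Harnack type estimate: \<open>\<bar>sin (y / 2)\<bar>\<close> exceeds
  \<open>\<bar>sin (x / 2)\<bar>\<close> by at most \<open>\<delta> / 2\<close>, and this excess is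
  absorbed by the term \<open>\<delta>\<^sup>2\<close> of the denominator. It allows the angle of a
  point in an approach region to be replaced by the angle of the vertex.\<close>

lemma kern_shift:
  assumes "0 < \<delta>" "\<bar>x - y\<bar> \<le> \<delta>"
  shows "kern \<delta> x \<le> 3 * kern \<delta> y"
proof (rule kern_le_kern)
  have "\<bar>sin (y / 2)\<bar> \<le> \<bar>sin (x / 2)\<bar> + \<bar>sin ((y - x) / 2)\<bar>"
    using abs_sin_half_add_le[of x "y - x"] by simp
  also have "\<dots> \<le> \<bar>sin (x / 2)\<bar> + \<delta> / 2"
    using abs_sin_x_le_abs_x[of "(y - x) / 2"] assms by auto
  finally have "(sin (y / 2))\<^sup>2 \<le> (\<bar>sin (x / 2)\<bar> + \<delta> / 2)\<^sup>2"
    using power_mono[of "\<bar>sin (y / 2)\<bar>" _ 2] by simp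
  also have "\<dots> \<le> 2 * (sin (x / 2))\<^sup>2 + 2 * (\<delta> / 2)\<^sup>2"
    using square_add_le[of "\<bar>sin (x / 2)\<bar>" "\<delta> / 2"] by simp
  finally have "\<delta>\<^sup>2 + (sin (y / 2))\<^sup>2 \<le> 3 * (\<delta>\<^sup>2 + (sin (x / 2))\<^sup>2)"
    by (simp add: power_divide) (use zero_le_power2[of \<delta>] zero_le_power2[of "sin (x / 2)"] in linarith)
  from mult_left_mono[OF this, of \<delta>] show "\<delta> * (\<delta>\<^sup>2 + (sin (y / 2))\<^sup>2) \<le> 3 * \<delta> * (\<delta>\<^sup>2 + (sin (x / 2))\<^sup>2)"
    using assms(1) by (simp add: mult_ac)
qed (use assms in auto)

text \<open>One of \<open>a\<close>, \<open>b\<close> is at least half as far from 0 as \<open>a + b\<close>.\<close>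

lemma kern_product:
  assumes "0 < \<delta>" "0 < \<eta>"
  shows "kern \<delta> a * kern \<eta> b \<le> 4 * (kern \<delta> (a + b) * kern \<eta> b + kern \<delta> a * kern \<eta> (a + b))"
proof -
  have half: "kern d x \<le> 4 * kern d (a + b)"
    if "0 < d" "\<bar>sin ((a + b) / 2)\<bar> \<le> 2 * \<bar>sin (x / 2)\<bar>" for d x
  proof (rule kern_le_kern)
    have "(sin ((a + b) / 2))\<^sup>2 \<le> (2 * \<bar>sin (x / 2)\<bar>)\<^sup>2"
      using power_mono[OF that(2), of 2] by simp
    then have "d\<^sup>2 + (sin ((a + b) / 2))\<^sup>2 \<le> 4 * (d\<^sup>2 + (sin (x / 2))\<^sup>2)"
      by (simp add: power_mult_distrib) (use zero_le_power2[of d] in linarith)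
    from mult_left_mono[OF this, of d] show "d * (d\<^sup>2 + (sin ((a + b) / 2))\<^sup>2) \<le> 4 * d * (d\<^sup>2 + (sin (x / 2))\<^sup>2)"
      using that(1) by (simp add: mult_ac)
  qed (use that in auto)
  have nn: "0 \<le> kern \<delta> y" "0 \<le> kern \<eta> y" for y using assms by (auto intro!: kern_nonneg)
  show ?thesis
  proof (cases "\<bar>sin (a / 2)\<bar> \<ge> \<bar>sin (b / 2)\<bar>")
    case True
    then have "kern \<delta> a \<le> 4 * kern \<delta> (a + b)"
      using abs_sin_half_add_le[of a b] assms by (intro half) auto
    then have "kern \<delta> a * kern \<eta> b \<le> 4 * kern \<delta> (a + b) * kern \<eta> b"
      by (intro mult_right_mono nn)
    then show ?thesis using mult_nonneg_nonneg[OF nn(1)[of a] nn(2)[of "a + b"]] by simp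
  next
    case False
    then have "kern \<eta> b \<le> 4 * kern \<eta> (a + b)"
      using abs_sin_half_add_le[of a b] assms by (intro half) auto
    then have "kern \<delta> a * kern \<eta> b \<le> kern \<delta> a * (4 * kern \<eta> (a + b))"
      by (intro mult_left_mono nn)
    then show ?thesis using mult_nonneg_nonneg[OF nn(1)[of "a + b"] nn(2)[of b]] by simp
  qed
qed

lemma poisson_polar:
  "poisson (of_real r * cis \<phi>) t = (1 - r\<^sup>2) / ((1 - r)\<^sup>2 + 4 * r * (sin ((\<phi> - t) / 2))\<^sup>2)"
proof -
  have "(norm (cis t - of_real r * cis \<phi>))\<^sup>2 =
      ((cos t)\<^sup>2 + (sin t)\<^sup>2) - 2 * r * (cos \<phi> * cos t + sin \<phi> * sin t) + r\<^sup>2 * ((cos \<phi>)\<^sup>2 + (sin \<phi>)\<^sup>2)"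
    unfolding cmod_power2 by (simp add: power2_diff power_mult_distrib distrib_left
      del: sin_cos_squared_add sin_cos_squared_add2 sin_cos_squared_add3)
  also have "\<dots> = 1 - 2 * r * cos (\<phi> - t) + r\<^sup>2"
    by (simp only: cos_diff sin_cos_squared_add2 mult_1_right)
  also have "cos (\<phi> - t) = 1 - 2 * (sin ((\<phi> - t) / 2))\<^sup>2"
    using cos_double_sin[of "(\<phi> - t) / 2"] by (simp only: nonzero_mult_div_cancel_left times_divide_eq_right zero_neq_numeral not_False_eq_True)
  also have "1 - 2 * r * (1 - 2 * (sin ((\<phi> - t) / 2))\<^sup>2) + r\<^sup>2 = (1 - r)\<^sup>2 + 4 * r * (sin ((\<phi> - t) / 2))\<^sup>2"
    by (simp add: power2_eq_square algebra_simps)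
  finally show ?thesis by (simp add: poisson_def norm_mult)
qed

text \<open>By \<open>poisson_polar\<close> the two kernels differ by the factor
  \<open>1 + r\<close> in the numerator and by the factor \<open>4 * r\<close> on the sine term. The
  second matters only for small \<open>r\<close>: when \<open>r < 1/2\<close>, the term
  \<open>d\<^sup>2\<close> is at least 1/4 and dominates the sine.\<close>

lemma poisson_kern:
  assumes "0 \<le> r" "r < 1"
  shows "poisson (of_real r * cis \<phi>) t \<le> 16 * kern (1 - r) (\<phi> - t)"
    and "kern (1 - r) (\<phi> - t) \<le> 4 * poisson (of_real r * cis \<phi>) t"
proof -
  define S where "S = (sin ((\<phi> - t) / 2))\<^sup>2"
  have S: "0 \<le> S" "S \<le> 1" by (auto simp: S_def power_le_one abs_square_le_1)
  define d where "d = 1 - r"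
  have d: "0 < d" "d \<le> 1" "r = 1 - d" using assms by (auto simp: d_def)
  have P: "poisson (of_real r * cis \<phi>) t = d * (2 - d) / (d\<^sup>2 + 4 * r * S)"
    unfolding poisson_polar S_def d(3) by (simp add: power2_eq_square algebra_simps)
  have K: "kern (1 - r) (\<phi> - t) = d / (d\<^sup>2 + S)" by (simp add: kern_def S_def d_def)
  have pos: "0 < d\<^sup>2 + 4 * r * S" "0 < d\<^sup>2 + S" using d S assms by (auto intro!: add_pos_nonneg)
  have rS: "0 \<le> r * S" using S assms by simp
  have dS: "0 \<le> d * S" "0 \<le> d * d\<^sup>2" using S d by simp_all
  have "(2 - d) * (d\<^sup>2 + S) \<le> 16 * (d\<^sup>2 + 4 * r * S)"
  proof (cases "r \<ge> 1 / 2")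
    case True
    then have "S / 2 \<le> r * S" using S mult_right_mono[of "1/2" r S] by simp
    then have "2 * S \<le> 64 * (r * S)" using S by linarith
    moreover have "(2 - d) * (d\<^sup>2 + S) \<le> 2 * d\<^sup>2 + 2 * S"
      using dS by (simp add: algebra_simps)
    ultimately show ?thesis using zero_le_power2[of d] by (simp only: distrib_left mult.assoc)
  next
    case False
    then have "(1 / 2)\<^sup>2 \<le> d\<^sup>2" using d by (intro power_mono) auto
    then have "2 * S \<le> 14 * d\<^sup>2" using S by (simp add: power2_eq_square)
    then show ?thesis using rS dS by (simp add: algebra_simps)
  qed
  then have "d * ((2 - d) * (d\<^sup>2 + S)) \<le> d * (16 * (d\<^sup>2 + 4 * r * S))"
    using d by (intro mult_left_mono) auto
  then have "d * (2 - d) * (d\<^sup>2 + S) \<le> 16 * d * (d\<^sup>2 + 4 * r * S)"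
    by (simp only: mult.assoc mult.left_commute)
  then have "d * (2 - d) / (d\<^sup>2 + 4 * r * S) \<le> 16 * d / (d\<^sup>2 + S)"
    using pos by (simp only: pos_divide_le_eq pos_le_divide_eq times_divide_eq_left)
  then show "poisson (of_real r * cis \<phi>) t \<le> 16 * kern (1 - r) (\<phi> - t)"
    unfolding P K by simp
  have "r * S \<le> S" using S assms by (simp add: mult_left_le_one_le)
  then have "d\<^sup>2 + 4 * (r * S) \<le> 4 * (d\<^sup>2 + S)"
    using zero_le_power2[of d] unfolding distrib_left by linarith
  also have "4 * (d\<^sup>2 + S) \<le> 4 * (2 - d) * (d\<^sup>2 + S)"
    by (rule mult_right_mono[OF _ less_imp_le[OF pos(2)]]) (use d(2) in simp)
  finally have "d\<^sup>2 + 4 * (r * S) \<le> 4 * (2 - d) * (d\<^sup>2 + S)" .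
  from mult_left_mono[OF this less_imp_le[OF d(1)]] have "d * (d\<^sup>2 + 4 * r * S) \<le> (4 * (d * (2 - d))) * (d\<^sup>2 + S)"
    by (simp only: mult.assoc mult.left_commute)
  then have "d / (d\<^sup>2 + S) \<le> 4 * (d * (2 - d)) / (d\<^sup>2 + 4 * r * S)"
    using pos by (simp only: pos_divide_le_eq pos_le_divide_eq times_divide_eq_left)
  then show "kern (1 - r) (\<phi> - t) \<le> 4 * poisson (of_real r * cis \<phi>) t"
    unfolding P K by simp
qed

lemma kern_measurable[measurable]:
  assumes [measurable]: "f \<in> borel_measurable M" "g \<in> borel_measurable M"
  shows "(\<lambda>x. kern (f x) (g x)) \<in> borel_measurable M"
proof -
  have [measurable]: "sin \<in> borel_measurable (borel :: real measure)"
    by (intro borel_measurable_continuous_onI continuous_intros)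
  show ?thesis unfolding kern_def by measurable
qed

text \<open>The bound is four times the total mass \<open>2 * pi\<close> of the Poisson kernel at
  radius \<open>1 - \<delta>\<close>. Its uniformity in \<open>\<delta>\<close> keeps the constant
  of the maximal inequality independent of the scales.\<close>

lemma nn_integral_kern_le:
  assumes "0 < \<delta>" "\<delta> \<le> 1"
  shows "(\<integral>\<^sup>+t\<in>{0..2*pi}. ennreal (kern \<delta> (x - t)) \<partial>lborel) \<le> ennreal (8 * pi)"
proof -
  define w where "w = of_real (1 - \<delta>) * cis x"
  have w: "norm w < 1" using assms unfolding w_def norm_mult norm_cis norm_of_real by simp
  have "(\<integral>\<^sup>+t\<in>{0..2*pi}. ennreal (kern \<delta> (x - t)) \<partial>lborel) \<le>
      (\<integral>\<^sup>+t\<in>{0..2*pi}. ennreal (4 * poisson w t) \<partial>lborel)"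
    using poisson_kern(2)[of "1 - \<delta>" x] assms
    by (intro nn_integral_mono mult_right_mono ennreal_leI) (auto simp: w_def)
  also have "\<dots> = ennreal (8 * pi)"
  proof -
    have "((\<lambda>t. 4 * poisson w t) has_integral 4 * (2 * pi)) {0..2*pi}"
      using poisson_integral_one[OF w] by (rule has_integral_mult_right)
    from nn_integral_has_integral_lebesgue'[OF _ this] show ?thesis
      using w by (simp add: poisson_nonneg)
  qed
  finally show ?thesis .
qed

abbreviation circ :: "real set" where "circ \<equiv> {0..2*pi}"

text \<open>Restricting to dyadic scales makes the supremum countable and lets a measurable index
  select the scale; the price is the factor 2 of \<open>kern_scale\<close>.\<close>

definition kavg :: "(real \<Rightarrow> real) \<Rightarrow> nat \<Rightarrow> real \<Rightarrow> ennreal" where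
  "kavg u j \<theta> = (\<integral>\<^sup>+t\<in>circ. ennreal (kern ((1/2)^j) (\<theta> - t)) * ennreal (u t) \<partial>lborel)"

lemma kavg_measurable[measurable]:
  assumes [measurable]: "u \<in> borel_measurable borel"
  shows "kavg u j \<in> borel_measurable borel"
  unfolding kavg_def by measurable

text \<open>The supremum over scales is linearised: at each point a scale is selected, which turns the
  maximal function into a kernel operator with a quasi-symmetric kernel.\<close>

lemma linearized_L2:
  fixes J :: "real \<Rightarrow> nat"
  assumes [measurable]: "u \<in> borel_measurable borel" "J \<in> borel \<rightarrow>\<^sub>M count_space UNIV"
    and u: "\<And>t. t \<in> circ \<Longrightarrow> u t \<le> B" and J: "\<And>\<theta>. J \<theta> \<le> n"
  shows "(\<integral>\<^sup>+\<theta>\<in>circ. (kavg u (J \<theta>) \<theta>)\<^sup>2 \<partial>lborel) \<le> ennreal ((64 * pi)\<^sup>2) * (\<integral>\<^sup>+t\<in>circ. (ennreal (u t))\<^sup>2 \<partial>lborel)"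
proof -
  define M where "M = restrict_space lborel circ"
  have space: "space M = circ" by (simp add: M_def space_restrict_space)
  have int_M: "(\<integral>\<^sup>+t. g t \<partial>M) = (\<integral>\<^sup>+t\<in>circ. g t \<partial>lborel)" for g
    unfolding M_def by (subst nn_integral_restrict_space) auto
  have fin: "finite_measure M"
    by (rule finite_measureI) (simp add: M_def space_restrict_space emeasure_restrict_space)
  have idM: "(\<lambda>x. x) \<in> M \<rightarrow>\<^sub>M borel"
    unfolding M_def by (intro measurable_restrict_space1) simp
  define K where "K = (\<lambda>x t. ennreal (kern ((1/2)^(J x)) (x - t)))"
  have Kb: "case_prod K \<in> borel_measurable (borel \<Otimes>\<^sub>M borel)"
    unfolding K_def by measurable
  have "(\<lambda>x. x) \<in> M \<Otimes>\<^sub>M M \<rightarrow>\<^sub>M borel \<Otimes>\<^sub>M borel"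
    using measurable_Pair[OF measurable_compose[OF measurable_fst idM] measurable_compose[OF measurable_snd idM]]
    by simp
  from measurable_compose[OF this Kb] have KM[measurable]: "case_prod K \<in> borel_measurable (M \<Otimes>\<^sub>M M)" .
  have uM[measurable]: "(\<lambda>t. ennreal (u t)) \<in> borel_measurable M"
    using measurable_compose[OF idM, of "\<lambda>t. ennreal (u t)" borel] by simp
  have kM[measurable]: "(\<lambda>t. ennreal (kern a (x - t))) \<in> borel_measurable M" for a x
    using measurable_compose[OF idM, of "\<lambda>t. ennreal (kern a (x - t))" borel] by simp
  have pos: "0 < (1/2::real)^k" "(1/2::real)^k \<le> 1" for k by (auto simp: power_le_one)
  have Keq: "(\<integral>\<^sup>+t. K x t * ennreal (u t) \<partial>M) = kavg u (J x) x" for x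
    unfolding int_M kavg_def K_def ..
  have "(\<integral>\<^sup>+x. (\<integral>\<^sup>+t. K x t * ennreal (u t) \<partial>M)\<^sup>2 \<partial>M) \<le>
      (2 * ennreal (32 * pi))\<^sup>2 * (\<integral>\<^sup>+t. (ennreal (u t))\<^sup>2 \<partial>M)"
  \<comment> \<open>The bound \<open>2^n\<close> on the kernel comes from admitting only the scales
    up to \<open>n\<close>. It does not reach the constant, so \<open>n\<close> can later tend to
    infinity.\<close>
  proof (rule quasi_symmetric_kernel_L2[OF fin, where B = "2^n" and B' = B])
    fix x t
    have "kern ((1/2)^(J x)) (x - t) \<le> 1 / (1/2)^(J x)" by (rule kern_le[OF pos(1)])
    also have "\<dots> = 2^(J x)" by (simp add: power_divide)
    also have "\<dots> \<le> 2^n" using J by (intro power_increasing) auto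
    finally show "K x t \<le> ennreal (2^n)" unfolding K_def by (rule ennreal_leI)
  next
    fix x y
    define a where "a = (1/2::real)^(J x)"
    define b where "b = (1/2::real)^(J y)"
    have ab: "0 < a" "a \<le> 1" "0 < b" "b \<le> 1" using pos by (auto simp: a_def b_def)
    have "(\<integral>\<^sup>+t. K x t * K y t \<partial>M) \<le>
        (\<integral>\<^sup>+t. 4 * (ennreal (kern a (x - y)) * ennreal (kern b (y - t))) +
          4 * (ennreal (kern b (y - x)) * ennreal (kern a (x - t))) \<partial>M)"
    proof (rule nn_integral_mono)
      fix t
      have nn: "0 \<le> kern a z" "0 \<le> kern b z" for z using ab by (auto intro!: kern_nonneg)
      \<comment> \<open>The two differences add up to \<open>x - y\<close>, free of
        \<open>t\<close>: each product on the right keeps a single kernel in \<open>t\<close>, whose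
        integral is at most \<open>8 * pi\<close>. With the factor 4 this gives the quasi-symmetry
        hypothesis with constant \<open>32 * pi\<close>.\<close>
      have "kern a (x - t) * kern b (t - y) \<le>
          4 * (kern a (x - y) * kern b (t - y) + kern a (x - t) * kern b (x - y))"
        using kern_product[OF ab(1,3), of "x - t" "t - y"] by simp
      then have "kern a (x - t) * kern b (y - t) \<le>
          4 * (kern a (x - y) * kern b (y - t)) + 4 * (kern b (y - x) * kern a (x - t))"
        by (simp add: kern_even[of b t y] kern_even[of b x y] mult.commute)
      then have "ennreal (kern a (x - t) * kern b (y - t)) \<le>
          ennreal (4 * (kern a (x - y) * kern b (y - t)) + 4 * (kern b (y - x) * kern a (x - t)))"
        by (rule ennreal_leI)
      then show "K x t * K y t \<le> 4 * (ennreal (kern a (x - y)) * ennreal (kern b (y - t))) +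
          4 * (ennreal (kern b (y - x)) * ennreal (kern a (x - t)))"
        using nn by (simp add: K_def a_def b_def ennreal_mult)
    qed
    also have "\<dots> = 4 * (ennreal (kern a (x - y)) * (\<integral>\<^sup>+t. ennreal (kern b (y - t)) \<partial>M)) +
        4 * (ennreal (kern b (y - x)) * (\<integral>\<^sup>+t. ennreal (kern a (x - t)) \<partial>M))"
      by (subst nn_integral_add) (auto simp: nn_integral_cmult)
    also have "\<dots> \<le> 4 * (ennreal (kern a (x - y)) * ennreal (8 * pi)) + 4 * (ennreal (kern b (y - x)) * ennreal (8 * pi))"
      unfolding int_M using ab
      by (intro add_mono mult_left_mono nn_integral_kern_le) auto
    also have "\<dots> = ennreal (32 * pi) * (K x y + K y x)"
    proof -
      have "ennreal (32 * pi) = 4 * ennreal (8 * pi)"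
        unfolding ennreal_numeral[symmetric] by (subst ennreal_mult[symmetric]) simp_all
      then show ?thesis
        by (simp only: K_def a_def b_def distrib_left mult_ac)
    qed
    finally show "(\<integral>\<^sup>+t. K x t * K y t \<partial>M) \<le> ennreal (32 * pi) * (K x y + K y x)" .
  qed (auto simp: space intro!: ennreal_leI u)
  also have "(2 * ennreal (32 * pi))\<^sup>2 = ennreal ((64 * pi)\<^sup>2)"
  proof -
    have "2 * ennreal (32 * pi) = ennreal (64 * pi)"
      unfolding ennreal_numeral[symmetric] by (subst ennreal_mult[symmetric]) simp_all
    then show ?thesis by (simp add: ennreal_power)
  qed
  finally show ?thesis unfolding Keq unfolding int_M .
qed

text \<open>\<open>J n\<close> selects a scale among 0, ..., n at which \<open>kavg\<close> is
  largest, so \<open>linearized_L2\<close> bounds the finite maxima uniformly in \<open>n\<close>,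
  and monotone convergence gives the supremum.\<close>

lemma maximal_L2:
  assumes [measurable]: "u \<in> borel_measurable borel"
    and u: "\<And>t. t \<in> circ \<Longrightarrow> u t \<le> B"
  shows "(\<integral>\<^sup>+\<theta>\<in>circ. (SUP j. (kavg u j \<theta>)\<^sup>2) \<partial>lborel) \<le> ennreal ((64 * pi)\<^sup>2) * (\<integral>\<^sup>+t\<in>circ. (ennreal (u t))\<^sup>2 \<partial>lborel)"
proof -
  define J where "J = rec_nat (\<lambda>\<theta>. 0::nat) (\<lambda>n f \<theta>. if kavg u (f \<theta>) \<theta> \<le> kavg u (Suc n) \<theta> then Suc n else f \<theta>)"
  have J0: "J 0 = (\<lambda>\<theta>. 0)" by (simp add: J_def)
  have JS: "J (Suc n) = (\<lambda>\<theta>. if kavg u (J n \<theta>) \<theta> \<le> kavg u (Suc n) \<theta> then Suc n else J n \<theta>)" for n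
    unfolding J_def by simp
  have Jm[measurable]: "J n \<in> borel \<rightarrow>\<^sub>M count_space UNIV" for n
  proof (induction n)
    case (Suc n)
    note Suc[measurable]
    have [measurable]: "(\<lambda>\<theta>. kavg u (J n \<theta>) \<theta>) \<in> borel_measurable borel"
      by (rule measurable_compose_countable) measurable
    show ?case unfolding JS by measurable
  qed (simp add: J0)
  have Jle: "J n \<theta> \<le> n" for n \<theta>
    by (induction n) (auto simp: J0 JS le_Suc_eq)
  define v where "v = (\<lambda>n \<theta>. kavg u (J n \<theta>) \<theta>)"
  have vm[measurable]: "v n \<in> borel_measurable borel" for n
    unfolding v_def by (rule measurable_compose_countable) measurable
  have vS: "v (Suc n) \<theta> = max (v n \<theta>) (kavg u (Suc n) \<theta>)" for n \<theta>
    by (auto simp: v_def JS max_def)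
  have inc: "incseq (\<lambda>n \<theta>. (v n \<theta>)\<^sup>2 * indicator circ \<theta>)"
    by (intro incseq_SucI le_funI mult_right_mono power_mono) (auto simp: vS)
  have ge: "kavg u n \<theta> \<le> v n \<theta>" for n \<theta>
    by (cases n) (auto simp: v_def J0 vS[unfolded v_def])
  have "(\<integral>\<^sup>+\<theta>\<in>circ. (SUP j. (kavg u j \<theta>)\<^sup>2) \<partial>lborel) \<le> (\<integral>\<^sup>+\<theta>. (SUP n. (v n \<theta>)\<^sup>2 * indicator circ \<theta>) \<partial>lborel)"
  proof (rule nn_integral_mono)
    fix \<theta>
    show "(SUP j. (kavg u j \<theta>)\<^sup>2) * indicator circ \<theta> \<le> (SUP n. (v n \<theta>)\<^sup>2 * indicator circ \<theta>)"
      by (cases "\<theta> \<in> circ") (auto intro!: SUP_mono' power_mono ge)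
  qed
  also have "\<dots> = (SUP n. \<integral>\<^sup>+\<theta>\<in>circ. (v n \<theta>)\<^sup>2 \<partial>lborel)"
    using inc by (intro nn_integral_monotone_convergence_SUP) auto
  also have "\<dots> \<le> ennreal ((64 * pi)\<^sup>2) * (\<integral>\<^sup>+t\<in>circ. (ennreal (u t))\<^sup>2 \<partial>lborel)"
    unfolding v_def using u Jle by (intro SUP_least linearized_L2) auto
  finally show ?thesis .
qed

text \<open>The index set is the nontangential approach region with vertex \<open>s * cis \<theta>\<close>, in polar
  coordinates; the strict inequality makes the function lower semicontinuous, hence Borel.\<close>

definition ntmax :: "(complex \<Rightarrow> complex) \<Rightarrow> real \<Rightarrow> real \<times> real \<Rightarrow> ennreal" where
  "ntmax f p x = (SUP y \<in> {y. 0 \<le> fst y \<and> \<bar>snd y - snd x\<bar> < fst x - fst y}.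
     ennreal (norm (f (of_real (fst y) * cis (snd y))) powr p))"

lemma less_ntmax_iff:
  "t < ntmax f p x \<longleftrightarrow> (\<exists>\<rho> \<phi>. 0 \<le> \<rho> \<and> \<bar>\<phi> - snd x\<bar> < fst x - \<rho> \<and> t < ennreal (norm (f (of_real \<rho> * cis \<phi>)) powr p))"
  by (simp add: ntmax_def less_SUP_iff Bex_def conj_ac)

lemma ntmax_measurable[measurable]: "ntmax f p \<in> borel_measurable (lborel \<Otimes>\<^sub>M lborel)"
proof -
  have "ntmax f p \<in> borel_measurable borel"
  proof (rule borel_measurableI_greater)
    fix t
    have "{x. t < ntmax f p x} = (\<Union>y \<in> {y. 0 \<le> fst y \<and> t < ennreal (norm (f (of_real (fst y) * cis (snd y))) powr p)}.
        {x. \<bar>snd y - snd x\<bar> < fst x - fst y})"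
      by (auto simp: less_ntmax_iff) blast
    moreover have "open {x::real \<times> real. \<bar>snd y - snd x\<bar> < fst x - fst y}" for y :: "real \<times> real"
      by (intro open_Collect_less continuous_intros)
    ultimately have "open {x. t < ntmax f p x}" by (auto intro: open_UN)
    then show "{x \<in> space borel. t < ntmax f p x} \<in> sets borel" by simp
  qed
  then show ?thesis by (simp add: lborel_prod)
qed

section \<open>The nontangential maximal inequality on a single circle\<close>

lemma dyadic_scale:
  fixes \<delta> :: real
  assumes "0 < \<delta>" "\<delta> \<le> 1"
  obtains j :: nat where "\<delta> \<le> (1/2)^j" "(1/2)^j \<le> 2 * \<delta>"
proof -
  obtain n where "(1/2::real)^n < \<delta>" using real_arch_pow_inv[OF assms(1), of "1/2"] by auto
  define k where "k = (LEAST n. (1/2::real)^n < \<delta>)"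
  have k: "(1/2::real)^k < \<delta>" unfolding k_def by (rule LeastI) fact
  then have "k \<noteq> 0" using assms by (intro notI) simp
  then obtain j where j: "k = Suc j" by (cases k) auto
  then have "\<not> (1/2::real)^j < \<delta>"
    using not_less_Least[of j "\<lambda>n. (1/2::real)^n < \<delta>"] by (simp add: k_def)
  then show ?thesis using k that[of j] by (auto simp: j)
qed

lemma continuous_on_circle_powr:
  assumes f: "f holomorphic_on disc" and s: "0 \<le> s" "s < 1" and "0 < \<alpha>"
  shows "continuous_on A (\<lambda>t. norm (f (of_real s * cis t)) powr \<alpha>)"
proof -
  have "continuous_on A (\<lambda>t. f (of_real s * cis t))"
    by (rule continuous_on_compose2[OF holomorphic_on_imp_continuous_on[OF f]])
       (use s in \<open>auto intro!: continuous_intros simp: disc_def norm_mult\<close>)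
  then show ?thesis
    using assms by (intro continuous_on_powr' continuous_on_norm continuous_on_const) auto
qed

text \<open>Scaling the circle of radius \<open>s\<close> to the unit circle moves the point to
  modulus \<open>r = \<rho> / s\<close>, and the approach condition yields
  \<open>\<bar>\<theta> - \<phi>\<bar> \<le> 1 - r\<close>, a shift under which the kernel at scale
  \<open>1 - r\<close> is stable. The constant 96 is the product of 16 from
  \<open>poisson_kern\<close>, 3 from \<open>kern_shift\<close> and 2 from
  \<open>kern_scale\<close>; the factor \<open>2 * pi\<close>, which exceeds 6, reduces it to
  16.\<close>

lemma holomorphic_le_kavg:
  assumes f: "f holomorphic_on disc" and s: "0 < s" "s < 1" and \<alpha>: "0 < \<alpha>"
    and \<rho>: "0 \<le> \<rho>" "\<bar>\<phi> - \<theta>\<bar> < s - \<rho>"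
  shows "\<exists>j. ennreal (norm (f (of_real \<rho> * cis \<phi>)) powr \<alpha>) \<le>
    16 * kavg (\<lambda>t. norm (f (of_real s * cis t)) powr \<alpha>) j \<theta>"
proof -
  define u where "u = (\<lambda>t. norm (f (of_real s * cis t)) powr \<alpha>)"
  define r where "r = \<rho> / s"
  have r: "0 \<le> r" "r < 1" "s * r = \<rho>" using s \<rho> by (auto simp: r_def)
  have "s - \<rho> = s * (1 - r)" using r by (simp add: algebra_simps)
  also have "\<dots> \<le> 1 - r" using s r by (simp add: mult_left_le_one_le)
  finally have d: "\<bar>\<theta> - \<phi>\<bar> \<le> 1 - r" using \<rho> by linarith
  obtain j where j: "1 - r \<le> (1/2)^j" "(1/2)^j \<le> 2 * (1 - r)"
    using dyadic_scale[of "1 - r"] r by auto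
  have F: "(\<lambda>z. f (of_real s * z)) holomorphic_on ball 0 (1 / s)"
  proof -
    have "f \<circ> (\<lambda>z. of_real s * z) holomorphic_on ball 0 (1 / s)"
      using s by (intro holomorphic_on_compose_gen[OF _ f] holomorphic_intros)
        (auto simp: disc_def norm_mult field_simps)
    then show ?thesis by (simp add: o_def)
  qed
  have w: "norm (of_real r * cis \<phi>) < 1" using r by (simp add: norm_mult)
  have "2 * pi * norm (f (of_real s * (of_real r * cis \<phi>))) powr \<alpha> \<le>
      integral circ (\<lambda>t. u t * poisson (of_real r * cis \<phi>) t)"
    unfolding u_def by (rule poisson_submean[OF F _ w \<alpha>]) (use s in simp)
  moreover have "of_real s * (of_real r * cis \<phi>) = of_real \<rho> * cis \<phi>"
    using r(3) by (simp flip: mult.assoc of_real_mult)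
  ultimately have sub: "2 * pi * norm (f (of_real \<rho> * cis \<phi>)) powr \<alpha> \<le>
      integral circ (\<lambda>t. u t * poisson (of_real r * cis \<phi>) t)" by simp
  have cu: "continuous_on A u" for A
    unfolding u_def by (rule continuous_on_circle_powr[OF f]) (use s \<alpha> in auto)
  have "(\<lambda>t. u t * poisson (of_real r * cis \<phi>) t) integrable_on circ"
    by (intro integrable_continuous_interval continuous_on_mult cu continuous_on_poisson w)
  then have I: "(\<integral>\<^sup>+t\<in>circ. ennreal (u t * poisson (of_real r * cis \<phi>) t) \<partial>lborel) =
      ennreal (integral circ (\<lambda>t. u t * poisson (of_real r * cis \<phi>) t))"
    using w by (intro nn_integral_has_integral_lebesgue')
      (auto simp: u_def poisson_nonneg integrable_integral)
  have P: "poisson (of_real r * cis \<phi>) t \<le> 96 * kern ((1/2)^j) (\<theta> - t)" for t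
  proof -
    have "poisson (of_real r * cis \<phi>) t \<le> 16 * kern (1 - r) (\<phi> - t)"
      using r by (intro poisson_kern) auto
    also have "kern (1 - r) (\<phi> - t) \<le> 3 * kern (1 - r) (\<theta> - t)"
      using r d by (intro kern_shift) auto
    also have "kern (1 - r) (\<theta> - t) \<le> 2 * kern ((1/2)^j) (\<theta> - t)"
      using r j by (intro kern_scale) auto
    finally show ?thesis by simp
  qed
  have "ennreal (2 * pi) * ennreal (norm (f (of_real \<rho> * cis \<phi>)) powr \<alpha>) \<le>
      (\<integral>\<^sup>+t\<in>circ. ennreal (u t * poisson (of_real r * cis \<phi>) t) \<partial>lborel)"
    unfolding I using ennreal_leI[OF sub] by (simp add: ennreal_mult)
  also have "\<dots> \<le> (\<integral>\<^sup>+t\<in>circ. 96 * (ennreal (kern ((1/2)^j) (\<theta> - t)) * ennreal (u t)) \<partial>lborel)"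
  proof (intro nn_integral_mono mult_right_mono)
    fix t
    have "u t * poisson (of_real r * cis \<phi>) t \<le> u t * (96 * kern ((1/2)^j) (\<theta> - t))"
      by (intro mult_left_mono P) (simp add: u_def)
    then have "ennreal (u t * poisson (of_real r * cis \<phi>) t) \<le> ennreal (96 * (kern ((1/2)^j) (\<theta> - t) * u t))"
      by (intro ennreal_leI) (simp only: mult_ac)
    also have "\<dots> = ennreal 96 * ennreal (kern ((1/2)^j) (\<theta> - t) * u t)"
      by (rule ennreal_mult) (auto simp: u_def kern_nonneg)
    also have "ennreal (kern ((1/2)^j) (\<theta> - t) * u t) = ennreal (kern ((1/2)^j) (\<theta> - t)) * ennreal (u t)"
      by (rule ennreal_mult) (auto simp: u_def kern_nonneg)
    finally show "ennreal (u t * poisson (of_real r * cis \<phi>) t) \<le> 96 * (ennreal (kern ((1/2)^j) (\<theta> - t)) * ennreal (u t))"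
      by simp
  qed simp
  also have "\<dots> = 96 * kavg u j \<theta>"
  proof -
    have [measurable]: "u \<in> borel_measurable borel" by (intro borel_measurable_continuous_onI cu)
    show ?thesis
      unfolding kavg_def by (subst nn_integral_cmult[symmetric]) (auto simp: mult.assoc)
  qed
  finally have le: "ennreal (2 * pi) * ennreal (norm (f (of_real \<rho> * cis \<phi>)) powr \<alpha>) \<le> 96 * kavg u j \<theta>" .
  have "ennreal 6 * ennreal (norm (f (of_real \<rho> * cis \<phi>)) powr \<alpha>) \<le>
      ennreal (2 * pi) * ennreal (norm (f (of_real \<rho> * cis \<phi>)) powr \<alpha>)"
    using pi_gt3 by (intro mult_right_mono ennreal_leI) auto
  also note le
  also have "96 * kavg u j \<theta> = ennreal 6 * (16 * kavg u j \<theta>)"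
    by (simp flip: mult.assoc)
  finally have "ennreal (norm (f (of_real \<rho> * cis \<phi>)) powr \<alpha>) \<le> 16 * kavg u j \<theta>"
    by (subst (asm) ennreal_mult_le_mult_iff) auto
  then show ?thesis unfolding u_def by blast
qed

text \<open>The factor 256 is the square of the 16 in \<open>holomorphic_le_kavg\<close>. The
  constant depends on neither \<open>s\<close> nor \<open>p\<close>, so the inequality can be
  integrated over \<open>s\<close> against any radial weight.\<close>

lemma ntmax_circle:
  assumes f: "f holomorphic_on disc" and s: "0 < s" "s < 1" and p: "0 < p"
  shows "(\<integral>\<^sup>+\<theta>\<in>circ. ntmax f p (s, \<theta>) \<partial>lborel) \<le>
    ennreal (256 * (64 * pi)\<^sup>2) * (\<integral>\<^sup>+\<theta>\<in>circ. ennreal (norm (f (of_real s * cis \<theta>)) powr p) \<partial>lborel)"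
proof -
  define u where "u = (\<lambda>t. norm (f (of_real s * cis t)) powr (p / 2))"
  have cu: "continuous_on A u" for A
    unfolding u_def by (rule continuous_on_circle_powr[OF f]) (use s p in auto)
  then have um[measurable]: "u \<in> borel_measurable borel" by (intro borel_measurable_continuous_onI)
  have "compact (u ` circ)" by (intro compact_continuous_image cu) auto
  then obtain B where B: "\<And>t. t \<in> circ \<Longrightarrow> u t \<le> B"
    by (meson bounded_imp_bdd_above compact_imp_bounded bdd_above.E imageI)
  have sq: "(ennreal (norm z powr (p / 2)))\<^sup>2 = ennreal (norm z powr p)" for z :: complex
    by (simp add: power2_eq_square powr_add[symmetric] flip: ennreal_mult)
  have "ntmax f p (s, \<theta>) \<le> 256 * (SUP j. (kavg u j \<theta>)\<^sup>2)" for \<theta>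
    unfolding ntmax_def
  proof (rule SUP_least, clarsimp)
    fix \<rho> \<phi> assume "0 \<le> \<rho>" "\<bar>\<phi> - \<theta>\<bar> < s - \<rho>"
    then obtain j where j: "ennreal (norm (f (of_real \<rho> * cis \<phi>)) powr (p / 2)) \<le> 16 * kavg u j \<theta>"
      using holomorphic_le_kavg[OF f s, of "p / 2"] p unfolding u_def by fastforce
    have "ennreal (norm (f (of_real \<rho> * cis \<phi>)) powr p) \<le> (16 * kavg u j \<theta>)\<^sup>2"
      using power_mono[OF j, of 2] by (simp add: sq)
    also have "\<dots> = 256 * (kavg u j \<theta>)\<^sup>2" by (simp add: power_mult_distrib)
    also have "\<dots> \<le> 256 * (SUP j. (kavg u j \<theta>)\<^sup>2)" by (intro mult_left_mono SUP_upper) auto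
    finally show "ennreal (norm (f (of_real \<rho> * cis \<phi>)) powr p) \<le> 256 * (SUP j. (kavg u j \<theta>)\<^sup>2)" .
  qed
  then have "(\<integral>\<^sup>+\<theta>\<in>circ. ntmax f p (s, \<theta>) \<partial>lborel) \<le> (\<integral>\<^sup>+\<theta>. 256 * ((SUP j. (kavg u j \<theta>)\<^sup>2) * indicator circ \<theta>) \<partial>lborel)"
    unfolding mult.assoc[symmetric] by (intro nn_integral_mono mult_right_mono) auto
  also have "\<dots> = 256 * (\<integral>\<^sup>+\<theta>\<in>circ. (SUP j. (kavg u j \<theta>)\<^sup>2) \<partial>lborel)"
    by (rule nn_integral_cmult) measurable
  also have "\<dots> \<le> 256 * (ennreal ((64 * pi)\<^sup>2) * (\<integral>\<^sup>+t\<in>circ. (ennreal (u t))\<^sup>2 \<partial>lborel))"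
    by (intro mult_left_mono maximal_L2[OF um B]) auto
  also have "\<dots> = ennreal (256 * (64 * pi)\<^sup>2) * (\<integral>\<^sup>+\<theta>\<in>circ. ennreal (norm (f (of_real s * cis \<theta>)) powr p) \<partial>lborel)"
    by (simp add: u_def sq ennreal_mult flip: mult.assoc)
  finally show ?thesis .
qed

subsection \<open>Level sets\<close>

lemma nn_integral_level_interval:
  "(\<integral>\<^sup>+t\<in>{0<..}. indicator {t. ennreal t < y} t \<partial>lborel) = y"
proof (cases y)
  case (real c)
  have "(\<integral>\<^sup>+t\<in>{0<..}. indicator {t. ennreal t < y} t \<partial>lborel) = (\<integral>\<^sup>+t. indicator {0<..<c} t \<partial>lborel)"
    by (intro nn_integral_cong) (auto simp: real indicator_def ennreal_less_iff)
  then show ?thesis using real by simp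
next
  case top
  have "(\<integral>\<^sup>+t\<in>{0<..}. indicator {t. ennreal t < y} t \<partial>lborel) = (\<integral>\<^sup>+t. indicator {0::real<..} t \<partial>lborel)"
    by (intro nn_integral_cong) (auto simp: top indicator_def)
  also have "\<dots> = emeasure lborel {0::real<..}" by simp
  also have "\<dots> = top"
  proof (rule ccontr)
    assume "emeasure lborel {0::real<..} \<noteq> top"
    then obtain n :: nat where n: "emeasure lborel {0::real<..} < of_nat n"
      using ennreal_Ex_less_of_nat by (auto simp: less_top)
    have "of_nat n = emeasure lborel {0::real<..<real n}" by (simp add: ennreal_of_nat_eq_real_of_nat)
    also have "\<dots> \<le> emeasure lborel {0::real<..}" by (intro emeasure_mono) auto
    finally show False using n by simp
  qed
  finally show ?thesis using top by simp
qed

lemma layer_cake: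
  fixes h :: "'a \<Rightarrow> ennreal" and k :: "'a \<Rightarrow> ennreal"
  assumes "sigma_finite_measure M"
    and [measurable]: "h \<in> borel_measurable M" "k \<in> borel_measurable M"
  shows "(\<integral>\<^sup>+x. k x * h x \<partial>M) =
    (\<integral>\<^sup>+t\<in>{0<..}. (\<integral>\<^sup>+x. k x * indicator {x. ennreal t < h x} x \<partial>M) \<partial>lborel)"
proof -
  interpret sigma_finite_measure M by fact
  interpret pair_sigma_finite M lborel ..
  have "(\<integral>\<^sup>+x. k x * h x \<partial>M) = (\<integral>\<^sup>+x. (\<integral>\<^sup>+t. k x * (indicator {t. ennreal t < h x} t * indicator {0<..} t) \<partial>lborel) \<partial>M)"
    by (subst nn_integral_cmult) (auto simp: nn_integral_level_interval)
  also have "\<dots> = (\<integral>\<^sup>+x. (\<integral>\<^sup>+t. k x * (of_bool (ennreal t < h x) * of_bool (0 < t)) \<partial>lborel) \<partial>M)"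
    by (simp add: indicator_def)
  also have "\<dots> = (\<integral>\<^sup>+t. (\<integral>\<^sup>+x. k x * (of_bool (ennreal t < h x) * of_bool (0 < t)) \<partial>M) \<partial>lborel)"
    by (rule Fubini'[symmetric]) measurable
  also have "\<dots> = (\<integral>\<^sup>+t\<in>{0<..}. (\<integral>\<^sup>+x. k x * indicator {x. ennreal t < h x} x \<partial>M) \<partial>lborel)"
    by (intro nn_integral_cong) (auto simp: indicator_def)
  finally show ?thesis .
qed

text \<open>Hoelder's inequality for the indicator of \<open>A\<close> and
  \<open>g powr (s - 1)\<close>, with the conjugate exponents \<open>s\<close> and
  \<open>s / (s - 1)\<close>; the latter turns the second function into
  \<open>g powr s\<close>.\<close>

lemma holder_set:
  assumes "finite_measure M" and [measurable]: "g \<in> borel_measurable M" "A \<in> sets M"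
    and g: "\<And>x. x \<in> space M \<Longrightarrow> 0 \<le> g x" "\<And>x. x \<in> space M \<Longrightarrow> g x \<le> B"
    and s: "1 < s" and G: "0 < (\<integral>x. g x powr s \<partial>M)"
  shows "(\<integral>\<^sup>+x. ennreal (g x powr (s - 1)) * indicator A x \<partial>M) \<le>
    ennreal (measure M A powr (1 / s) * (\<integral>x. g x powr s \<partial>M) powr (1 - 1 / s))"
proof (cases "measure M A = 0")
  case True
  interpret finite_measure M by fact
  have "A \<in> null_sets M" using True by (auto simp: emeasure_eq_measure)
  then have "(\<integral>\<^sup>+x. ennreal (g x powr (s - 1)) * indicator A x \<partial>M) = 0"
    by (rule nn_integral_null_set)
  then show ?thesis by simp
next
  case False
  interpret finite_measure M by fact
  define G where "G = (\<integral>x. g x powr s \<partial>M)"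
  define m where "m = measure M A"
  define \<beta> where "\<beta> = 1 - 1 / s"
  have m: "0 < m" using False by (simp add: m_def order_less_le)
  have \<beta>: "0 < \<beta>" "\<beta> < 1" "1 / s + \<beta> = 1" "s * \<beta> = s - 1" using s by (auto simp: \<beta>_def field_simps)
  have G': "0 < G" using G by (simp add: G_def)
  have gs: "integrable M (\<lambda>x. g x powr s)"
    using g s by (intro integrable_const_bound[where B = "B powr s"]) (auto intro!: AE_I2 powr_mono2)
  have iA: "integrable M (indicat_real A)" by (simp add: less_top[symmetric])
  have "(\<integral>\<^sup>+x. ennreal (g x powr (s - 1)) * indicator A x \<partial>M) \<le>
      (\<integral>\<^sup>+x. ennreal (m powr (1 / s) * G powr \<beta> * (1 / (s * m) * indicat_real A x + \<beta> / G * g x powr s)) \<partial>M)"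
  proof (rule nn_integral_mono)
    fix x assume x: "x \<in> space M"
    show "ennreal (g x powr (s - 1)) * indicator A x \<le>
        ennreal (m powr (1 / s) * G powr \<beta> * (1 / (s * m) * indicat_real A x + \<beta> / G * g x powr s))"
    proof (cases "x \<in> A \<and> g x \<noteq> 0")
      case True
      then have gx: "0 < g x" using g(1)[OF x] by simp
      \<comment> \<open>Young's inequality after both factors are normalised by their integrals: the
        right-hand side then integrates over \<open>A\<close> and the space to at most
        \<open>1 / s + \<beta> = 1\<close>.\<close>
      have "(1 / m) powr (1 / s) * (g x powr s / G) powr \<beta> \<le> 1 / s * (1 / m) + \<beta> * (g x powr s / G)"
        using \<beta> s m G' gx by (intro Youngs_inequality_0) auto
      also have "(g x powr s / G) powr \<beta> = g x powr (s - 1) / G powr \<beta>"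
        using G' gx \<beta> by (simp add: powr_divide powr_powr)
      also have "(1 / m) powr (1 / s) = 1 / m powr (1 / s)"
        using m by (simp add: powr_divide)
      finally have "g x powr (s - 1) \<le> m powr (1 / s) * G powr \<beta> * (1 / s * (1 / m) + \<beta> * (g x powr s / G))"
        using m G' by (simp add: field_simps)
      then show ?thesis using True by (auto intro!: ennreal_leI)
    next
      case False
      then show ?thesis using m s \<beta> G' by (auto simp: indicator_def)
    qed
  qed
  also have "\<dots> = ennreal (\<integral>x. m powr (1 / s) * G powr \<beta> * (1 / (s * m) * indicat_real A x + \<beta> / G * g x powr s) \<partial>M)"
    using gs iA s m G' \<beta> by (intro nn_integral_eq_integral) auto
  also have "(\<integral>x. m powr (1 / s) * G powr \<beta> * (1 / (s * m) * indicat_real A x + \<beta> / G * g x powr s) \<partial>M) =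
      m powr (1 / s) * G powr \<beta> * (1 / (s * m) * m + \<beta> / G * G)"
    using gs iA by (simp add: G_def m_def)
  also have "\<dots> = m powr (1 / s) * G powr \<beta>"
    using m G' \<beta> by simp
  finally show ?thesis by (simp add: m_def G_def \<beta>_def)
qed

text \<open>Minkowski's integral inequality applied to the superposition of the indicators of the
  level sets of \<open>g\<close>.\<close>

lemma Ls_norm_le_level_sets:
  assumes "finite_measure M" and [measurable]: "g \<in> borel_measurable M"
    and g: "\<And>x. x \<in> space M \<Longrightarrow> 0 \<le> g x" "\<And>x. x \<in> space M \<Longrightarrow> g x \<le> B"
    and s: "1 < s"
  shows "ennreal ((\<integral>x. g x powr s \<partial>M) powr (1 / s)) \<le>
    (\<integral>\<^sup>+t\<in>{0<..}. ennreal (measure M {x \<in> space M. t < g x} powr (1 / s)) \<partial>lborel)"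
    (is "_ \<le> ?I")
proof (cases "(\<integral>x. g x powr s \<partial>M) = 0")
  case False
  interpret finite_measure M by fact
  define G where "G = (\<integral>x. g x powr s \<partial>M)"
  have "0 \<le> G" unfolding G_def by (rule integral_nonneg_AE) auto
  with False have G: "0 < G" unfolding G_def by linarith
  have gs: "integrable M (\<lambda>x. g x powr s)"
    using g s by (intro integrable_const_bound[where B = "B powr s"]) (auto intro!: AE_I2 powr_mono2)
  have [measurable]: "(\<lambda>t. measure M {x \<in> space M. t < g x}) \<in> borel_measurable borel"
  proof -
    have "mono (\<lambda>t. - (measure M {x \<in> space M. t < g x}))"
      by (auto intro!: monoI finite_measure_mono)
    from borel_measurable_uminus[OF borel_measurable_mono[OF this]] show ?thesis by simp
  qed
  have "ennreal G = (\<integral>\<^sup>+x. ennreal (g x powr s) \<partial>M)"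
    unfolding G_def using gs by (intro nn_integral_eq_integral[symmetric]) auto
  \<comment> \<open>Duality: \<open>g\<close> is tested against its own extremal function
    \<open>g powr (s - 1)\<close>. Hoelder on each level set produces the factor
    \<open>G powr (1 - 1 / s)\<close>, which can be cancelled because \<open>G\<close> is positive
    in this case.\<close>
  also have "\<dots> = (\<integral>\<^sup>+x. ennreal (g x powr (s - 1)) * ennreal (g x) \<partial>M)"
  proof (rule nn_integral_cong)
    fix x assume x: "x \<in> space M"
    have "g x powr s = g x powr (s - 1) * g x"
      using g(1)[OF x] by (simp add: powr_mult_base mult.commute)
    then show "ennreal (g x powr s) = ennreal (g x powr (s - 1)) * ennreal (g x)"
      using g(1)[OF x] by (simp add: ennreal_mult)
  qed
  also have "\<dots> = (\<integral>\<^sup>+t\<in>{0<..}. (\<integral>\<^sup>+x. ennreal (g x powr (s - 1)) * indicator {x. ennreal t < ennreal (g x)} x \<partial>M) \<partial>lborel)"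
    by (rule layer_cake) (auto intro: sigma_finite_measure_axioms)
  also have "\<dots> \<le> (\<integral>\<^sup>+t. ennreal (G powr (1 - 1 / s)) *
      (ennreal (measure M {x \<in> space M. t < g x} powr (1 / s)) * indicator {0<..} t) \<partial>lborel)"
  proof (rule nn_integral_mono)
    fix t :: real
    show "(\<integral>\<^sup>+x. ennreal (g x powr (s - 1)) * indicator {x. ennreal t < ennreal (g x)} x \<partial>M) * indicator {0<..} t \<le>
      ennreal (G powr (1 - 1 / s)) * (ennreal (measure M {x \<in> space M. t < g x} powr (1 / s)) * indicator {0<..} t)"
    proof (cases "0 < t")
      case True
      define A where "A = {x \<in> space M. t < g x}"
      have [measurable]: "A \<in> sets M" unfolding A_def by measurable
      have "(\<integral>\<^sup>+x. ennreal (g x powr (s - 1)) * indicator {x. ennreal t < ennreal (g x)} x \<partial>M) =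
          (\<integral>\<^sup>+x. ennreal (g x powr (s - 1)) * indicator A x \<partial>M)"
        using True by (intro nn_integral_cong) (auto simp: A_def indicator_def ennreal_less_iff)
      also have "\<dots> \<le> ennreal (measure M A powr (1 / s) * G powr (1 - 1 / s))"
        unfolding G_def using G g s \<open>finite_measure M\<close> by (intro holder_set) (auto simp: G_def)
      finally show ?thesis
        using True by (simp add: A_def ennreal_mult mult.commute)
    qed simp
  qed
  also have "\<dots> = ennreal (G powr (1 - 1 / s)) * ?I"
    by (subst nn_integral_cmult) auto
  finally have le: "ennreal G \<le> ennreal (G powr (1 - 1 / s)) * ?I" .
  have "G = G powr (1 - 1 / s) * G powr (1 / s)"
    using G by (simp flip: powr_add)
  then have "ennreal G = ennreal (G powr (1 - 1 / s)) * ennreal (G powr (1 / s))"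
    by (metis ennreal_mult powr_ge_zero)
  with le have "ennreal (G powr (1 - 1 / s)) * ennreal (G powr (1 / s)) \<le> ennreal (G powr (1 - 1 / s)) * ?I"
    by simp
  then have "ennreal (G powr (1 / s)) \<le> ?I"
    using G by (subst (asm) ennreal_mult_le_mult_iff) auto
  then show ?thesis by (simp add: G_def)
qed (use s in simp)

text \<open>By \<open>scal\<close> the quotient \<open>m r / (1 - r)\<close> does not increase. With
  \<open>\<rho>\<close> the infimum of the sublevel set this yields
  \<open>m r \<le> x * (1 - r) / (1 - \<rho>)\<close> there, and the integral is dominated by that
  of a multiple of \<open>(1 - r) powr (\<beta> - 1)\<close> between \<open>\<rho>\<close> and 1, in
  which the powers of \<open>1 - \<rho>\<close> cancel.\<close>

lemma nn_integral_sublevel: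
  fixes m :: "real \<Rightarrow> real"
  assumes \<beta>: "0 < \<beta>" and x: "0 \<le> x"
    and m: "\<And>r. 0 < r \<Longrightarrow> r < 1 \<Longrightarrow> 0 \<le> m r"
    and scal: "\<And>r r'. 0 < r \<Longrightarrow> r \<le> r' \<Longrightarrow> r' < 1 \<Longrightarrow> m r' * (1 - r) \<le> m r * (1 - r')"
  shows "(\<integral>\<^sup>+r\<in>{0<..<1}. ennreal (of_bool (m r \<le> x) * m r powr \<beta> / (1 - r)) \<partial>lborel) \<le> ennreal (x powr \<beta> / \<beta>)"
proof (cases "{r \<in> {0<..<1}. m r \<le> x} = {}")
  case True
  then have "(\<integral>\<^sup>+r\<in>{0<..<1}. ennreal (of_bool (m r \<le> x) * m r powr \<beta> / (1 - r)) \<partial>lborel) = (\<integral>\<^sup>+r. 0 \<partial>(lborel :: real measure))"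
    by (intro nn_integral_cong) (auto simp: indicator_def)
  then show ?thesis by simp
next
  case False
  define E where "E = {r \<in> {0<..<1}. m r \<le> x}"
  define \<rho> where "\<rho> = Inf E"
  have E: "E \<noteq> {}" "bdd_below E" using False by (auto simp: E_def intro!: bdd_belowI[of _ 0])
  obtain r0 where "r0 \<in> E" using E by auto
  then have "\<rho> \<le> r0" "r0 < 1" using E by (auto simp: \<rho>_def E_def intro!: cInf_lower)
  then have \<rho>1: "\<rho> < 1" by simp
  have key: "m r * (1 - \<rho>) \<le> x * (1 - r)" if r: "r \<in> E" for r
  proof (cases "m r = 0")
    case True then show ?thesis using r x by (simp add: E_def)
  next
    case False
    then have mr: "0 < m r" using r m[of r] by (auto simp: E_def)
    \<comment> \<open>The infimum need not be attained, so the claim is recast as a lower bound for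
      \<open>\<rho>\<close> and checked for every element of \<open>E\<close>. Elements to the left
      of \<open>r\<close> need \<open>scal\<close>; for those to the right
      \<open>m r \<le> x\<close> is enough.\<close>
    have "1 - x * (1 - r) / m r \<le> \<rho>"
      unfolding \<rho>_def
    proof (rule cInf_greatest[OF E(1)])
      fix r' assume r': "r' \<in> E"
      have "m r * (1 - r') \<le> x * (1 - r)"
      proof (cases "r' \<le> r")
        case True
        then have "m r * (1 - r') \<le> m r' * (1 - r)" using r r' by (intro scal) (auto simp: E_def)
        also have "\<dots> \<le> x * (1 - r)" using r r' by (intro mult_right_mono) (auto simp: E_def)
        finally show ?thesis .
      next
        case False
        have "m r * (1 - r') \<le> m r * (1 - r)" using False mr by (intro mult_left_mono) auto
        also have "\<dots> \<le> x * (1 - r)" using r by (intro mult_right_mono) (auto simp: E_def)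
        finally show ?thesis .
      qed
      then show "1 - x * (1 - r) / m r \<le> r'" using mr by (simp add: field_simps)
    qed
    then show ?thesis using mr by (simp add: field_simps)
  qed
  have "(\<integral>\<^sup>+r\<in>{0<..<1}. ennreal (of_bool (m r \<le> x) * m r powr \<beta> / (1 - r)) \<partial>lborel) \<le>
      (\<integral>\<^sup>+r. ennreal (x powr \<beta> / (1 - \<rho>) powr \<beta>) * (ennreal ((1 - r) powr (\<beta> - 1)) * indicator {0..1 - \<rho>} (1 - r)) \<partial>lborel)"
  proof (rule nn_integral_mono)
    fix r :: real
    show "ennreal (of_bool (m r \<le> x) * m r powr \<beta> / (1 - r)) * indicator {0<..<1} r \<le>
      ennreal (x powr \<beta> / (1 - \<rho>) powr \<beta>) * (ennreal ((1 - r) powr (\<beta> - 1)) * indicator {0..1 - \<rho>} (1 - r))"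
    proof (cases "r \<in> E")
      case True
      then have r: "0 < r" "r < 1" "m r \<le> x" by (auto simp: E_def)
      have \<rho>r: "\<rho> \<le> r" unfolding \<rho>_def by (rule cInf_lower[OF True E(2)])
      have "m r \<le> x * (1 - r) / (1 - \<rho>)" using key[OF True] \<rho>1 by (simp add: field_simps)
      then have "m r powr \<beta> \<le> (x * (1 - r) / (1 - \<rho>)) powr \<beta>"
        using \<beta> m r by (intro powr_mono2) auto
      also have "\<dots> = x powr \<beta> / (1 - \<rho>) powr \<beta> * (1 - r) powr \<beta>"
        using x r \<rho>1 by (simp add: powr_divide powr_mult)
      finally have "m r powr \<beta> / (1 - r) \<le> x powr \<beta> / (1 - \<rho>) powr \<beta> * (1 - r) powr \<beta> / (1 - r)"
        using r by (intro divide_right_mono) auto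
      also have "\<dots> = x powr \<beta> / (1 - \<rho>) powr \<beta> * (1 - r) powr (\<beta> - 1)"
        using r by (simp add: powr_diff)
      finally have "ennreal (m r powr \<beta> / (1 - r)) \<le> ennreal (x powr \<beta> / (1 - \<rho>) powr \<beta> * (1 - r) powr (\<beta> - 1))"
        by (rule ennreal_leI)
      then show ?thesis using r \<rho>r by (simp flip: ennreal_mult)
    next
      case False
      then show ?thesis by (auto simp: E_def indicator_def)
    qed
  qed
  also have "\<dots> = ennreal (x powr \<beta> / (1 - \<rho>) powr \<beta>) * (\<integral>\<^sup>+r. ennreal (r powr (\<beta> - 1)) * indicator {0..1 - \<rho>} r \<partial>lborel)"
    by (subst (2) nn_integral_real_affine[where c = "-1" and t = 1]) (auto simp: nn_integral_cmult)
  also have "(\<integral>\<^sup>+r. ennreal (r powr (\<beta> - 1)) * indicator {0..1 - \<rho>} r \<partial>lborel) = ennreal ((1 - \<rho>) powr \<beta> / \<beta>)"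
    using has_integral_powr_from_0[of "\<beta> - 1" "1 - \<rho>"] \<beta> \<rho>1
    by (intro nn_integral_has_integral_lebesgue') auto
  also have "ennreal (x powr \<beta> / (1 - \<rho>) powr \<beta>) * ennreal ((1 - \<rho>) powr \<beta> / \<beta>) = ennreal (x powr \<beta> / \<beta>)"
    using \<beta> \<rho>1 by (simp flip: ennreal_mult)
  finally show ?thesis .
qed

text \<open>In the application \<open>g r\<close> is \<open>\<bar>f\<^sub>r\<bar>\<^sup>p\<close>,
  \<open>h\<close> its nontangential maximal function and \<open>m r\<close> the mass of the Carleson square at \<open>r\<close>.\<close>

lemma sublevel_embedding:
  fixes h :: "'a \<Rightarrow> ennreal" and g :: "real \<Rightarrow> 'a \<Rightarrow> real" and m :: "real \<Rightarrow> real"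
  assumes "finite_measure M"
    and hm[measurable]: "h \<in> borel_measurable M" and hN: "(\<integral>\<^sup>+x. h x \<partial>M) \<le> ennreal N" and N: "0 \<le> N"
    and gm: "\<And>r. 0 < r \<Longrightarrow> r < 1 \<Longrightarrow> g r \<in> borel_measurable M"
    and g0: "\<And>r x. 0 < r \<Longrightarrow> r < 1 \<Longrightarrow> x \<in> space M \<Longrightarrow> 0 \<le> g r x"
    and gB: "\<And>r. 0 < r \<Longrightarrow> r < 1 \<Longrightarrow> \<exists>B. \<forall>x\<in>space M. g r x \<le> B"
    and gh: "\<And>r x. 0 < r \<Longrightarrow> r < 1 \<Longrightarrow> x \<in> space M \<Longrightarrow> ennreal (g r x) \<le> h x"
    and mm[measurable]: "m \<in> borel_measurable borel"
    and m0: "\<And>r. 0 < r \<Longrightarrow> r < 1 \<Longrightarrow> 0 \<le> m r"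
    and scal: "\<And>r r'. 0 < r \<Longrightarrow> r \<le> r' \<Longrightarrow> r' < 1 \<Longrightarrow> m r' * (1 - r) \<le> m r * (1 - r')"
    and c: "0 < c"
    and mass: "\<And>r t x. 0 < r \<Longrightarrow> r < 1 \<Longrightarrow> 0 < t \<Longrightarrow> x \<in> space M \<Longrightarrow> t < g r x \<Longrightarrow>
      m r \<le> c * measure M {x \<in> space M. ennreal t < h x}"
    and s: "1 < s" and \<kappa>: "1 \<le> \<kappa>"
  shows "(\<integral>\<^sup>+r\<in>{0<..<1}. ennreal ((m r powr (1 - 1 / s) * (\<integral>x. g r x powr s \<partial>M) powr (1 / s)) powr \<kappa> / (1 - r)) \<partial>lebesgue)
    \<le> ennreal ((c powr (1 - 1 / s)) powr \<kappa> / (1 - 1 / s) * N powr \<kappa>)"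
proof -
  interpret finite_measure M by fact
  define \<beta> where "\<beta> = 1 - 1 / s"
  have \<beta>: "0 < \<beta>" "\<beta> + 1 / s = 1" using s by (auto simp: \<beta>_def field_simps)
  define H where "H = (\<lambda>t. measure M {x \<in> space M. ennreal t < h x})"
  have H0: "0 \<le> H t" for t by (simp add: H_def)
  have Hm[measurable]: "H \<in> borel_measurable borel"
  proof -
    have "mono (\<lambda>t. - H t)"
      unfolding H_def
      by (auto intro!: monoI finite_measure_mono) (meson ennreal_leI le_less_trans)
    from borel_measurable_uminus[OF borel_measurable_mono[OF this]] show ?thesis by simp
  qed
  have intH: "(\<integral>\<^sup>+t\<in>{0<..}. ennreal (H t) \<partial>lborel) \<le> ennreal N"
  proof -
    have "(\<integral>\<^sup>+x. h x \<partial>M) = (\<integral>\<^sup>+x. 1 * h x \<partial>M)" by simp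
    also have "\<dots> = (\<integral>\<^sup>+t\<in>{0<..}. (\<integral>\<^sup>+x. 1 * indicator {x. ennreal t < h x} x \<partial>M) \<partial>lborel)"
      by (rule layer_cake) (auto intro: sigma_finite_measure_axioms)
    also have "\<dots> = (\<integral>\<^sup>+t\<in>{0<..}. ennreal (H t) \<partial>lborel)"
    proof (rule nn_integral_cong)
      fix t
      have "(\<integral>\<^sup>+x. 1 * indicator {x. ennreal t < h x} x \<partial>M) = (\<integral>\<^sup>+x. indicator {x \<in> space M. ennreal t < h x} x \<partial>M)"
        by (intro nn_integral_cong) (auto simp: indicator_def)
      also have "\<dots> = ennreal (H t)" by (simp add: H_def emeasure_eq_measure)
      finally show "(\<integral>\<^sup>+x. 1 * indicator {x. ennreal t < h x} x \<partial>M) * indicator {0<..} t = ennreal (H t) * indicator {0<..} t"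
        by simp
    qed
    finally show ?thesis using hN by simp
  qed
  \<comment> \<open>The truncation \<open>m r \<le> c * H t\<close> can be inserted without loss: at
    every other height \<open>t > 0\<close> the level set of \<open>g r\<close> is empty, by
    \<open>mass\<close>.\<close>
  define k where "k = (\<lambda>r t. ennreal (of_bool (m r \<le> c * H t) * m r powr \<beta>) * ennreal (H t powr (1 / s)))"
  have [measurable]: "case_prod k \<in> borel_measurable (borel \<Otimes>\<^sub>M borel)"
    unfolding k_def by measurable
  define J where "J = (\<lambda>r. \<integral>\<^sup>+t\<in>{0<..}. k r t \<partial>lborel)"
  have [measurable]: "J \<in> borel_measurable borel"
    unfolding J_def by measurable
  define X where "X = (\<lambda>r. m r powr \<beta> * (\<integral>x. g r x powr s \<partial>M) powr (1 / s))"
  have X0: "0 \<le> X r" for r by (simp add: X_def)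
  have XJ: "ennreal (X r) \<le> J r" if r: "0 < r" "r < 1" for r
  proof -
    obtain B where B: "\<And>x. x \<in> space M \<Longrightarrow> g r x \<le> B" using gB[OF r] by auto
    note [measurable] = gm[OF r]
    have "ennreal (X r) = ennreal (m r powr \<beta>) * ennreal ((\<integral>x. g r x powr s \<partial>M) powr (1 / s))"
      by (simp add: X_def ennreal_mult)
    also have "\<dots> \<le> ennreal (m r powr \<beta>) * (\<integral>\<^sup>+t\<in>{0<..}. ennreal (measure M {x \<in> space M. t < g r x} powr (1 / s)) \<partial>lborel)"
      by (intro mult_left_mono Ls_norm_le_level_sets[OF \<open>finite_measure M\<close> gm[OF r] g0[OF r] B s]) auto
    also have "\<dots> = (\<integral>\<^sup>+t. ennreal (m r powr \<beta>) * (ennreal (measure M {x \<in> space M. t < g r x} powr (1 / s)) * indicator {0<..} t) \<partial>lborel)"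
    proof (rule nn_integral_cmult[symmetric])
      have "mono (\<lambda>t. - measure M {x \<in> space M. t < g r x})"
        by (auto intro!: monoI finite_measure_mono)
      from borel_measurable_uminus[OF borel_measurable_mono[OF this]]
      have [measurable]: "(\<lambda>t. measure M {x \<in> space M. t < g r x}) \<in> borel_measurable borel" by simp
      show "(\<lambda>t. ennreal (measure M {x \<in> space M. t < g r x} powr (1 / s)) * indicator {0<..} t) \<in> borel_measurable lborel"
        by measurable
    qed
    also have "\<dots> \<le> J r"
      unfolding J_def
    proof (rule nn_integral_mono)
      fix t :: real
      show "ennreal (m r powr \<beta>) * (ennreal (measure M {x \<in> space M. t < g r x} powr (1 / s)) * indicator {0<..} t) \<le> k r t * indicator {0<..} t"
      proof (cases "0 < t \<and> {x \<in> space M. t < g r x} \<noteq> {}")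
        case True
        then obtain x where x: "x \<in> space M" "t < g r x" by auto
        have le: "m r \<le> c * H t" unfolding H_def using mass[OF r _ x] True by simp
        have "measure M {x \<in> space M. t < g r x} \<le> H t"
          unfolding H_def
        proof (rule finite_measure_mono)
          show "{x \<in> space M. t < g r x} \<subseteq> {x \<in> space M. ennreal t < h x}"
          proof safe
            fix y assume y: "y \<in> space M" "t < g r y"
            then have "ennreal t < ennreal (g r y)" using True by (simp add: ennreal_less_iff)
            also have "\<dots> \<le> h y" using y r by (intro gh)
            finally show "ennreal t < h y" .
          qed
        qed measurable
        then have "measure M {x \<in> space M. t < g r x} powr (1 / s) \<le> H t powr (1 / s)"
          using s by (intro powr_mono2) auto
        then show ?thesis
          using True le by (auto simp: k_def intro!: mult_left_mono ennreal_leI)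
      next
        case False
        then have "0 < t \<Longrightarrow> measure M {x \<in> space M. t < g r x} = 0" by (metis measure_empty)
        then show ?thesis by (cases "0 < t") simp_all
      qed
    qed
    finally show ?thesis .
  qed
  \<comment> \<open>Because \<open>\<beta> + 1 / s = 1\<close>, the truncation turns the mixed
    powers of \<open>m r\<close> and \<open>H t\<close> into a bound linear in \<open>H t\<close>,
    uniform in \<open>r\<close>.\<close>
  have k_le: "k r t \<le> ennreal (c powr \<beta>) * ennreal (H t)" if r: "0 < r" "r < 1" for r t
  proof (cases "m r \<le> c * H t")
    case True
    have "m r powr \<beta> * H t powr (1 / s) \<le> (c * H t) powr \<beta> * H t powr (1 / s)"
      using True m0[OF r] \<beta> by (intro mult_right_mono powr_mono2) auto
    also have "\<dots> = c powr \<beta> * H t powr (\<beta> + 1 / s)"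
      using c H0[of t] by (simp add: powr_mult powr_add)
    also have "\<dots> = c powr \<beta> * H t" using \<beta> H0[of t] by simp
    finally have "ennreal (m r powr \<beta> * H t powr (1 / s)) \<le> ennreal (c powr \<beta> * H t)" by (rule ennreal_leI)
    then show ?thesis using True H0 by (simp add: k_def ennreal_mult)
  qed (simp add: k_def)
  have J_le: "J r \<le> ennreal (c powr \<beta> * N)" if r: "0 < r" "r < 1" for r
  proof -
    have "J r \<le> (\<integral>\<^sup>+t. ennreal (c powr \<beta>) * (ennreal (H t) * indicator {0<..} t) \<partial>lborel)"
      unfolding J_def mult.assoc[symmetric] using k_le[OF r] by (intro nn_integral_mono mult_right_mono) auto
    also have "\<dots> = ennreal (c powr \<beta>) * (\<integral>\<^sup>+t\<in>{0<..}. ennreal (H t) \<partial>lborel)"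
      by (rule nn_integral_cmult) measurable
    also have "\<dots> \<le> ennreal (c powr \<beta>) * ennreal N" by (intro mult_left_mono intH) simp
    finally show ?thesis using N by (simp add: ennreal_mult)
  qed
  have intJ: "(\<integral>\<^sup>+r\<in>{0<..<1}. J r * ennreal (1 / (1 - r)) \<partial>lborel) \<le> ennreal (c powr \<beta> / \<beta> * N)"
  proof -
    have "(\<integral>\<^sup>+r\<in>{0<..<1}. J r * ennreal (1 / (1 - r)) \<partial>lborel) =
        (\<integral>\<^sup>+r. (\<integral>\<^sup>+t. k r t * indicator {0<..} t * (ennreal (1 / (1 - r)) * indicator {0<..<1} r) \<partial>lborel) \<partial>lborel)"
      unfolding J_def by (intro nn_integral_cong) (subst nn_integral_multc, measurable, simp add: mult.assoc)
    \<comment> \<open>At a fixed height \<open>t\<close>, \<open>nn_integral_sublevel\<close> with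
      \<open>x = c * H t\<close> carries out the integration in \<open>r\<close> and again leaves a
      multiple of \<open>H t\<close>.\<close>
    also have "\<dots> = (\<integral>\<^sup>+t. (\<integral>\<^sup>+r. k r t * indicator {0<..} t * (ennreal (1 / (1 - r)) * indicator {0<..<1} r) \<partial>lborel) \<partial>lborel)"
      by (rule lborel_pair.Fubini') measurable
    also have "\<dots> \<le> (\<integral>\<^sup>+t. ennreal (c powr \<beta> / \<beta>) * (ennreal (H t) * indicator {0<..} t) \<partial>lborel)"
    proof (rule nn_integral_mono)
      fix t
      have "(\<integral>\<^sup>+r. k r t * indicator {0<..} t * (ennreal (1 / (1 - r)) * indicator {0<..<1} r) \<partial>lborel) =
          (\<integral>\<^sup>+r. ennreal (H t powr (1 / s)) * indicator {0<..} t * (ennreal (of_bool (m r \<le> c * H t) * m r powr \<beta> / (1 - r)) * indicator {0<..<1} r) \<partial>lborel)"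
        by (intro nn_integral_cong) (auto simp: k_def indicator_def mult_ac simp flip: ennreal_mult)
      also have "\<dots> = ennreal (H t powr (1 / s)) * indicator {0<..} t * (\<integral>\<^sup>+r\<in>{0<..<1}. ennreal (of_bool (m r \<le> c * H t) * m r powr \<beta> / (1 - r)) \<partial>lborel)"
        by (rule nn_integral_cmult) measurable
      also have "\<dots> \<le> ennreal (H t powr (1 / s)) * indicator {0<..} t * ennreal ((c * H t) powr \<beta> / \<beta>)"
        using c H0[of t] by (intro mult_left_mono nn_integral_sublevel \<beta>(1) m0 scal) auto
      also have "\<dots> = ennreal (H t powr (1 / s) * ((c * H t) powr \<beta> / \<beta>)) * indicator {0<..} t"
        by (subst ennreal_mult) (use \<beta> in \<open>auto simp only: mult_ac powr_ge_zero intro!: divide_nonneg_pos\<close>)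
      also have "H t powr (1 / s) * ((c * H t) powr \<beta> / \<beta>) = c powr \<beta> / \<beta> * H t powr (\<beta> + 1 / s)"
        using c H0[of t] by (simp add: powr_mult powr_add)
      also have "\<dots> = c powr \<beta> / \<beta> * H t" using \<beta> H0[of t] by simp
      also have "ennreal (c powr \<beta> / \<beta> * H t) * indicator {0<..} t = ennreal (c powr \<beta> / \<beta>) * (ennreal (H t) * indicator {0<..} t)"
        using \<beta> H0[of t] by (simp only: mult.assoc[symmetric] ennreal_mult'' divide_nonneg_pos powr_ge_zero)
      finally show "(\<integral>\<^sup>+r. k r t * indicator {0<..} t * (ennreal (1 / (1 - r)) * indicator {0<..<1} r) \<partial>lborel) \<le>
          ennreal (c powr \<beta> / \<beta>) * (ennreal (H t) * indicator {0<..} t)" .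
    qed
    also have "\<dots> = ennreal (c powr \<beta> / \<beta>) * (\<integral>\<^sup>+t\<in>{0<..}. ennreal (H t) \<partial>lborel)"
      by (rule nn_integral_cmult) measurable
    also have "\<dots> \<le> ennreal (c powr \<beta> / \<beta>) * ennreal N" by (intro mult_left_mono intH) simp
    finally show ?thesis using N \<beta> by (simp only: ennreal_mult'')
  qed
  define D where "D = c powr \<beta> * N"
  have D: "0 \<le> D" using N by (simp add: D_def)
  \<comment> \<open>One factor \<open>X r\<close> is integrated by way of \<open>J\<close>, the
    remaining power \<open>\<kappa> - 1\<close> is bounded by means of \<open>D\<close>.
    Measurability in \<open>r\<close> is required of the majorant \<open>J\<close> only, not of
    \<open>X\<close>.\<close>
  have "(\<integral>\<^sup>+r\<in>{0<..<1}. ennreal (X r powr \<kappa> / (1 - r)) \<partial>lebesgue) \<le>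
      (\<integral>\<^sup>+r. ennreal (D powr (\<kappa> - 1)) * (J r * ennreal (1 / (1 - r)) * indicator {0<..<1} r) \<partial>lebesgue)"
  proof (rule nn_integral_mono)
    fix r :: real
    show "ennreal (X r powr \<kappa> / (1 - r)) * indicator {0<..<1} r \<le>
        ennreal (D powr (\<kappa> - 1)) * (J r * ennreal (1 / (1 - r)) * indicator {0<..<1} r)"
    proof (cases "r \<in> {0<..<1}")
      case True
      then have r: "0 < r" "r < 1" by auto
      have "ennreal (X r) \<le> ennreal D"
        unfolding D_def using XJ[OF r] J_le[OF r] by (rule order_trans)
      then have XD: "X r \<le> D" using D by simp
      have "X r powr \<kappa> / (1 - r) = X r powr (\<kappa> - 1) * (X r * (1 / (1 - r)))"
        using X0[of r] by (simp add: powr_mult_base mult.commute)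
      also have "\<dots> \<le> D powr (\<kappa> - 1) * (X r * (1 / (1 - r)))"
        using XD X0[of r] \<kappa> r by (intro mult_right_mono powr_mono2) auto
      finally have "ennreal (X r powr \<kappa> / (1 - r)) \<le> ennreal (D powr (\<kappa> - 1) * (X r * (1 / (1 - r))))"
        by (rule ennreal_leI)
      also have "\<dots> = ennreal (D powr (\<kappa> - 1)) * (ennreal (X r) * ennreal (1 / (1 - r)))"
        using X0[of r] r by (subst ennreal_mult, simp, simp, subst ennreal_mult) auto
      also have "\<dots> \<le> ennreal (D powr (\<kappa> - 1)) * (J r * ennreal (1 / (1 - r)))"
        by (intro mult_left_mono mult_right_mono XJ r) auto
      finally show ?thesis using True by simp
    qed simp
  qed
  also have "\<dots> = ennreal (D powr (\<kappa> - 1)) * (\<integral>\<^sup>+r\<in>{0<..<1}. J r * ennreal (1 / (1 - r)) \<partial>lborel)"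
    unfolding nn_integral_completion by (rule nn_integral_cmult) measurable
  also have "\<dots> \<le> ennreal (D powr (\<kappa> - 1)) * ennreal (c powr \<beta> / \<beta> * N)"
    by (intro mult_left_mono intJ) simp
  also have "\<dots> = ennreal (D powr (\<kappa> - 1) * (D / \<beta>))"
    using N \<beta> D by (simp add: D_def flip: ennreal_mult)
  also have "D powr (\<kappa> - 1) * (D / \<beta>) = D powr \<kappa> / \<beta>"
    using D by (simp add: powr_mult_base mult.commute)
  also have "\<dots> = (c powr \<beta>) powr \<kappa> / \<beta> * N powr \<kappa>"
    using N by (simp add: D_def powr_mult)
  finally show ?thesis by (simp add: X_def \<beta>_def)
qed

subsection \<open>Radial weights in polar coordinates\<close>

lemma disc_lebesgue[measurable]: "disc \<in> sets lebesgue" "disc \<in> sets borel"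
  by (auto simp: disc_def)

lemma space_disc_area: "space disc_area = disc"
  by (simp add: disc_area_def space_scale_measure)

lemma measurable_disc_area: "f \<in> borel_measurable disc_area \<longleftrightarrow> f \<in> borel_measurable (lebesgue_on disc)"
  unfolding disc_area_def by (rule arg_cong2[where f="(\<in>)"]) (auto intro!: measurable_cong_sets)

lemma borel_measurable_disc_areaI:
  assumes "f \<in> borel_measurable borel"
  shows "f \<in> borel_measurable disc_area"
  unfolding measurable_disc_area using assms
  by (intro measurable_restrict_space1) (simp add: measurable_completion)

lemma nn_integral_disc_area:
  assumes "f \<in> borel_measurable disc_area"
  shows "(\<integral>\<^sup>+z. f z \<partial>disc_area) = ennreal (1 / pi) * (\<integral>\<^sup>+z\<in>disc. f z \<partial>lborel)"
proof -
  have "(\<integral>\<^sup>+z. f z \<partial>disc_area) = ennreal (1 / pi) * (\<integral>\<^sup>+z. f z \<partial>lebesgue_on disc)"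
    using assms unfolding measurable_disc_area unfolding disc_area_def by (rule nn_integral_scale_measure)
  also have "(\<integral>\<^sup>+z. f z \<partial>lebesgue_on disc) = (\<integral>\<^sup>+z\<in>disc. f z \<partial>lebesgue)"
    by (rule nn_integral_restrict_space) simp
  finally show ?thesis by (simp add: nn_integral_completion)
qed

lemma polar_null_set:
  assumes N: "N \<in> null_sets (lborel :: complex measure)"
  shows "AE s in lborel. 0 < s \<longrightarrow> (AE \<theta> in lborel. \<theta> \<in> circ \<longrightarrow> of_real s * cis \<theta> \<notin> N)"
proof -
  have [measurable]: "N \<in> sets borel" using N by auto
  have cm[measurable]: "cis \<in> borel_measurable borel"
    by (intro borel_measurable_continuous_onI continuous_intros)
  have "0 = (\<integral>\<^sup>+z. indicator N z \<partial>lborel)"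
    using N by (simp add: null_setsD1)
  also have "\<dots> = (\<integral>\<^sup>+s\<in>{0<..}. (\<integral>\<^sup>+\<theta>\<in>circ. ennreal s * indicator N (of_real s * cis \<theta>) \<partial>lborel) \<partial>lborel)"
    by (rule nn_integral_polar) measurable
  finally have "AE s in lborel. (\<integral>\<^sup>+\<theta>\<in>circ. ennreal s * indicator N (of_real s * cis \<theta>) \<partial>lborel) * indicator {0<..} s = 0"
    by (subst (asm) eq_commute, subst (asm) nn_integral_0_iff_AE) auto
  then show ?thesis
  proof eventually_elim
    case (elim s)
    show ?case
    proof
      assume s: "0 < s"
      then have "(\<integral>\<^sup>+\<theta>\<in>circ. ennreal s * indicator N (of_real s * cis \<theta>) \<partial>lborel) = 0"
        using elim by simp
      then have "AE \<theta> in lborel. ennreal s * indicator N (of_real s * cis \<theta>) * indicator circ \<theta> = 0"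
        by (subst (asm) nn_integral_0_iff_AE) auto
      then show "AE \<theta> in lborel. \<theta> \<in> circ \<longrightarrow> of_real s * cis \<theta> \<notin> N"
        by eventually_elim (use s in \<open>auto simp: indicator_def split: if_splits\<close>)
    qed
  qed
qed

text \<open>The weight is only Lebesgue measurable and a radius is a null set of the plane, so
  measurability of the weight along it is not immediate. \<open>W\<close> is the mean over circles
  of a Borel function that equals the weight almost everywhere; radiality and
  \<open>polar_null_set\<close> identify it with the radial profile for almost every
  \<open>s\<close>.\<close>

lemma radial_weight_polar:
  assumes "radial_weight \<omega>"
  obtains W :: "real \<Rightarrow> ennreal" where "W \<in> borel_measurable borel"
    "AE s in lborel. 0 < s \<longrightarrow> s < 1 \<longrightarrow> W s = ennreal (\<omega> (of_real s))"
    "\<And>F. F \<in> borel_measurable borel \<Longrightarrow> (\<integral>\<^sup>+z. F z * ennreal (\<omega> z) \<partial>disc_area) =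
      (\<integral>\<^sup>+s\<in>{0<..<1}. ennreal (s / pi) * W s * (\<integral>\<^sup>+\<theta>\<in>circ. F (of_real s * cis \<theta>) \<partial>lborel) \<partial>lborel)"
proof -
  have cm[measurable]: "cis \<in> borel_measurable borel"
    by (intro borel_measurable_continuous_onI continuous_intros)
  have \<omega>: "\<omega> \<in> borel_measurable disc_area"
    using assms by (auto simp: radial_weight_def weight_def)
  then have "(\<lambda>z. if z \<in> disc then \<omega> z else 0) \<in> borel_measurable lebesgue"
    unfolding measurable_disc_area by (subst borel_measurable_if) auto
  then obtain g where g[measurable]: "g \<in> borel_measurable lborel"
      and ae: "AE z in lborel. (if z \<in> disc then \<omega> z else 0) = g z"
    using completion_ex_borel_measurable_real by blast
  obtain N where N: "\<And>z. z \<in> space lborel - N \<Longrightarrow> (if z \<in> disc then \<omega> z else 0) = g z" "N \<in> null_sets lborel"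
    using AE_E3[OF ae] by blast
  define W where "W = (\<lambda>s. ennreal (1 / (2 * pi)) * (\<integral>\<^sup>+\<theta>\<in>circ. ennreal (g (of_real s * cis \<theta>)) \<partial>lborel))"
  have Wm: "W \<in> borel_measurable borel"
    unfolding W_def by measurable
  have good: "AE s in lborel. 0 < s \<longrightarrow> s < 1 \<longrightarrow> (AE \<theta> in lborel. \<theta> \<in> circ \<longrightarrow> g (of_real s * cis \<theta>) = \<omega> (of_real s))"
    using polar_null_set[OF N(2)]
  proof eventually_elim
    case (elim s)
    show ?case
    proof (intro impI)
      assume s: "0 < s" "s < 1"
      then have "AE \<theta> in lborel. \<theta> \<in> circ \<longrightarrow> of_real s * cis \<theta> \<notin> N" using elim by simp
      then show "AE \<theta> in lborel. \<theta> \<in> circ \<longrightarrow> g (of_real s * cis \<theta>) = \<omega> (of_real s)"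
      proof eventually_elim
        case (elim \<theta>)
        show ?case
        proof
          assume "\<theta> \<in> circ"
          have d: "of_real s * cis \<theta> \<in> disc" using s by (simp add: disc_def norm_mult)
          then have "g (of_real s * cis \<theta>) = \<omega> (of_real s * cis \<theta>)"
            using elim \<open>\<theta> \<in> circ\<close> N(1)[of "of_real s * cis \<theta>"] by simp
          also have "\<dots> = \<omega> (of_real (norm (of_real s * cis \<theta>)))"
            using assms d unfolding radial_weight_def by blast
          finally show "g (of_real s * cis \<theta>) = \<omega> (of_real s)" using s by (simp add: norm_mult)
        qed
      qed
    qed
  qed
  have W: "AE s in lborel. 0 < s \<longrightarrow> s < 1 \<longrightarrow> W s = ennreal (\<omega> (of_real s))"
    using good
  proof eventually_elim
    case (elim s)
    show ?case
    proof (intro impI)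
      assume s: "0 < s" "s < 1"
      have "(\<integral>\<^sup>+\<theta>\<in>circ. ennreal (g (of_real s * cis \<theta>)) \<partial>lborel) = (\<integral>\<^sup>+\<theta>\<in>circ. ennreal (\<omega> (of_real s)) \<partial>lborel)"
        using elim s by (intro nn_integral_cong_AE) (auto simp: indicator_def)
      also have "\<dots> = ennreal (\<omega> (of_real s)) * ennreal (2 * pi)"
        by (subst nn_integral_cmult_indicator) auto
      finally have "W s = ennreal (\<omega> (of_real s)) * (ennreal (1 / (2 * pi)) * ennreal (2 * pi))"
        by (simp only: W_def mult_ac)
      also have "ennreal (1 / (2 * pi)) * ennreal (2 * pi) = 1"
        by (simp flip: ennreal_mult)
      finally show "W s = ennreal (\<omega> (of_real s))" by simp
    qed
  qed
  have "(\<integral>\<^sup>+z. F z * ennreal (\<omega> z) \<partial>disc_area) =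
      (\<integral>\<^sup>+s\<in>{0<..<1}. ennreal (s / pi) * W s * (\<integral>\<^sup>+\<theta>\<in>circ. F (of_real s * cis \<theta>) \<partial>lborel) \<partial>lborel)"
    if F[measurable]: "F \<in> borel_measurable borel" for F
  proof -
    note Wm[measurable]
    have [measurable]: "F \<in> borel_measurable disc_area" by (rule borel_measurable_disc_areaI) fact
    note \<omega>[measurable]
    have "(\<integral>\<^sup>+z. F z * ennreal (\<omega> z) \<partial>disc_area) = ennreal (1 / pi) * (\<integral>\<^sup>+z\<in>disc. F z * ennreal (\<omega> z) \<partial>lborel)"
      by (rule nn_integral_disc_area) measurable
    also have "(\<integral>\<^sup>+z\<in>disc. F z * ennreal (\<omega> z) \<partial>lborel) = (\<integral>\<^sup>+z. F z * ennreal (g z) * indicator disc z \<partial>lborel)"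
      using ae by (intro nn_integral_cong_AE) (auto simp: indicator_def)
    also have "\<dots> = (\<integral>\<^sup>+s\<in>{0<..}. (\<integral>\<^sup>+\<theta>\<in>circ. ennreal s * (F (of_real s * cis \<theta>) * ennreal (g (of_real s * cis \<theta>)) * indicator disc (of_real s * cis \<theta>)) \<partial>lborel) \<partial>lborel)"
      by (rule nn_integral_polar) measurable
    also have "ennreal (1 / pi) * \<dots> = (\<integral>\<^sup>+s. ennreal (1 / pi) * ((\<integral>\<^sup>+\<theta>\<in>circ. ennreal s * (F (of_real s * cis \<theta>) * ennreal (g (of_real s * cis \<theta>)) * indicator disc (of_real s * cis \<theta>)) \<partial>lborel) * indicator {0<..} s) \<partial>lborel)"
      by (rule nn_integral_cmult[symmetric]) measurable
    also have "\<dots> = (\<integral>\<^sup>+s\<in>{0<..<1}. ennreal (s / pi) * W s * (\<integral>\<^sup>+\<theta>\<in>circ. F (of_real s * cis \<theta>) \<partial>lborel) \<partial>lborel)"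
    proof (rule nn_integral_cong_AE)
      show "AE s in lborel. ennreal (1 / pi) * ((\<integral>\<^sup>+\<theta>\<in>circ. ennreal s * (F (of_real s * cis \<theta>) * ennreal (g (of_real s * cis \<theta>)) * indicator disc (of_real s * cis \<theta>)) \<partial>lborel) * indicator {0<..} s) =
        ennreal (s / pi) * W s * (\<integral>\<^sup>+\<theta>\<in>circ. F (of_real s * cis \<theta>) \<partial>lborel) * indicator {0<..<1} s"
        using good W
      proof eventually_elim
        case (elim s)
        consider "s \<le> 0" | "1 \<le> s" | "0 < s" "s < 1" by linarith
        then show ?case
        proof cases
          case 2
          then have "of_real s * cis \<theta> \<notin> disc" for \<theta> by (simp add: disc_def norm_mult)
          then show ?thesis using 2 by simp
        next
          case 3
          then have "AE \<theta> in lborel. \<theta> \<in> circ \<longrightarrow> g (of_real s * cis \<theta>) = \<omega> (of_real s)" using elim by simp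
          then have "(\<integral>\<^sup>+\<theta>\<in>circ. ennreal s * (F (of_real s * cis \<theta>) * ennreal (g (of_real s * cis \<theta>)) * indicator disc (of_real s * cis \<theta>)) \<partial>lborel) =
              (\<integral>\<^sup>+\<theta>. ennreal s * W s * (F (of_real s * cis \<theta>) * indicator circ \<theta>) \<partial>lborel)"
            using elim(2) 3
            by (intro nn_integral_cong_AE)
               (auto simp: indicator_def disc_def norm_mult mult_ac)
          also have "\<dots> = ennreal s * W s * (\<integral>\<^sup>+\<theta>\<in>circ. F (of_real s * cis \<theta>) \<partial>lborel)"
            by (rule nn_integral_cmult) measurable
          finally have eq: "(\<integral>\<^sup>+\<theta>\<in>circ. ennreal s * (F (of_real s * cis \<theta>) * ennreal (g (of_real s * cis \<theta>)) * indicator disc (of_real s * cis \<theta>)) \<partial>lborel) =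
              ennreal s * W s * (\<integral>\<^sup>+\<theta>\<in>circ. F (of_real s * cis \<theta>) \<partial>lborel)" .
          have "ennreal (s / pi) = ennreal (1 / pi) * ennreal s"
            using 3 by (simp flip: ennreal_mult)
          then show ?thesis unfolding eq using 3 by (simp add: mult.assoc)
        qed simp
      qed
    qed
    finally show ?thesis .
  qed
  with Wm W show ?thesis by (rule that)
qed

text \<open>The measure \<open>\<omega> dA\<close> lifted to pairs of radius and angle, the
  variables of \<open>ntmax\<close>. The factor \<open>s / pi\<close> is the Jacobian for normalised
  area.\<close>

definition polar_measure :: "(real \<Rightarrow> ennreal) \<Rightarrow> (real \<times> real) measure" where
  "polar_measure W = density (lborel \<Otimes>\<^sub>M lborel)
     (\<lambda>x. ennreal (fst x / pi) * W (fst x) * (indicator {0<..<1} (fst x) * indicator circ (snd x)))"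

lemma sets_polar_measure[measurable_cong, simp]: "sets (polar_measure W) = sets (lborel \<Otimes>\<^sub>M lborel)"
  by (simp add: polar_measure_def)

lemma space_polar_measure[simp]: "space (polar_measure W) = UNIV"
  by (simp add: polar_measure_def space_pair_measure)

lemma nn_integral_polar_measure:
  assumes [measurable]: "W \<in> borel_measurable borel" and k: "k \<in> borel_measurable (lborel \<Otimes>\<^sub>M lborel)"
  shows "(\<integral>\<^sup>+x. k x \<partial>polar_measure W) =
    (\<integral>\<^sup>+s\<in>{0<..<1}. ennreal (s / pi) * W s * (\<integral>\<^sup>+\<theta>\<in>circ. k (s, \<theta>) \<partial>lborel) \<partial>lborel)"
proof -
  note k[measurable]
  have "(\<integral>\<^sup>+x. k x \<partial>polar_measure W) =
      (\<integral>\<^sup>+x. ennreal (fst x / pi) * W (fst x) * (indicator {0<..<1} (fst x) * indicator circ (snd x)) * k x \<partial>(lborel \<Otimes>\<^sub>M lborel))"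
    unfolding polar_measure_def by (rule nn_integral_density) measurable
  also have "\<dots> = (\<integral>\<^sup>+s. (\<integral>\<^sup>+\<theta>. ennreal (s / pi) * W s * (indicator {0<..<1} s * indicator circ \<theta>) * k (s, \<theta>) \<partial>lborel) \<partial>lborel)"
    by (subst lborel.nn_integral_fst[symmetric]) auto
  also have "\<dots> = (\<integral>\<^sup>+s. (\<integral>\<^sup>+\<theta>. (ennreal (s / pi) * W s * indicator {0<..<1} s) * (k (s, \<theta>) * indicator circ \<theta>) \<partial>lborel) \<partial>lborel)"
    by (simp only: mult_ac)
  also have "\<dots> = (\<integral>\<^sup>+s. (ennreal (s / pi) * W s * indicator {0<..<1} s) * (\<integral>\<^sup>+\<theta>\<in>circ. k (s, \<theta>) \<partial>lborel) \<partial>lborel)"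
    by (intro nn_integral_cong nn_integral_cmult) measurable
  finally show ?thesis by (simp only: mult_ac)
qed

text \<open>The existence of suitable arguments is replaced by a closed condition on the cosine,
  which is Borel and free of branches. An inclusion suffices, because the mass has to be bounded
  from above only.\<close>

lemma carleson_square_subset:
  assumes r: "0 < r" "r < 1"
  shows "carleson_square (of_real r) \<subseteq> {z \<in> disc. r \<le> norm z \<and> norm z * cos ((1 - r) / 2) \<le> Re z}"
proof
  fix z assume "z \<in> carleson_square (of_real r)"
  then obtain s t where z: "z \<in> disc" "r \<le> norm z" and st: "is_Arg z s" "is_Arg (of_real r) t" "\<bar>s - t\<bar> \<le> (1 - r) / 2"
    using r by (auto simp: carleson_square_def)
  have "cis t = 1" using st(2) r by (simp add: is_Arg_def cis_conv_exp)
  then have t: "cos t = 1" "sin t = 0" by (auto simp: complex_eq_iff)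
  have "cos ((1 - r) / 2) \<le> cos \<bar>s - t\<bar>"
    using st(3) r pi_gt3 by (intro cos_monotone_0_pi_le) auto
  also have "\<dots> = cos s" using t by (simp add: cos_diff)
  finally have "norm z * cos ((1 - r) / 2) \<le> norm z * cos s" by (intro mult_left_mono) auto
  also have "\<dots> = Re z"
  proof -
    have "z = of_real (norm z) * cis s" using st(1) by (simp add: is_Arg_def cis_conv_exp)
    then have "Re z = Re (of_real (norm z) * cis s)" by (rule arg_cong)
    then show ?thesis by simp
  qed
  finally show "z \<in> {z \<in> disc. r \<le> norm z \<and> norm z * cos ((1 - r) / 2) \<le> Re z}" using z by simp
qed

lemma emeasure_arc_le:
  assumes d: "0 \<le> d" "d \<le> pi"
  shows "(\<integral>\<^sup>+\<theta>\<in>circ. of_bool (cos d \<le> cos \<theta>) \<partial>lborel) \<le> ennreal (2 * d)"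
proof -
  have "(\<integral>\<^sup>+\<theta>\<in>circ. of_bool (cos d \<le> cos \<theta>) \<partial>lborel) \<le> (\<integral>\<^sup>+\<theta>. indicator {0..d} \<theta> + indicator {2*pi-d..2*pi} \<theta> \<partial>lborel)"
  proof (rule nn_integral_mono)
    fix \<theta> :: real
    have "\<theta> \<in> {0..d} \<or> \<theta> \<in> {2*pi-d..2*pi}" if "\<theta> \<in> circ" "cos d \<le> cos \<theta>"
    proof (cases "\<theta> \<le> pi")
      case True
      then show ?thesis using that d cos_mono_le_eq[of d \<theta>] by auto
    next
      case False
      have "cos \<theta> = cos (2 * pi - \<theta>)" by (simp add: cos_diff)
      then show ?thesis using that d False cos_mono_le_eq[of d "2 * pi - \<theta>"] by auto
    qed
    then show "of_bool (cos d \<le> cos \<theta>) * indicator circ \<theta> \<le> (indicator {0..d} \<theta> + indicator {2*pi-d..2*pi} \<theta> :: ennreal)"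
      by (auto simp: indicator_def)
  qed
  also have "\<dots> = ennreal (2 * d)"
    using d by (subst nn_integral_add) (auto simp flip: ennreal_plus)
  finally show ?thesis .
qed

lemma weight_mass_carleson_le:
  assumes \<omega>: "radial_weight \<omega>"
    and W[measurable]: "W \<in> borel_measurable borel"
    and polar: "\<And>F. F \<in> borel_measurable borel \<Longrightarrow> (\<integral>\<^sup>+z. F z * ennreal (\<omega> z) \<partial>disc_area) =
      (\<integral>\<^sup>+s\<in>{0<..<1}. ennreal (s / pi) * W s * (\<integral>\<^sup>+\<theta>\<in>circ. F (of_real s * cis \<theta>) \<partial>lborel) \<partial>lborel)"
    and r: "0 < r" "r < 1"
  shows "ennreal (weight_mass \<omega> (carleson_square (of_real r))) \<le>
    ennreal (1 - r) * (\<integral>\<^sup>+s\<in>{r..<1}. ennreal (s / pi) * W s \<partial>lborel)"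
proof -
  define S where "S = carleson_square (of_real r)"
  define B where "B = {z. r \<le> norm z \<and> norm z * cos ((1 - r) / 2) \<le> Re z}"
  have "closed B" unfolding B_def
    by (intro closed_Collect_conj closed_Collect_le continuous_intros)
  then have [measurable]: "B \<in> sets borel" by simp
  have SB: "S \<subseteq> B" using carleson_square_subset[OF r] by (auto simp: S_def B_def)
  have \<omega>0: "0 \<le> \<omega> z" if "z \<in> disc" for z using \<omega> that by (auto simp: radial_weight_def weight_def)
  have "ennreal (weight_mass \<omega> S) \<le> (\<integral>\<^sup>+z. indicator B z * ennreal (\<omega> z) \<partial>disc_area)"
  proof (cases "integrable disc_area (\<lambda>z. indicat_real S z *\<^sub>R \<omega> z)")
    case True
    have "ennreal (weight_mass \<omega> S) = (\<integral>\<^sup>+z. ennreal (indicat_real S z *\<^sub>R \<omega> z) \<partial>disc_area)"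
      unfolding weight_mass_def set_lebesgue_integral_def
      using True by (intro nn_integral_eq_integral[symmetric]) (auto intro!: AE_I2 simp: space_disc_area \<omega>0)
    also have "\<dots> \<le> (\<integral>\<^sup>+z. indicator B z * ennreal (\<omega> z) \<partial>disc_area)"
      using SB by (intro nn_integral_mono) (auto simp: indicator_def)
    finally show ?thesis .
  next
    \<comment> \<open>The Bochner integral is then 0 and the bound is trivial. With this case split
      the measurability of the square itself need not be discussed.\<close>
    case False
    then show ?thesis by (simp add: weight_mass_def set_lebesgue_integral_def not_integrable_integral_eq)
  qed
  also have "\<dots> = (\<integral>\<^sup>+s\<in>{0<..<1}. ennreal (s / pi) * W s * (\<integral>\<^sup>+\<theta>\<in>circ. indicator B (of_real s * cis \<theta>) \<partial>lborel) \<partial>lborel)"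
    by (rule polar) measurable
  also have "\<dots> \<le> (\<integral>\<^sup>+s. ennreal (1 - r) * (ennreal (s / pi) * W s * indicator {r..<1} s) \<partial>lborel)"
  proof (rule nn_integral_mono)
    fix s :: real
    show "ennreal (s / pi) * W s * (\<integral>\<^sup>+\<theta>\<in>circ. indicator B (of_real s * cis \<theta>) \<partial>lborel) * indicator {0<..<1} s \<le>
        ennreal (1 - r) * (ennreal (s / pi) * W s * indicator {r..<1} s)"
    proof (cases "0 < s \<and> s < 1")
      case True
      show ?thesis
      proof (cases "r \<le> s")
        case rs: True
        have "(\<integral>\<^sup>+\<theta>\<in>circ. indicator B (of_real s * cis \<theta>) \<partial>lborel) \<le> (\<integral>\<^sup>+\<theta>\<in>circ. of_bool (cos ((1 - r) / 2) \<le> cos \<theta>) \<partial>lborel)"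
          using True by (intro nn_integral_mono mult_right_mono) (auto simp: B_def indicator_def norm_mult)
        also have "\<dots> \<le> ennreal (2 * ((1 - r) / 2))"
          using r pi_gt3 by (intro emeasure_arc_le) auto
        also have "2 * ((1 - r) / 2) = 1 - r" by simp
        finally have "ennreal (s / pi) * W s * (\<integral>\<^sup>+\<theta>\<in>circ. indicator B (of_real s * cis \<theta>) \<partial>lborel) \<le> ennreal (s / pi) * W s * ennreal (1 - r)"
          by (intro mult_left_mono) auto
        then show ?thesis using True rs by (simp add: mult_ac)
      next
        case False
        then have "of_real s * cis \<theta> \<notin> B" for \<theta> using True by (simp add: B_def norm_mult)
        then show ?thesis by simp
      qed
    qed simp
  qed
  also have "\<dots> = ennreal (1 - r) * (\<integral>\<^sup>+s\<in>{r..<1}. ennreal (s / pi) * W s \<partial>lborel)"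
    by (rule nn_integral_cmult) measurable
  finally show ?thesis by (simp add: S_def)
qed

text \<open>\<open>weight_tail\<close> integrates against \<open>ds\<close>, area against
  \<open>s ds / pi\<close>. The density \<open>s\<close> is at most 1 on the left and at least 1/2
  beyond \<open>(1 + r) / 2\<close>, whence the factor 2.\<close>

lemma tail_doubling:
  assumes W[measurable]: "W \<in> borel_measurable borel"
    and ae: "AE s in lborel. 0 < s \<longrightarrow> s < 1 \<longrightarrow> W s = ennreal (\<omega> (of_real s))"
    and C: "0 \<le> C" "weight_tail \<omega> r \<le> ennreal C * weight_tail \<omega> ((1 + r) / 2)"
    and r: "0 < r" "r < 1"
  shows "(\<integral>\<^sup>+s\<in>{r..<1}. ennreal (s / pi) * W s \<partial>lborel) \<le>
    ennreal (2 * C) * (\<integral>\<^sup>+s\<in>{(1 + r) / 2..<1}. ennreal (s / pi) * W s \<partial>lborel)"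
proof -
  have tail: "weight_tail \<omega> a = (\<integral>\<^sup>+s\<in>{a..<1}. W s \<partial>lborel)" if "0 < a" for a
    unfolding weight_tail_def nn_integral_completion
    using ae that by (intro nn_integral_cong_AE) (auto simp: indicator_def)
  have "(\<integral>\<^sup>+s\<in>{r..<1}. ennreal (s / pi) * W s \<partial>lborel) \<le> (\<integral>\<^sup>+s. ennreal (1 / pi) * (W s * indicator {r..<1} s) \<partial>lborel)"
    unfolding mult.assoc[symmetric]
    using pi_gt_zero
    by (intro nn_integral_mono) (auto simp: indicator_def intro!: mult_right_mono ennreal_leI divide_right_mono)
  also have "\<dots> = ennreal (1 / pi) * weight_tail \<omega> r"
    unfolding tail[OF r(1)] by (rule nn_integral_cmult) measurable
  also have "\<dots> \<le> ennreal (1 / pi) * (ennreal C * weight_tail \<omega> ((1 + r) / 2))"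
    by (intro mult_left_mono C) simp
  also have "\<dots> = (\<integral>\<^sup>+s. ennreal (1 / pi) * ennreal C * (W s * indicator {(1 + r) / 2..<1} s) \<partial>lborel)"
    using r by (subst nn_integral_cmult) (auto simp: tail mult.assoc)
  also have "\<dots> \<le> (\<integral>\<^sup>+s. ennreal (2 * C) * (ennreal (s / pi) * W s * indicator {(1 + r) / 2..<1} s) \<partial>lborel)"
  proof (rule nn_integral_mono)
    fix s :: real
    show "ennreal (1 / pi) * ennreal C * (W s * indicator {(1 + r) / 2..<1} s) \<le>
        ennreal (2 * C) * (ennreal (s / pi) * W s * indicator {(1 + r) / 2..<1} s)"
    proof (cases "s \<in> {(1 + r) / 2..<1}")
      case True
      then have s: "1 \<le> 2 * s" "0 \<le> s" using r by auto
      have "1 / pi * C \<le> 2 * C * (s / pi)"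
        using s C(1) mult_right_mono[of 1 "2 * s" "C / pi"] by (simp add: mult_ac)
      then have "ennreal (1 / pi * C) \<le> ennreal (2 * C * (s / pi))" by (rule ennreal_leI)
      then have "ennreal (1 / pi) * ennreal C \<le> ennreal (2 * C) * ennreal (s / pi)"
        using s C(1) by (simp only: ennreal_mult'' ennreal_mult' divide_nonneg_pos pi_gt_zero zero_le_one)
      then have "ennreal (1 / pi) * ennreal C * W s \<le> ennreal (2 * C) * ennreal (s / pi) * W s"
        by (rule mult_right_mono) simp
      then show ?thesis using True by (simp add: mult.assoc)
    qed simp
  qed
  also have "\<dots> = ennreal (2 * C) * (\<integral>\<^sup>+s\<in>{(1 + r) / 2..<1}. ennreal (s / pi) * W s \<partial>lborel)"
    by (rule nn_integral_cmult) measurable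
  finally show ?thesis .
qed

section \<open>Mass of the superlevel sets of the maximal function\<close>

lemma cis_representative:
  obtains \<phi> where "0 \<le> \<phi>" "\<phi> < 2 * pi" "cis \<phi> = cis \<theta>"
proof
  show "0 \<le> Arg2pi (cis \<theta>)" "Arg2pi (cis \<theta>) < 2 * pi" by (simp_all add: Arg2pi_ge_0 Arg2pi_lt_2pi)
  show "cis (Arg2pi (cis \<theta>)) = cis \<theta>"
    using Arg2pi_eq[of "cis \<theta>"] by (simp add: cis_conv_exp)
qed

text \<open>The point \<open>of_real \<rho> * cis \<theta>\<close> lies in the approach region of
  each vertex of radius \<open>s \<ge> (1 + r) / 2\<close> whose angle differs by less than
  \<open>(1 - r) / 2\<close>, since \<open>s - \<rho>\<close> exceeds
  \<open>(1 - r) / 2\<close>.\<close>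

lemma ntmax_superlevel_mass:
  assumes W[measurable]: "W \<in> borel_measurable borel"
    and r: "0 < r" "r < 1" and \<rho>: "0 \<le> \<rho>" "\<rho> < r" and t: "0 \<le> t" "t < norm (f (of_real \<rho> * cis \<theta>)) powr p"
  shows "ennreal ((1 - r) / 2) * (\<integral>\<^sup>+s\<in>{(1 + r) / 2..<1}. ennreal (s / pi) * W s \<partial>lborel) \<le>
    emeasure (polar_measure W) {x. ennreal t < ntmax f p x}"
proof -
  obtain \<phi> where \<phi>: "0 \<le> \<phi>" "\<phi> < 2 * pi" "cis \<phi> = cis \<theta>" by (rule cis_representative)
  define d where "d = (1 - r) / 2"
  have d: "0 < d" "d \<le> pi" using r pi_gt3 by (auto simp: d_def)
  \<comment> \<open>The admissible arc may leave \<open>circ\<close> at an endpoint; the half of it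
    on the inner side stays inside and has the required length \<open>d\<close>.\<close>
  define a where "a = (if \<phi> \<le> pi then \<phi> else \<phi> - d)"
  have a: "{a<..<a + d} \<subseteq> circ" "\<And>x. x \<in> {a<..<a + d} \<Longrightarrow> \<bar>\<phi> - x\<bar> < d"
    using \<phi> d by (auto simp: a_def split: if_splits)
  define L where "L = {x. ennreal t < ntmax f p x}"
  have [measurable]: "L \<in> sets (lborel \<Otimes>\<^sub>M lborel)"
  proof -
    have "{x \<in> space (lborel \<Otimes>\<^sub>M lborel). ennreal t < ntmax f p x} \<in> sets (lborel \<Otimes>\<^sub>M lborel)"
      by measurable
    then show ?thesis by (simp add: L_def space_pair_measure)
  qed
  have L: "(s, x) \<in> L" if "s \<in> {(1 + r) / 2..<1}" "x \<in> {a<..<a + d}" for s x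
  proof -
    have "\<bar>\<phi> - x\<bar> < s - \<rho>" using a(2)[OF that(2)] that(1) \<rho> r by (simp add: d_def)
    moreover have "ennreal t < ennreal (norm (f (of_real \<rho> * cis \<phi>)) powr p)"
      using t \<phi>(3) by (simp add: ennreal_less_iff)
    ultimately show ?thesis unfolding L_def less_ntmax_iff using \<rho>(1) by auto
  qed
  have "ennreal d * (\<integral>\<^sup>+s\<in>{(1 + r) / 2..<1}. ennreal (s / pi) * W s \<partial>lborel) =
      (\<integral>\<^sup>+s. ennreal d * (ennreal (s / pi) * W s * indicator {(1 + r) / 2..<1} s) \<partial>lborel)"
    by (rule nn_integral_cmult[symmetric]) measurable
  also have "\<dots> \<le> (\<integral>\<^sup>+s\<in>{0<..<1}. ennreal (s / pi) * W s * (\<integral>\<^sup>+\<theta>\<in>circ. indicator L (s, \<theta>) \<partial>lborel) \<partial>lborel)"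
  proof (rule nn_integral_mono)
    fix s :: real
    show "ennreal d * (ennreal (s / pi) * W s * indicator {(1 + r) / 2..<1} s) \<le>
        ennreal (s / pi) * W s * (\<integral>\<^sup>+\<theta>\<in>circ. indicator L (s, \<theta>) \<partial>lborel) * indicator {0<..<1} s"
    proof (cases "s \<in> {(1 + r) / 2..<1}")
      case True
      have "ennreal d = (\<integral>\<^sup>+\<theta>. indicator {a<..<a + d} \<theta> \<partial>lborel)" using d by simp
      also have "\<dots> \<le> (\<integral>\<^sup>+\<theta>\<in>circ. indicator L (s, \<theta>) \<partial>lborel)"
        using L[OF True] a(1) by (intro nn_integral_mono) (auto simp: indicator_def)
      finally have "ennreal (s / pi) * W s * ennreal d \<le> ennreal (s / pi) * W s * (\<integral>\<^sup>+\<theta>\<in>circ. indicator L (s, \<theta>) \<partial>lborel)"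
        by (rule mult_left_mono) simp
      then show ?thesis using True r by (simp add: mult_ac)
    qed simp
  qed
  also have "\<dots> = (\<integral>\<^sup>+x. indicator L x \<partial>polar_measure W)"
    by (rule nn_integral_polar_measure[symmetric]) measurable
  also have "\<dots> = emeasure (polar_measure W) L"
    by (rule nn_integral_indicator) measurable
  finally show ?thesis by (simp add: d_def L_def)
qed

section \<open>Assembly of the embedding inequality\<close>

theorem theorem22:
  fixes p q lam :: real and \<omega> :: "complex \<Rightarrow> real"
  assumes "0 < p" and "p < q" and "p \<le> lam" and "\<omega> \<in> D_hat"
  shows "\<exists>C>0. \<forall>f \<in> bergman_space p \<omega>.
    (\<integral>\<^sup>+ r\<in>{0<..<1}.
        ennreal (weight_mass \<omega> (carleson_square (of_real r)) powr (lam * (1 / p - 1 / q)) *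
                 bergman_norm q \<omega> (dilation r f) powr lam / (1 - r)) \<partial>lebesgue)
      \<le> ennreal (C * bergman_norm p \<omega> f powr lam)"
proof -
  have q: "0 < q" using assms by simp
  have \<omega>: "radial_weight \<omega>" using assms(4) by (simp add: D_hat_def)
  then have wt: "weight \<omega>" by (simp add: radial_weight_def)
  have \<omega>0: "0 \<le> \<omega> z" if "z \<in> disc" for z using wt that by (simp add: weight_def)
  have \<omega>int: "integrable disc_area \<omega>" using wt by (simp add: weight_def)
  obtain C0 where C0: "1 < C0" and dbl: "\<And>r. 0 \<le> r \<Longrightarrow> r < 1 \<Longrightarrow>
      weight_tail \<omega> r \<le> ennreal C0 * weight_tail \<omega> ((1 + r) / 2)"
    using assms(4) unfolding D_hat_def by blast
  obtain W where W[measurable]: "W \<in> borel_measurable borel"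
    and ae: "AE s in lborel. 0 < s \<longrightarrow> s < 1 \<longrightarrow> W s = ennreal (\<omega> (of_real s))"
    and polar: "\<And>F. F \<in> borel_measurable borel \<Longrightarrow> (\<integral>\<^sup>+z. F z * ennreal (\<omega> z) \<partial>disc_area) =
      (\<integral>\<^sup>+s\<in>{0<..<1}. ennreal (s / pi) * W s * (\<integral>\<^sup>+\<theta>\<in>circ. F (of_real s * cis \<theta>) \<partial>lborel) \<partial>lborel)"
    using radial_weight_polar[OF \<omega>] by blast
  define Y where "Y = polar_measure W"
  have [measurable_cong]: "sets Y = sets (lborel \<Otimes>\<^sub>M lborel)" by (simp add: Y_def)
  have spY: "space Y = UNIV" by (simp add: Y_def)
  have cm[measurable]: "cis \<in> borel_measurable borel"
    by (intro borel_measurable_continuous_onI continuous_intros)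
  have intY: "(\<integral>\<^sup>+x. F (of_real (fst x) * cis (snd x)) \<partial>Y) = (\<integral>\<^sup>+z. F z * ennreal (\<omega> z) \<partial>disc_area)"
    if [measurable]: "F \<in> borel_measurable borel" for F
    unfolding Y_def by (subst nn_integral_polar_measure) (auto simp: polar)
  have total: "(\<integral>\<^sup>+z. ennreal (\<omega> z) \<partial>disc_area) < top"
    using \<omega>int \<omega>0 by (subst nn_integral_eq_integral) (auto intro!: AE_I2 simp: space_disc_area)
  have finY: "finite_measure Y"
  proof (rule finite_measureI)
    have "emeasure Y (space Y) = (\<integral>\<^sup>+x. (\<lambda>_. 1) (of_real (fst x) * cis (snd x) :: complex) \<partial>Y)" by simp
    also have "\<dots> = (\<integral>\<^sup>+z. 1 * ennreal (\<omega> z) \<partial>disc_area)" by (rule intY) simp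
    finally show "emeasure Y (space Y) \<noteq> \<infinity>" using total by simp
  qed
  interpret Y: finite_measure Y by fact
  define Tau where "Tau = (\<lambda>r. \<integral>\<^sup>+s\<in>{r..<1}. ennreal (s / pi) * W s \<partial>lborel)"
  have Tau_mono: "Tau r' \<le> Tau r" if "r \<le> r'" for r r'
    unfolding Tau_def using that by (intro nn_integral_mono) (auto simp: indicator_def)
  have Tau_fin: "Tau r < top" for r
  proof -
    have "Tau r \<le> (\<integral>\<^sup>+s\<in>{0<..<1}. ennreal (s / pi) * W s * (\<integral>\<^sup>+\<theta>\<in>circ. 1 \<partial>lborel) \<partial>lborel)"
      unfolding Tau_def
    proof (rule nn_integral_mono)
      fix s :: real
      have "1 \<le> (\<integral>\<^sup>+\<theta>\<in>circ. 1 \<partial>lborel)" using pi_gt3 by simp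
      then have "ennreal (s / pi) * W s * 1 \<le> ennreal (s / pi) * W s * (\<integral>\<^sup>+\<theta>\<in>circ. 1 \<partial>lborel)"
        by (rule mult_left_mono) simp
      then show "ennreal (s / pi) * W s * indicator {r..<1} s \<le>
          ennreal (s / pi) * W s * (\<integral>\<^sup>+\<theta>\<in>circ. 1 \<partial>lborel) * indicator {0<..<1} s"
        by (cases "0 < s") (auto simp: indicator_def ennreal_neg divide_le_0_iff)
    qed
    also have "\<dots> = (\<integral>\<^sup>+z. 1 * ennreal (\<omega> z) \<partial>disc_area)"
      by (rule polar[of "\<lambda>_. 1", symmetric]) simp
    finally show ?thesis using total by simp
  qed
  define \<tau> where "\<tau> = (\<lambda>r. enn2real (Tau r))"
  have \<tau>: "ennreal (\<tau> r) = Tau r" "0 \<le> \<tau> r" for r using Tau_fin by (auto simp: \<tau>_def)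
  have \<tau>_mono: "\<tau> r' \<le> \<tau> r" if "r \<le> r'" for r r'
    using Tau_mono[OF that] \<tau> by (metis ennreal_le_iff)
  \<comment> \<open>A majorant of the mass of the Carleson square (see \<open>wm\<close>) whose
    quotient by \<open>1 - r\<close> is exactly monotone; the embedding is run with \<open>m\<close>
    in place of that mass.\<close>
  define m where "m = (\<lambda>r. (1 - r) * \<tau> r)"
  have mm: "m \<in> borel_measurable borel"
  proof -
    have "mono (\<lambda>r. - \<tau> r)" using \<tau>_mono by (auto intro: monoI)
    from borel_measurable_uminus[OF borel_measurable_mono[OF this]]
    have [measurable]: "\<tau> \<in> borel_measurable borel" by simp
    show ?thesis unfolding m_def by measurable
  qed
  have m0: "0 \<le> m r" if "r < 1" for r using that \<tau> by (simp add: m_def)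
  have scal: "m r' * (1 - r) \<le> m r * (1 - r')" if "0 < r" "r \<le> r'" "r' < 1" for r r'
  proof -
    have "(1 - r') * (1 - r) * \<tau> r' \<le> (1 - r') * (1 - r) * \<tau> r"
      using that by (intro mult_left_mono \<tau>_mono) auto
    then show ?thesis by (simp add: m_def mult_ac)
  qed
  have wm: "weight_mass \<omega> (carleson_square (of_real r)) \<le> m r" if r: "0 < r" "r < 1" for r
  proof -
    have "ennreal (weight_mass \<omega> (carleson_square (of_real r))) \<le> ennreal (1 - r) * Tau r"
      unfolding Tau_def by (rule weight_mass_carleson_le[OF \<omega> W polar r])
    also have "\<dots> = ennreal (m r)" using r \<tau>(2) by (simp add: m_def ennreal_mult flip: \<tau>(1))
    finally show ?thesis using m0[OF r(2)] by simp
  qed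
  have wm0: "0 \<le> weight_mass \<omega> E" for E
    unfolding weight_mass_def set_lebesgue_integral_def
    by (intro integral_nonneg_AE AE_I2) (auto simp: space_disc_area \<omega>0)
  define s where "s = q / p"
  define \<kappa> where "\<kappa> = lam / p"
  have s: "1 < s" "p * s = q" "1 / s = p / q" using assms by (auto simp: s_def)
  have \<kappa>: "1 \<le> \<kappa>" using assms by (simp add: \<kappa>_def)
  \<comment> \<open>The factor \<open>2 * C0\<close> comes from \<open>tail_doubling\<close>, a
    further 2 from the arc of length \<open>(1 - r) / 2\<close> in
    \<open>ntmax_superlevel_mass\<close>.\<close>
  define c where "c = 4 * C0"
  have c: "0 < c" using C0 by (simp add: c_def)
  define C1 where "C1 = 256 * (64 * pi)\<^sup>2"
  have C1: "0 < C1" by (simp add: C1_def)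
  define K where "K = (c powr (1 - 1 / s)) powr \<kappa> / (1 - 1 / s) * C1 powr \<kappa>"
  have K: "0 < K" using c C1 s(1) by (simp add: K_def)
  have "(\<integral>\<^sup>+ r\<in>{0<..<1}.
        ennreal (weight_mass \<omega> (carleson_square (of_real r)) powr (lam * (1 / p - 1 / q)) *
                 bergman_norm q \<omega> (dilation r f) powr lam / (1 - r)) \<partial>lebesgue)
      \<le> ennreal (K * bergman_norm p \<omega> f powr lam)" if f: "f \<in> bergman_space p \<omega>" for f
  proof -
    have hol: "f holomorphic_on disc" and fint: "integrable disc_area (\<lambda>z. norm (f z) powr p * \<omega> z)"
      using f by (auto simp: bergman_space_def)
    \<comment> \<open>Nothing is known of \<open>f\<close> outside the disc, so its norm is cut off
      there to obtain a Borel function on the plane.\<close>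
    define e where "e = (\<lambda>z. if z \<in> disc then norm (f z) else 0)"
    have [measurable]: "e \<in> borel_measurable borel"
      unfolding e_def
      by (rule borel_measurable_continuous_on_if)
        (auto intro!: continuous_on_norm holomorphic_on_imp_continuous_on hol disc_lebesgue)
    define N where "N = (\<integral>z. norm (f z) powr p * \<omega> z \<partial>disc_area)"
    have N0: "0 \<le> N" unfolding N_def
      by (intro integral_nonneg_AE AE_I2) (auto simp: space_disc_area \<omega>0)
    have N: "(\<integral>\<^sup>+z. ennreal (e z powr p) * ennreal (\<omega> z) \<partial>disc_area) = ennreal N"
    proof -
      have "(\<integral>\<^sup>+z. ennreal (e z powr p) * ennreal (\<omega> z) \<partial>disc_area) = (\<integral>\<^sup>+z. ennreal (norm (f z) powr p * \<omega> z) \<partial>disc_area)"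
        by (intro nn_integral_cong) (auto simp: space_disc_area e_def \<omega>0 ennreal_mult)
      also have "\<dots> = ennreal N"
        unfolding N_def using fint by (intro nn_integral_eq_integral AE_I2) (auto simp: space_disc_area \<omega>0)
      finally show ?thesis .
    qed
    define h where "h = ntmax f p"
    have hm: "h \<in> borel_measurable Y" unfolding h_def by measurable
    have hN: "(\<integral>\<^sup>+x. h x \<partial>Y) \<le> ennreal (C1 * N)"
    proof -
      have "(\<integral>\<^sup>+x. h x \<partial>Y) = (\<integral>\<^sup>+s\<in>{0<..<1}. ennreal (s / pi) * W s * (\<integral>\<^sup>+\<theta>\<in>circ. h (s, \<theta>) \<partial>lborel) \<partial>lborel)"
        unfolding Y_def h_def by (rule nn_integral_polar_measure) measurable
      also have "\<dots> \<le> (\<integral>\<^sup>+s. ennreal C1 * (ennreal (s / pi) * W s * (\<integral>\<^sup>+\<theta>\<in>circ. ennreal (e (of_real s * cis \<theta>) powr p) \<partial>lborel) * indicator {0<..<1} s) \<partial>lborel)"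
      proof (rule nn_integral_mono)
        fix s :: real
        show "ennreal (s / pi) * W s * (\<integral>\<^sup>+\<theta>\<in>circ. h (s, \<theta>) \<partial>lborel) * indicator {0<..<1} s \<le>
          ennreal C1 * (ennreal (s / pi) * W s * (\<integral>\<^sup>+\<theta>\<in>circ. ennreal (e (of_real s * cis \<theta>) powr p) \<partial>lborel) * indicator {0<..<1} s)"
        proof (cases "s \<in> {0<..<1}")
          case True
          then have s: "0 < s" "s < 1" by auto
          have "(\<integral>\<^sup>+\<theta>\<in>circ. h (s, \<theta>) \<partial>lborel) \<le> ennreal C1 * (\<integral>\<^sup>+\<theta>\<in>circ. ennreal (norm (f (of_real s * cis \<theta>)) powr p) \<partial>lborel)"
            unfolding h_def C1_def by (rule ntmax_circle[OF hol s assms(1)])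
          also have "(\<integral>\<^sup>+\<theta>\<in>circ. ennreal (norm (f (of_real s * cis \<theta>)) powr p) \<partial>lborel) = (\<integral>\<^sup>+\<theta>\<in>circ. ennreal (e (of_real s * cis \<theta>) powr p) \<partial>lborel)"
            using s by (simp add: e_def disc_def norm_mult)
          finally have "ennreal (s / pi) * W s * (\<integral>\<^sup>+\<theta>\<in>circ. h (s, \<theta>) \<partial>lborel) \<le>
              ennreal (s / pi) * W s * (ennreal C1 * (\<integral>\<^sup>+\<theta>\<in>circ. ennreal (e (of_real s * cis \<theta>) powr p) \<partial>lborel))"
            by (rule mult_left_mono) simp
          then show ?thesis using True by (simp add: mult_ac)
        qed simp
      qed
      also have "\<dots> = ennreal C1 * (\<integral>\<^sup>+s\<in>{0<..<1}. ennreal (s / pi) * W s * (\<integral>\<^sup>+\<theta>\<in>circ. ennreal (e (of_real s * cis \<theta>) powr p) \<partial>lborel) \<partial>lborel)"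
        by (rule nn_integral_cmult) measurable
      also have "(\<integral>\<^sup>+s\<in>{0<..<1}. ennreal (s / pi) * W s * (\<integral>\<^sup>+\<theta>\<in>circ. ennreal (e (of_real s * cis \<theta>) powr p) \<partial>lborel) \<partial>lborel) = ennreal N"
        unfolding N[symmetric] by (rule polar[symmetric]) measurable
      also have "ennreal C1 * ennreal N = ennreal (C1 * N)"
        using C1 N0 by (simp add: ennreal_mult)
      finally show ?thesis .
    qed
    \<comment> \<open>The power \<open>p\<close> of the norm of \<open>dilation r f\<close> in polar
      coordinates. The cut-off in the radius makes \<open>g r\<close> bounded and dominated by
      \<open>h\<close> at all pairs, as \<open>space Y\<close> is the whole plane of pairs.\<close>
    define g where "g = (\<lambda>r (x :: real \<times> real). (if fst x \<in> {0<..<1} then e (of_real r * (of_real (fst x) * cis (snd x))) powr p else 0))"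
    have gm: "g r \<in> borel_measurable Y" for r
      unfolding g_def by measurable
    have in_disc: "of_real r * (of_real x * cis \<theta>) \<in> disc" "norm (of_real r * (of_real x * cis \<theta>)) \<le> r"
      if "0 < r" "r < 1" "0 < x" "x < 1" for r x \<theta>
      using that mult_strict_mono[of r 1 x 1] mult_left_le[of x r] by (auto simp: disc_def norm_mult)
    have gB: "\<exists>B. \<forall>x\<in>space Y. g r x \<le> B" if r: "0 < r" "r < 1" for r
    proof -
      have "cball 0 r \<subseteq> disc" using r by (auto simp: disc_def)
      then have "compact (f ` cball 0 r)"
        by (intro compact_continuous_image continuous_on_subset[OF holomorphic_on_imp_continuous_on[OF hol]]) auto
      then obtain B where B: "\<And>z. z \<in> cball 0 r \<Longrightarrow> norm (f z) \<le> B"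
        by (meson bounded_iff compact_imp_bounded imageI)
      have "g r x \<le> B powr p" for x
        unfolding g_def using in_disc[OF r, of "fst x" "snd x"] B assms(1)
        by (auto simp: e_def intro!: powr_mono2)
      then show ?thesis by blast
    qed
    have gh: "ennreal (g r x) \<le> h x" if r: "0 < r" "r < 1" for r x
    proof (cases "fst x \<in> {0<..<1}")
      case True
      \<comment> \<open>The dilated point lies on the same ray as the vertex at a smaller radius,
        hence in its approach region.\<close>
      have "ennreal (norm (f (of_real (r * fst x) * cis (snd x))) powr p) \<le> h x"
        unfolding h_def ntmax_def
        by (rule SUP_upper2[of "(r * fst x, snd x)"]) (use True r in auto)
      then show ?thesis
        using True in_disc(1)[OF r, of "fst x" "snd x"] by (simp add: g_def e_def mult.assoc)
    next
      case False
      then have "g r x = 0" by (auto simp: g_def)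
      then show ?thesis by simp
    qed
    have mass: "m r \<le> c * measure Y {x \<in> space Y. ennreal t < h x}"
      if r: "0 < r" "r < 1" and t: "0 < t" and x: "t < g r x" for r t x
    proof -
      define L where "L = measure Y {x \<in> space Y. ennreal t < h x}"
      have fx: "fst x \<in> {0<..<1}" using x t by (auto simp: g_def split: if_splits)
      have lt: "t < norm (f (of_real (r * fst x) * cis (snd x))) powr p"
        using x fx in_disc(1)[OF r, of "fst x" "snd x"] by (simp add: g_def e_def mult.assoc)
      have "ennreal ((1 - r) / 2) * Tau ((1 + r) / 2) \<le> emeasure Y {x. ennreal t < h x}"
        unfolding Tau_def Y_def h_def
        using fx r t lt
        by (intro ntmax_superlevel_mass[OF W r, where \<rho> = "r * fst x" and \<theta> = "snd x"]) auto
      also have "\<dots> = ennreal L" by (simp add: L_def spY Y.emeasure_eq_measure)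
      finally have "ennreal ((1 - r) / 2 * \<tau> ((1 + r) / 2)) \<le> ennreal L"
        using r by (subst ennreal_mult) (auto simp: \<tau>)
      then have le: "(1 - r) / 2 * \<tau> ((1 + r) / 2) \<le> L" by (simp add: L_def)
      have "Tau r \<le> ennreal (2 * C0) * Tau ((1 + r) / 2)"
        unfolding Tau_def using C0 dbl[of r] r by (intro tail_doubling[OF W ae]) auto
      then have "ennreal (\<tau> r) \<le> ennreal (2 * C0 * \<tau> ((1 + r) / 2))"
        using C0 by (subst ennreal_mult) (auto simp: \<tau>)
      then have "\<tau> r \<le> 2 * C0 * \<tau> ((1 + r) / 2)"
        using C0 \<tau>(2)[of "(1 + r) / 2"] by (subst (asm) ennreal_le_iff) auto
      then have "m r \<le> (1 - r) * (2 * C0 * \<tau> ((1 + r) / 2))"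
        unfolding m_def using r by (intro mult_left_mono) auto
      also have "\<dots> = c * ((1 - r) / 2 * \<tau> ((1 + r) / 2))" by (simp add: c_def)
      also have "\<dots> \<le> c * L" using le c by (intro mult_left_mono) auto
      finally show ?thesis by (simp add: L_def)
    qed
    \<comment> \<open>Both integrands are nonnegative, so the identity is proved for extended-valued
      integrals, where the polar formula is available; \<open>p * s = q\<close> matches the
      powers.\<close>
    have gint: "(\<integral>x. g r x powr s \<partial>Y) = (\<integral>z. norm (dilation r f z) powr q * \<omega> z \<partial>disc_area)"
      if r: "0 < r" "r < 1" for r
    proof -
      have rz: "of_real r * z \<in> disc" if "z \<in> disc" for z
        using that r mult_right_mono[of r 1 "norm z"] by (auto simp: disc_def norm_mult)
      have "(\<integral>x. g r x powr s \<partial>Y) = enn2real (\<integral>\<^sup>+x. ennreal (g r x powr s) \<partial>Y)"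
        by (rule integral_eq_nn_integral) (use gm in auto)
      also have "(\<integral>\<^sup>+x. ennreal (g r x powr s) \<partial>Y) = (\<integral>\<^sup>+x. ennreal (e (of_real r * (of_real (fst x) * cis (snd x))) powr q) \<partial>Y)"
        unfolding Y_def
      proof (subst (1 2) nn_integral_polar_measure)
        show "(\<integral>\<^sup>+sa\<in>{0<..<1}. ennreal (sa / pi) * W sa * (\<integral>\<^sup>+\<theta>\<in>circ. ennreal (g r (sa, \<theta>) powr s) \<partial>lborel) \<partial>lborel) =
          (\<integral>\<^sup>+s\<in>{0<..<1}. ennreal (s / pi) * W s * (\<integral>\<^sup>+\<theta>\<in>circ. ennreal (e (of_real r * (of_real (fst (s, \<theta>)) * cis (snd (s, \<theta>)))) powr q) \<partial>lborel) \<partial>lborel)"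
          by (intro nn_integral_cong) (auto simp: g_def indicator_def powr_powr s(2))
      qed (use gm[of r] in \<open>simp_all add: Y_def\<close>)
      also have "\<dots> = (\<integral>\<^sup>+z. ennreal (e (of_real r * z) powr q) * ennreal (\<omega> z) \<partial>disc_area)"
        by (rule intY[of "\<lambda>z. ennreal (e (of_real r * z) powr q)"]) measurable
      also have "\<dots> = (\<integral>\<^sup>+z. ennreal (norm (dilation r f z) powr q * \<omega> z) \<partial>disc_area)"
        by (intro nn_integral_cong) (auto simp: space_disc_area e_def rz dilation_def \<omega>0 ennreal_mult)
      also have "enn2real \<dots> = (\<integral>z. norm (dilation r f z) powr q * \<omega> z \<partial>disc_area)"
      proof (rule integral_eq_nn_integral[symmetric])
        have "dilation r f \<in> bergman_space q \<omega>"
          using r by (intro dilation_in_bergman_space wt hol q) auto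
        then show "(\<lambda>z. norm (dilation r f z) powr q * \<omega> z) \<in> borel_measurable disc_area"
          by (auto simp: bergman_space_def)
      qed (auto intro!: AE_I2 simp: space_disc_area \<omega>0)
      finally show ?thesis .
    qed
    have "(\<integral>\<^sup>+ r\<in>{0<..<1}.
        ennreal (weight_mass \<omega> (carleson_square (of_real r)) powr (lam * (1 / p - 1 / q)) *
                 bergman_norm q \<omega> (dilation r f) powr lam / (1 - r)) \<partial>lebesgue) \<le>
      (\<integral>\<^sup>+r\<in>{0<..<1}. ennreal ((m r powr (1 - 1 / s) * (\<integral>x. g r x powr s \<partial>Y) powr (1 / s)) powr \<kappa> / (1 - r)) \<partial>lebesgue)"
    proof (rule nn_integral_mono)
      fix r :: real
      show "ennreal (weight_mass \<omega> (carleson_square (of_real r)) powr (lam * (1 / p - 1 / q)) *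
                 bergman_norm q \<omega> (dilation r f) powr lam / (1 - r)) * indicator {0<..<1} r \<le>
        ennreal ((m r powr (1 - 1 / s) * (\<integral>x. g r x powr s \<partial>Y) powr (1 / s)) powr \<kappa> / (1 - r)) * indicator {0<..<1} r"
      proof (cases "r \<in> {0<..<1}")
        case True
        then have r: "0 < r" "r < 1" by auto
        define G where "G = (\<integral>x. g r x powr s \<partial>Y)"
        have G: "bergman_norm q \<omega> (dilation r f) powr lam = (G powr (1 / s)) powr \<kappa>"
          using assms by (simp add: bergman_norm_def G_def gint[OF r] powr_powr s(3) \<kappa>_def)
        \<comment> \<open>With \<open>s = q / p\<close> and \<open>\<kappa> = lam / p\<close>, the
          power of the mass and the power of the norm acquire the common outer exponent
          \<open>\<kappa>\<close>.\<close>
        have e1: "lam * (1 / p - 1 / q) = (1 - 1 / s) * \<kappa>"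
          using assms unfolding s(3) by (simp add: \<kappa>_def field_simps)
        have "0 \<le> (1 - 1 / s) * \<kappa>" using s(1) \<kappa> by simp
        then have "weight_mass \<omega> (carleson_square (of_real r)) powr (lam * (1 / p - 1 / q)) \<le> (m r powr (1 - 1 / s)) powr \<kappa>"
          unfolding e1 powr_powr using wm[OF r] wm0 by (intro powr_mono2) auto
        then have "weight_mass \<omega> (carleson_square (of_real r)) powr (lam * (1 / p - 1 / q)) * bergman_norm q \<omega> (dilation r f) powr lam / (1 - r) \<le>
            (m r powr (1 - 1 / s)) powr \<kappa> * (G powr (1 / s)) powr \<kappa> / (1 - r)"
          unfolding G using r by (intro divide_right_mono mult_right_mono) auto
        also have "(m r powr (1 - 1 / s)) powr \<kappa> * (G powr (1 / s)) powr \<kappa> = (m r powr (1 - 1 / s) * G powr (1 / s)) powr \<kappa>"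
          by (simp add: powr_mult)
        finally show ?thesis using True by (auto simp: G_def intro!: ennreal_leI)
      qed simp
    qed
    also have "\<dots> \<le> ennreal ((c powr (1 - 1 / s)) powr \<kappa> / (1 - 1 / s) * (C1 * N) powr \<kappa>)"
      using C1 N0 gh gB mass m0 scal
      by (intro sublevel_embedding[OF finY hm hN _ gm _ _ _ mm _ _ c _ s(1) \<kappa>]) (auto simp: g_def)
    also have "(c powr (1 - 1 / s)) powr \<kappa> / (1 - 1 / s) * (C1 * N) powr \<kappa> = K * N powr \<kappa>"
      using C1 N0 by (simp add: K_def powr_mult)
    also have "N powr \<kappa> = bergman_norm p \<omega> f powr lam"
      using assms by (simp add: bergman_norm_def N_def powr_powr \<kappa>_def)
    finally show ?thesis .
  qed
  with K show ?thesis by blast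
qed

end
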